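(* The Penrose limit of a Lorentzian metric $g$ along a (null) homogeneous geodesic $\gamma$ is homogeneous.
   Context: Let $(M,g)$ be a smooth Lorentzian manifold of dimension $n+1$ and $\gamma$ a null geodesic. Near any point of $\gamma$ there are coordinates $(u,v,y^1,\dots,y^{n-1})$, with $\gamma$ given by $(u,0,0)$, in which $$g = du\,dv+\alpha\,dv^2+\sum_i\beta_i\,dy^i dv+\sum_{i,j}C_{ij}\,dy^i dy^j,$$ where $\alpha,\beta_i,C_{ij}$ are functions of $(u,v,y)$ and $(C_{ij})$ is positive definite. For $\Omega>0$ let $\phi_\Omega(u,v,y)=(u,\Omega^2 v,\Omega y)$ in these coordinates. Patching such neighbourhoods along $\gamma$, the Penrose limit of $(M,g)$ along $\gamma$ is a tubular neighbourhood of $\gamma$ with the metric $$g_{Pl}=\lim_{\Omega\to0}\Omega^{-2}\phi_\Omega^*g=du\,dv+\sum_{i,j}C_{ij}(u,0,0)\,dy^i dy^j .$$ A geodesic is called homogeneous if it is the orbit of a 1-parameter subgroup of isometries. A connected Lorentzian manifold is called homogeneous if its group of isometries acts transitively on it. *)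

theory Defs
  imports "HOL-Analysis.Analysis"
begin

section \<open>Smooth maps between Euclidean spaces\<close>

text \<open>Meant for open \<open>S\<close> and finite-dimensional \<open>'a\<close>, where it is the usual notion of
  a \<open>C\<^sup>k\<close> map.\<close>

primrec Ck_on :: "nat \<Rightarrow> 'a::real_normed_vector set \<Rightarrow> ('a \<Rightarrow> 'b::real_normed_vector) \<Rightarrow> bool" where
  "Ck_on 0 S f \<longleftrightarrow> continuous_on S f"
| "Ck_on (Suc k) S f \<longleftrightarrow>
     (\<forall>x\<in>S. f differentiable (at x)) \<and> (\<forall>v. Ck_on k S (\<lambda>x. frechet_derivative f (at x) v))"

definition smooth_on :: "'a::real_normed_vector set \<Rightarrow> ('a \<Rightarrow> 'b::real_normed_vector) \<Rightarrow> bool" where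
  "smooth_on S f \<longleftrightarrow> open S \<and> (\<forall>k. Ck_on k S f)"

definition pullback_form ::
  "(real^'m \<Rightarrow> real^'m) \<Rightarrow> (real^'m \<Rightarrow> real^'m^'m) \<Rightarrow> real^'m \<Rightarrow> real^'m^'m" where
  "pullback_form f B q = transpose (jacobian f (at q)) ** B (f q) ** jacobian f (at q)"


section \<open>Lorentzian manifolds\<close>

text \<open>A chart is a pair of a domain and a coordinate map, whose values outside the domain are
  irrelevant. The metric is given by its component matrix with respect to each
  chart of the (maximal) atlas, as a function on the chart domain.\<close>

type_synonym ('a, 'm) chart = "'a set \<times> ('a \<Rightarrow> real^'m)"

record ('a, 'm) metric_mfd =
  top_of :: "'a topology"
  charts :: "('a, 'm) chart set"
  metric :: "('a, 'm) chart \<Rightarrow> 'a \<Rightarrow> real^'m^'m"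

definition chart_on :: "'a topology \<Rightarrow> ('a, 'm::finite) chart \<Rightarrow> bool" where
  "chart_on X = (\<lambda>(D, x). openin X D \<and> open (x ` D) \<and>
     homeomorphic_map (subtopology X D) (top_of_set (x ` D)) x)"

definition smooth_compatible :: "('a, 'm::finite) chart \<Rightarrow> ('a, 'm) chart \<Rightarrow> bool" where
  "smooth_compatible = (\<lambda>(D, x) (E, y).
     smooth_on (x ` (D \<inter> E)) (y \<circ> inv_into D x) \<and> smooth_on (y ` (D \<inter> E)) (x \<circ> inv_into E y))"

definition smooth_structure :: "'a topology \<Rightarrow> ('a, 'm::finite) chart set \<Rightarrow> bool" where
  "smooth_structure X A \<longleftrightarrow>
     (\<Union>c\<in>A. fst c) = topspace X \<and>
     (\<forall>c\<in>A. chart_on X c) \<and>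
     (\<forall>c\<in>A. \<forall>c'\<in>A. smooth_compatible c c') \<and>
     (\<forall>c. chart_on X c \<and> (\<forall>c'\<in>A. smooth_compatible c c') \<longrightarrow> c \<in> A)"

definition local_metric :: "('a, 'm::finite) metric_mfd \<Rightarrow> ('a, 'm) chart \<Rightarrow> real^'m \<Rightarrow> real^'m^'m" where
  "local_metric M c q = metric M c (inv_into (fst c) (snd c) q)"

definition lorentzian_form :: "real^'m::finite^'m \<Rightarrow> bool" where
  "lorentzian_form G \<longleftrightarrow> transpose G = G \<and>
     (\<exists>(P :: real^'m^'m) e. invertible P \<and>
       transpose P ** G ** P = (\<chi> i j. if i = j then (if i = e then - 1 else 1) else 0))"

definition lorentzian_manifold :: "('a, 'm::finite) metric_mfd \<Rightarrow> bool" where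
  "lorentzian_manifold M \<longleftrightarrow>
     Hausdorff_space (top_of M) \<and> second_countable (top_of M) \<and>
     smooth_structure (top_of M) (charts M) \<and>
     (\<forall>c\<in>charts M. smooth_on (snd c ` fst c) (local_metric M c)) \<and>
     (\<forall>c\<in>charts M. \<forall>p\<in>fst c. lorentzian_form (metric M c p)) \<and>
     (\<forall>c\<in>charts M. \<forall>c'\<in>charts M. \<forall>p\<in>fst c \<inter> fst c'.
        metric M c p = pullback_form (snd c' \<circ> inv_into (fst c) (snd c)) (local_metric M c') (snd c p))"

definition smooth_map ::
  "('a, 'm::finite) metric_mfd \<Rightarrow> ('b, 'm) metric_mfd \<Rightarrow> ('a \<Rightarrow> 'b) \<Rightarrow> bool" where
  "smooth_map M N f \<longleftrightarrow> continuous_map (top_of M) (top_of N) f \<and>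
     (\<forall>(D, x)\<in>charts M. \<forall>(E, y)\<in>charts N.
        smooth_on (x ` {p \<in> D. f p \<in> E}) (y \<circ> f \<circ> inv_into D x))"

definition isometry ::
  "('a, 'm::finite) metric_mfd \<Rightarrow> ('b, 'm) metric_mfd \<Rightarrow> ('a \<Rightarrow> 'b) \<Rightarrow> bool" where
  "isometry M N f \<longleftrightarrow>
     bij_betw f (topspace (top_of M)) (topspace (top_of N)) \<and>
     smooth_map M N f \<and> smooth_map N M (inv_into (topspace (top_of M)) f) \<and>
     (\<forall>c\<in>charts M. \<forall>c'\<in>charts N. \<forall>p\<in>fst c. f p \<in> fst c' \<longrightarrow>
        metric M c p = pullback_form (snd c' \<circ> f \<circ> inv_into (fst c) (snd c)) (local_metric N c') (snd c p))"

definition homogeneous :: "('a, 'm::finite) metric_mfd \<Rightarrow> bool" where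
  "homogeneous M \<longleftrightarrow> connected_space (top_of M) \<and>
     (\<forall>p\<in>topspace (top_of M). \<forall>q\<in>topspace (top_of M). \<exists>f. isometry M M f \<and> f p = q)"


section \<open>Null geodesics and homogeneous geodesics\<close>

definition metric_partial ::
  "('a, 'm::finite) metric_mfd \<Rightarrow> ('a, 'm) chart \<Rightarrow> real^'m \<Rightarrow> 'm \<Rightarrow> 'm \<Rightarrow> 'm \<Rightarrow> real" where
  "metric_partial M c q l i j =
     frechet_derivative (\<lambda>z. local_metric M c z $ i $ j) (at q) (axis l 1)"

definition christoffel ::
  "('a, 'm::finite) metric_mfd \<Rightarrow> ('a, 'm) chart \<Rightarrow> real^'m \<Rightarrow> 'm \<Rightarrow> 'm \<Rightarrow> 'm \<Rightarrow> real" where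
  "christoffel M c q k i j =
     (\<Sum>l\<in>UNIV. matrix_inv (local_metric M c q) $ k $ l *
        (metric_partial M c q i j l + metric_partial M c q j i l - metric_partial M c q l i j)) / 2"

text \<open>The parameter is affine, and \<open>I\<close> need not be the maximal interval of definition.\<close>

definition geodesic :: "('a, 'm::finite) metric_mfd \<Rightarrow> (real \<Rightarrow> 'a) \<Rightarrow> real set \<Rightarrow> bool" where
  "geodesic M \<gamma> I \<longleftrightarrow>
     open I \<and> is_interval I \<and> I \<noteq> {} \<and> continuous_map (top_of_set I) (top_of M) \<gamma> \<and>
     (\<forall>(D, x)\<in>charts M.
        smooth_on {t \<in> I. \<gamma> t \<in> D} (x \<circ> \<gamma>) \<and>
        (\<forall>t\<in>I. \<gamma> t \<in> D \<longrightarrow>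
          (let w = vector_derivative (x \<circ> \<gamma>) (at t);
               a = vector_derivative (\<lambda>s. vector_derivative (x \<circ> \<gamma>) (at s)) (at t)
           in \<forall>k. a $ k + (\<Sum>i\<in>UNIV. \<Sum>j\<in>UNIV.
                      christoffel M (D, x) (x (\<gamma> t)) k i j * w $ i * w $ j) = 0)))"

definition null_geodesic :: "('a, 'm::finite) metric_mfd \<Rightarrow> (real \<Rightarrow> 'a) \<Rightarrow> real set \<Rightarrow> bool" where
  "null_geodesic M \<gamma> I \<longleftrightarrow> geodesic M \<gamma> I \<and>
     (\<forall>(D, x)\<in>charts M. \<forall>t\<in>I. \<gamma> t \<in> D \<longrightarrow>
        (let w = vector_derivative (x \<circ> \<gamma>) (at t)
         in w \<noteq> 0 \<and> w \<bullet> (metric M (D, x) (\<gamma> t) *v w) = 0))"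

definition one_parameter_isometries ::
  "('a, 'm::finite) metric_mfd \<Rightarrow> (real \<Rightarrow> 'a \<Rightarrow> 'a) \<Rightarrow> bool" where
  "one_parameter_isometries M \<Phi> \<longleftrightarrow>
     (\<forall>s. isometry M M (\<Phi> s)) \<and>
     (\<forall>s t. \<forall>p\<in>topspace (top_of M). \<Phi> (s + t) p = \<Phi> s (\<Phi> t p)) \<and>
     continuous_map (prod_topology euclideanreal (top_of M)) (top_of M) (\<lambda>(s, p). \<Phi> s p) \<and>
     (\<forall>(D, x)\<in>charts M. \<forall>(E, y)\<in>charts M.
        smooth_on {(s, x p) | s p. p \<in> D \<and> \<Phi> s p \<in> E} (\<lambda>(s, q). y (\<Phi> s (inv_into D x q))))"

text \<open>The geodesic, after a smooth reparametrization \<open>\<tau>\<close> of its parameter interval by the whole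
  real line, is an orbit curve of a one-parameter group of isometries. In particular its image is
  an orbit; if the orbit is a closed curve, the geodesic winds around it as the group does,
  and not merely finitely often.\<close>

definition homogeneous_geodesic :: "('a, 'm::finite) metric_mfd \<Rightarrow> (real \<Rightarrow> 'a) \<Rightarrow> real set \<Rightarrow> bool" where
  "homogeneous_geodesic M \<gamma> I \<longleftrightarrow> geodesic M \<gamma> I \<and>
     (\<exists>\<Phi> \<tau>. one_parameter_isometries M \<Phi> \<and>
        smooth_on UNIV \<tau> \<and> (\<forall>s. deriv \<tau> s \<noteq> 0) \<and> range \<tau> = I \<and>
        (\<forall>s. \<gamma> (\<tau> s) = \<Phi> s (\<gamma> (\<tau> 0))))"


section \<open>Penrose limits\<close>

text \<open>The labels \<open>U\<close> and \<open>V\<close> (assumed distinct in the theorem) are the indices of the coordinates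
  \<open>u\<close> and \<open>v\<close>; all other indices belong to the \<open>y\<^sup>i\<close>, of which there may be none. The symbol
  \<open>du dv\<close> is the symmetric product, so that \<open>g\<^sub>u\<^sub>v = 1/2\<close>. The entries for \<open>(V, V)\<close> and
  \<open>(V, i)\<close>, that is \<open>\<alpha>\<close> and \<open>\<beta>\<^sub>i / 2\<close>, are unrestricted.\<close>

definition adapted_metric :: "'m \<Rightarrow> 'm \<Rightarrow> real^'m^'m \<Rightarrow> bool" where
  "adapted_metric U V G \<longleftrightarrow>
     transpose G = G \<and> G $ U $ U = 0 \<and> G $ U $ V = 1 / 2 \<and>
     (\<forall>i. i \<noteq> U \<and> i \<noteq> V \<longrightarrow> G $ U $ i = 0) \<and>
     (\<forall>w. w $ U = 0 \<and> w $ V = 0 \<and> w \<noteq> 0 \<longrightarrow> 0 < w \<bullet> (G *v w))"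

definition adapted_chart ::
  "'m \<Rightarrow> 'm \<Rightarrow> ('a, 'm::finite) metric_mfd \<Rightarrow> (real \<Rightarrow> 'a) \<Rightarrow> real set \<Rightarrow> ('a, 'm) chart \<Rightarrow> bool" where
  "adapted_chart U V M \<gamma> J c \<longleftrightarrow> c \<in> charts M \<and>
     open J \<and> is_interval J \<and> J \<noteq> {} \<and>
     (\<forall>u\<in>J. \<gamma> u \<in> fst c \<and> snd c (\<gamma> u) = axis U u) \<and>
     (\<forall>p\<in>fst c. adapted_metric U V (metric M c p))"

definition dilate :: "'m \<Rightarrow> 'm \<Rightarrow> real \<Rightarrow> real^'m \<Rightarrow> real^'m" where
  "dilate U V \<Omega> q = (\<chi> i. if i = U then q $ i else if i = V then \<Omega>\<^sup>2 * q $ i else \<Omega> * q $ i)"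

text \<open>\<open>penrose_limit U V M \<gamma> I N\<close>: the manifold \<open>N\<close> is obtained by patching limits along all of
  \<open>\<gamma>\<close>. The patches are triples \<open>(J, c, d)\<close> consisting of a parameter interval \<open>J\<close>, a chart
  \<open>c\<close> of \<open>M\<close> adapted to \<open>\<gamma>\<close> over \<open>J\<close>, and a chart \<open>d\<close> of \<open>N\<close> with image \<open>{u \<in> J}\<close>: as
  \<open>\<Omega> \<rightarrow> 0\<close>, the domains of the rescaled metrics in the coordinates \<open>c\<close> exhaust the slab over
  \<open>J\<close>. In \<open>d\<close> the metric of \<open>N\<close> is the limit of the rescaled metrics. Two patches are
  glued exactly over the common part of their parameter intervals, by the limit of the
  coordinate changes of \<open>M\<close> conjugated with the dilations, which are isometries between the
  rescaled metrics.\<close>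

definition penrose_limit ::
  "'m \<Rightarrow> 'm \<Rightarrow> ('a, 'm::finite) metric_mfd \<Rightarrow> (real \<Rightarrow> 'a) \<Rightarrow> real set \<Rightarrow> ('b, 'm) metric_mfd \<Rightarrow> bool" where
  "penrose_limit U V M \<gamma> I N \<longleftrightarrow> lorentzian_manifold N \<and>
     (\<exists>P. (\<Union>(J, c, d)\<in>P. J) = I \<and> (\<Union>(J, c, d)\<in>P. fst d) = topspace (top_of N) \<and>
        (\<forall>(J, c, d)\<in>P.
           adapted_chart U V M \<gamma> J c \<and>
           d \<in> charts N \<and> snd d ` fst d = {q. q $ U \<in> J} \<and>
           (\<forall>q. q $ U \<in> J \<longrightarrow>
              ((\<lambda>\<Omega>. (1 / \<Omega>\<^sup>2) *\<^sub>R pullback_form (dilate U V \<Omega>) (local_metric M c) q)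
                 \<longlongrightarrow> local_metric N d q) (at_right 0))) \<and>
        (\<forall>(J, c, d)\<in>P. \<forall>(J', c', d')\<in>P.
           fst d \<inter> fst d' = {p \<in> fst d. snd d p $ U \<in> J'} \<and>
           (\<forall>q. q $ U \<in> J \<inter> J' \<longrightarrow>
              ((\<lambda>\<Omega>. dilate U V (1 / \<Omega>)
                     (snd c' (inv_into (fst c) (snd c) (dilate U V \<Omega> q))))
                 \<longlongrightarrow> snd d' (inv_into (fst d) (snd d) q)) (at_right 0))))"

end

theory Submission
  imports Defs
begin

text \<open>In each patch the Penrose limit is a Rosen metric
  \<open>du dv + C\<^sub>i\<^sub>j(u) dy\<^sup>i dy\<^sup>j\<close>. Two families of isometries make it homogeneous.

  Within a slice \<open>u = const\<close>, a patch carries the Heisenberg group of isometries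
  \<open>y \<mapsto> y + b(u)\<close>, \<open>v \<mapsto> v - 2 c \<bullet> y - c \<bullet> b(u) + k\<close> with \<open>C b' = c\<close> constant. They are exactly
  the isometries that preserve \<open>u\<close> and translate \<open>y\<close>, a description independent of the patch; each is
  determined by its restriction to a thin slab and extends over an entire patch. Connectedness of the
  parameter interval then extends a translation of one slab to a global isometry.

  Across the slices, an isometry of \<open>M\<close> that moves \<open>\<gamma>\<close> along itself, written in adapted charts
  and conjugated with the dilations, converges to an isometry of the limit metrics. Second-order Taylor
  expansion along the axis gives the limit and the limit of its Jacobian. As the convergence is
  continuous, limits of composites are composites of limits; hence the local limits do not depend on the
  patches and the limits for \<open>s\<close> and \<open>-s\<close> are mutually inverse.\<close>

subsection \<open>Calculus of smooth maps\<close>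

text \<open>Conjugation with the dilations divides the \<open>v\<close>-entry of an isometry by
  \<Omega>^2, so a limit exists only if that entry vanishes on the axis together with its transverse
  first derivatives. The adapted form guarantees this: there pairing with
  \<open>\<partial>_u\<close> is \<open>dv / 2\<close>, and a map carrying axis to axis sends
  \<open>\<partial>_u\<close> to a multiple of \<open>\<partial>_u\<close>; invariance of the
  pairing forces the vanishing. Changes of adapted charts of \<open>M\<close> also carry axis to
  axis. They are the time-zero case of the same construction, so a single analysis yields both the
  flow and the gluing of the limit. In particular the glued transitions are linear in
  \<open>y\<close>, which is why "translating \<open>y\<close>" means the same in every patch. The
  constant \<open>c\<close> is the transverse momentum: \<open>(C b')' = 0\<close> is the transverse
  geodesic equation of a Rosen metric, whose coefficients do not depend on \<open>y\<close>. As
  \<open>C b' = c\<close> is solved by one integration, extension over a patch meets no blow-up; as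
  intersections of parameter intervals are connected, continuation along \<open>I\<close> meets no
  monodromy.\<close>

abbreviation dd :: "'a::real_normed_vector \<Rightarrow> ('a \<Rightarrow> 'b::real_normed_vector) \<Rightarrow> 'a \<Rightarrow> 'b" where
  "dd v f \<equiv> \<lambda>x. frechet_derivative f (at x) v"

text \<open>\<open>frechet_derivative\<close> is a choice among all derivatives, so functions with
  the same derivatives get the same value; the second claim therefore holds even without
  differentiability.\<close>

lemma frechet_derivative_transform_open:
  assumes "open S" "x \<in> S" "\<And>y. y \<in> S \<Longrightarrow> f y = g y"
  shows "f differentiable (at x) \<longleftrightarrow> g differentiable (at x)"
    and "frechet_derivative f (at x) = frechet_derivative g (at x)"
proof -
  have *: "(f has_derivative D) (at x) \<longleftrightarrow> (g has_derivative D) (at x)" for D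
    using has_derivative_transform_within_open[OF _ assms(1,2)] assms(3)
    by (metis (no_types, lifting))
  show "f differentiable (at x) \<longleftrightarrow> g differentiable (at x)"
    using * by (simp add: differentiable_def)
  show "frechet_derivative f (at x) = frechet_derivative g (at x)"
    using * by (simp add: frechet_derivative_def)
qed

text \<open>\<open>Ck_on\<close> takes derivatives in the whole space, so agreement on
  \<open>S\<close> helps because \<open>S\<close> is a neighbourhood of each of its points.\<close>

lemma Ck_on_cong:
  assumes "open S" "\<And>x. x \<in> S \<Longrightarrow> f x = g x" "Ck_on k S f"
  shows "Ck_on k S g"
  using assms(2,3)
proof (induction k arbitrary: f g)
  case 0
  then show ?case using continuous_on_cong by fastforce
next
  case (Suc k)
  have eq: "frechet_derivative f (at x) = frechet_derivative g (at x)" if "x \<in> S" for x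
    using frechet_derivative_transform_open[OF assms(1) that] Suc.prems(1) by blast
  have "Ck_on k S (dd v g)" for v
    using Suc.IH[of "dd v f" "dd v g"] Suc.prems(2) eq by auto
  moreover have "g differentiable (at x)" if "x \<in> S" for x
    using frechet_derivative_transform_open(1)[OF assms(1) that, of f g] Suc.prems that by auto
  ultimately show ?case by simp
qed

lemma Ck_on_continuous_on: "Ck_on k S f \<Longrightarrow> continuous_on S f"
  by (cases k) (simp_all add: continuous_at_imp_continuous_on differentiable_imp_continuous_within)

lemma Ck_on_pred: "Ck_on (Suc k) S f \<Longrightarrow> Ck_on k S f"
proof (induction k arbitrary: f)
  case 0
  then show ?case using Ck_on_continuous_on by (metis Ck_on.simps(1))
next
  case (Suc k)
  from Suc.prems have "\<forall>x\<in>S. f differentiable (at x)" and *: "\<forall>v. Ck_on (Suc k) S (dd v f)"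
    unfolding Ck_on.simps(2)[of "Suc k" S f] by blast+
  moreover have "\<forall>v. Ck_on k S (dd v f)" using Suc.IH * by blast
  ultimately show ?case by simp
qed

lemma Ck_on_subset: "Ck_on k S f \<Longrightarrow> T \<subseteq> S \<Longrightarrow> Ck_on k T f"
proof (induction k arbitrary: f)
  case 0
  then show ?case using continuous_on_subset by auto
next
  case (Suc k)
  then show ?case by (simp add: subset_eq)
qed

lemma Ck_on_local:
  assumes "\<And>x. x \<in> S \<Longrightarrow> \<exists>T. open T \<and> x \<in> T \<and> Ck_on k T f"
  shows "Ck_on k S f"
  using assms
proof (induction k arbitrary: f)
  case 0
  then show ?case
    by (metis Ck_on.simps(1) at_within_open continuous_at_imp_continuous_on
        continuous_on_eq_continuous_within)
next
  case (Suc k)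
  have "Ck_on k S (dd v f)" for v
    using Suc.prems by (intro Suc.IH) (metis Ck_on.simps(2))
  moreover have "\<forall>x\<in>S. f differentiable (at x)"
    using Suc.prems by (metis Ck_on.simps(2))
  ultimately show ?case by simp
qed

lemma Ck_on_const: "Ck_on k S (\<lambda>x. c)"
proof (induction k arbitrary: c)
  case (Suc k)
  have "frechet_derivative (\<lambda>x. c) (at x) v = 0" for x v
    by (simp add: frechet_derivative_const)
  then show ?case using Suc by simp
qed simp

lemma Ck_on_linear:
  assumes "bounded_linear f"
  shows "Ck_on k S f"
proof (cases k)
  case 0
  then show ?thesis using assms by (simp add: linear_continuous_on)
next
  case (Suc k)
  have "frechet_derivative f (at x) = f" for x
    by (metis assms bounded_linear_imp_has_derivative frechet_derivative_at)
  then show ?thesis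
    using Suc assms by (simp add: Ck_on_const bounded_linear_imp_differentiable)
qed

lemma Ck_on_add:
  assumes "open S" "Ck_on k S f" "Ck_on k S g"
  shows "Ck_on k S (\<lambda>x. f x + g x)"
  using assms(2,3)
proof (induction k arbitrary: f g)
  case 0
  then show ?case by (simp add: continuous_on_add)
next
  case (Suc k)
  have der: "((\<lambda>x. f x + g x) has_derivative (\<lambda>h. dd h f x + dd h g x)) (at x)" if "x \<in> S" for x
    using Suc.prems that by (intro has_derivative_add) (auto simp: frechet_derivative_works[symmetric])
  have "Ck_on k S (dd v (\<lambda>x. f x + g x))" for v
  proof (rule Ck_on_cong[OF assms(1)])
    show "Ck_on k S (\<lambda>x. dd v f x + dd v g x)" using Suc by auto
    show "dd v f x + dd v g x = dd v (\<lambda>x. f x + g x) x" if "x \<in> S" for x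
      by (rule fun_cong[OF frechet_derivative_at[OF der[OF that]]])
  qed
  then show ?case using Suc.prems by auto
qed

lemma Ck_on_sum:
  assumes "open S" "\<And>i. i \<in> A \<Longrightarrow> Ck_on k S (f i)"
  shows "Ck_on k S (\<lambda>x. \<Sum>i\<in>A. f i x)"
  using assms(2)
  by (induction A rule: infinite_finite_induct) (simp_all add: Ck_on_const Ck_on_add[OF assms(1)])

text \<open>One induction covers all products in use. The Leibniz rule contains \<open>f\<close> and
  \<open>g\<close> themselves beside their derivatives, hence the descent by
  \<open>Ck_on_pred\<close>.\<close>

lemma (in bounded_bilinear) Ck_on:
  assumes "open S" "Ck_on k S f" "Ck_on k S g"
  shows "Ck_on k S (\<lambda>x. prod (f x) (g x))"
  using assms(2,3)
proof (induction k arbitrary: f g)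
  case 0
  then show ?case by (simp add: continuous_on)
next
  case (Suc k)
  have der: "((\<lambda>x. prod (f x) (g x)) has_derivative
     (\<lambda>h. prod (f x) (dd h g x) + prod (dd h f x) (g x))) (at x)" if "x \<in> S" for x
    using Suc.prems that by (intro FDERIV) (auto simp: frechet_derivative_works[symmetric])
  have "Ck_on k S (dd v (\<lambda>x. prod (f x) (g x)))" for v
  proof (rule Ck_on_cong[OF assms(1)])
    show "Ck_on k S (\<lambda>x. prod (f x) (dd v g x) + prod (dd v f x) (g x))"
      using Suc.prems Ck_on_pred[of k S f] Ck_on_pred[of k S g]
      by (intro Ck_on_add[OF assms(1)] Suc.IH) auto
    show "prod (f x) (dd v g x) + prod (dd v f x) (g x) = dd v (\<lambda>x. prod (f x) (g x)) x"
      if "x \<in> S" for x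
      by (rule fun_cong[OF frechet_derivative_at[OF der[OF that]]])
  qed
  then show ?case using der by (auto simp: differentiable_def)
qed

lemmas Ck_on_scaleR = bounded_bilinear.Ck_on[OF bounded_bilinear_scaleR]
lemmas Ck_on_mult = bounded_bilinear.Ck_on[OF bounded_bilinear_mult]

text \<open>\<open>Ck_on\<close> controls derivatives in fixed directions, whereas the chain rule
  produces a direction that moves with the point; the expansion turns it into scalar coefficients of
  fixed directions.\<close>

lemma frechet_derivative_basis_expansion:
  fixes g :: "'b::euclidean_space \<Rightarrow> 'c::real_normed_vector"
  assumes "g differentiable (at y)"
  shows "frechet_derivative g (at y) w = (\<Sum>b\<in>Basis. (w \<bullet> b) *\<^sub>R frechet_derivative g (at y) b)"
proof -
  interpret bounded_linear "frechet_derivative g (at y)"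
    using assms by (metis frechet_derivative_works has_derivative_bounded_linear)
  have "frechet_derivative g (at y) w = frechet_derivative g (at y) (\<Sum>b\<in>Basis. (w \<bullet> b) *\<^sub>R b)"
    by (simp add: euclidean_representation)
  then show ?thesis by (simp add: sum scaleR)
qed

lemma Ck_on_compose:
  fixes f :: "'a::real_normed_vector \<Rightarrow> 'b::euclidean_space" and g :: "'b \<Rightarrow> 'c::real_normed_vector"
  assumes "open S" "open T" "Ck_on k S f" "Ck_on k T g" "f ` S \<subseteq> T"
  shows "Ck_on k S (\<lambda>x. g (f x))"
  using assms(3,4)
proof (induction k arbitrary: g)
  case 0
  then show ?case using continuous_on_compose2[OF _ _ assms(5)] by simp
next
  case (Suc k)
  have der: "((\<lambda>x. g (f x)) has_derivative (\<lambda>h. frechet_derivative g (at (f x)) (dd h f x))) (at x)"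
    if "x \<in> S" for x
    using Suc.prems that assms(5)
    by (intro has_derivative_compose[where f=f and g=g]) (auto simp: frechet_derivative_works[symmetric])
  have "Ck_on k S (dd v (\<lambda>x. g (f x)))" for v
  proof (rule Ck_on_cong[OF assms(1)])
    show "Ck_on k S (\<lambda>x. \<Sum>b\<in>Basis. (dd v f x \<bullet> b) *\<^sub>R dd b g (f x))"
    proof (intro Ck_on_sum Ck_on_scaleR assms(1))
      fix b :: 'b
      show "Ck_on k S (\<lambda>x. dd b g (f x))"
        using Suc.prems Ck_on_pred[of k S f] by (intro Suc.IH) auto
      show "Ck_on k S (\<lambda>x. dd v f x \<bullet> b)"
        using bounded_bilinear.Ck_on[OF bounded_bilinear_inner assms(1) _ Ck_on_const, of k "dd v f" b]
          Suc.prems by simp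
    qed
    show "(\<Sum>b\<in>Basis. (dd v f x \<bullet> b) *\<^sub>R dd b g (f x)) = dd v (\<lambda>x. g (f x)) x" if "x \<in> S" for x
    proof -
      have "dd v (\<lambda>x. g (f x)) x = frechet_derivative g (at (f x)) (dd v f x)"
        by (rule fun_cong[OF frechet_derivative_at[OF der[OF that]], symmetric])
      then show ?thesis
        using frechet_derivative_basis_expansion[of g "f x" "dd v f x"] Suc.prems that assms(5) by auto
    qed
  qed
  then show ?case using der by (auto simp: differentiable_def)
qed

lemma Ck_on_inverse:
  fixes f :: "'a::real_normed_vector \<Rightarrow> real"
  assumes "open S" "Ck_on k S f" "\<And>x. x \<in> S \<Longrightarrow> f x \<noteq> 0"
  shows "Ck_on k S (\<lambda>x. inverse (f x))"
  using assms(2)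
proof (induction k)
  case 0
  then show ?case using assms(3) by (simp add: continuous_on_inverse)
next
  case (Suc k)
  have der: "((\<lambda>x. inverse (f x)) has_derivative (\<lambda>h. - (inverse (f x) * dd h f x * inverse (f x)))) (at x)"
    if "x \<in> S" for x
    using Suc.prems that assms(3) by (intro Deriv.has_derivative_inverse) (auto simp: frechet_derivative_works[symmetric])
  have "Ck_on k S (dd v (\<lambda>x. inverse (f x)))" for v
  proof (rule Ck_on_cong[OF assms(1)])
    have "Ck_on k S (\<lambda>x. inverse (f x))" using Suc Ck_on_pred by blast
    then show "Ck_on k S (\<lambda>x. (-1) * (inverse (f x) * dd v f x * inverse (f x)))"
      using Suc.prems by (intro Ck_on_mult assms(1) Ck_on_const) auto
    show "(-1) * (inverse (f x) * dd v f x * inverse (f x)) = dd v (\<lambda>x. inverse (f x)) x"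
      if "x \<in> S" for x
      using fun_cong[OF frechet_derivative_at[OF der[OF that]], of v] by simp
  qed
  then show ?case using der by (auto simp: differentiable_def)
qed

lemma smooth_on_open: "smooth_on S f \<Longrightarrow> open S"
  by (simp add: smooth_on_def)

lemma smooth_on_continuous_on: "smooth_on S f \<Longrightarrow> continuous_on S f"
  unfolding smooth_on_def using Ck_on_continuous_on[of 0 S f] by blast

lemma smooth_on_differentiable: "smooth_on S f \<Longrightarrow> x \<in> S \<Longrightarrow> f differentiable (at x)"
  unfolding smooth_on_def using Ck_on.simps(2)[of 0 S f] by blast

lemma smooth_on_has_derivative:
  "smooth_on S f \<Longrightarrow> x \<in> S \<Longrightarrow> (f has_derivative frechet_derivative f (at x)) (at x)"
  by (simp add: smooth_on_differentiable frechet_derivative_works[symmetric])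

lemma smooth_on_dd: "smooth_on S f \<Longrightarrow> smooth_on S (dd v f)"
  unfolding smooth_on_def using Ck_on.simps(2)[of _ S f] by blast

lemma smooth_on_cong: "smooth_on S f \<Longrightarrow> (\<And>x. x \<in> S \<Longrightarrow> f x = g x) \<Longrightarrow> smooth_on S g"
  unfolding smooth_on_def using Ck_on_cong[of S f g] by blast

lemma smooth_on_subset: "smooth_on S f \<Longrightarrow> open T \<Longrightarrow> T \<subseteq> S \<Longrightarrow> smooth_on T f"
  unfolding smooth_on_def using Ck_on_subset[of _ S f T] by blast

lemma smooth_on_local:
  assumes "\<And>x. x \<in> S \<Longrightarrow> \<exists>T. x \<in> T \<and> T \<subseteq> S \<and> smooth_on T f"
  shows "smooth_on S f"
proof -
  have "open S" using assms smooth_on_open by (subst open_subopen) blast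
  then show ?thesis using assms Ck_on_local unfolding smooth_on_def by metis
qed

lemma smooth_on_const: "open S \<Longrightarrow> smooth_on S (\<lambda>x. c)"
  by (simp add: smooth_on_def Ck_on_const)

lemma smooth_on_linear: "open S \<Longrightarrow> bounded_linear f \<Longrightarrow> smooth_on S f"
  by (simp add: smooth_on_def Ck_on_linear)

lemma smooth_on_add: "smooth_on S f \<Longrightarrow> smooth_on S g \<Longrightarrow> smooth_on S (\<lambda>x. f x + g x)"
  by (simp add: smooth_on_def Ck_on_add)

lemma smooth_on_sum:
  "open S \<Longrightarrow> (\<And>i. i \<in> A \<Longrightarrow> smooth_on S (f i)) \<Longrightarrow> smooth_on S (\<lambda>x. \<Sum>i\<in>A. f i x)"
  by (simp add: smooth_on_def Ck_on_sum)

lemma smooth_on_scaleR: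
  "smooth_on S f \<Longrightarrow> smooth_on S g \<Longrightarrow> smooth_on S (\<lambda>x. f x *\<^sub>R g x)"
  by (simp add: smooth_on_def Ck_on_scaleR)

lemma smooth_on_mult:
  fixes f g :: "'a::real_normed_vector \<Rightarrow> real"
  shows "smooth_on S f \<Longrightarrow> smooth_on S g \<Longrightarrow> smooth_on S (\<lambda>x. f x * g x)"
  by (simp add: smooth_on_def Ck_on_mult)

lemma smooth_on_prod:
  fixes f :: "'i \<Rightarrow> 'a::real_normed_vector \<Rightarrow> real"
  assumes "open S" "\<And>i. i \<in> A \<Longrightarrow> smooth_on S (f i)"
  shows "smooth_on S (\<lambda>x. \<Prod>i\<in>A. f i x)"
  using assms(2)
  by (induction A rule: infinite_finite_induct)
    (simp_all add: smooth_on_const assms(1) smooth_on_mult)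

lemma smooth_on_divide:
  fixes f g :: "'a::real_normed_vector \<Rightarrow> real"
  assumes "smooth_on S f" "smooth_on S g" "\<And>x. x \<in> S \<Longrightarrow> g x \<noteq> 0"
  shows "smooth_on S (\<lambda>x. f x / g x)"
  using smooth_on_mult[OF assms(1), of "\<lambda>x. inverse (g x)"] assms
  by (simp add: divide_inverse smooth_on_def Ck_on_inverse)

lemma smooth_on_compose:
  fixes f :: "'a::real_normed_vector \<Rightarrow> 'b::euclidean_space"
  assumes "smooth_on S f" "smooth_on T g" "f ` S \<subseteq> T"
  shows "smooth_on S (\<lambda>x. g (f x))"
  using assms Ck_on_compose[of S T _ f g] by (auto simp: smooth_on_def)

lemma smooth_on_vec_nth: "smooth_on S f \<Longrightarrow> smooth_on S (\<lambda>x. f x $ i)"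
  for f :: "'a::real_normed_vector \<Rightarrow> 'b::euclidean_space^'n::finite"
  using smooth_on_compose[OF _ smooth_on_linear[OF open_UNIV bounded_linear_vec_nth]] by auto

lemma smooth_on_vec_lambda:
  fixes f :: "'i::finite \<Rightarrow> 'a::real_normed_vector \<Rightarrow> real"
  assumes "open S" "\<And>i. smooth_on S (f i)"
  shows "smooth_on S (\<lambda>x. \<chi> i. f i x)"
proof -
  have "(\<chi> i. f i x) = (\<Sum>i\<in>UNIV. f i x *\<^sub>R axis i 1)" for x
    by (simp add: vec_eq_iff axis_def sum.delta if_distrib cong: if_cong)
  then show ?thesis
    by (simp add: assms smooth_on_sum smooth_on_scaleR smooth_on_const)
qed

lemma frechet_derivative_vec_nth:
  assumes "f differentiable (at x)"
  shows "frechet_derivative (\<lambda>x. f x $ i) (at x) v = frechet_derivative f (at x) v $ i"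
proof -
  have "((\<lambda>x. f x $ i) has_derivative (\<lambda>v. frechet_derivative f (at x) v $ i)) (at x)"
    using assms bounded_linear.has_derivative[OF bounded_linear_vec_nth, of f "frechet_derivative f (at x)"]
    by (simp add: frechet_derivative_works)
  from fun_cong[OF frechet_derivative_at[OF this]] show ?thesis by simp
qed

section \<open>Symmetry of second derivatives\<close>

lemma second_difference_mvt:
  fixes f :: "'a::real_normed_vector \<Rightarrow> real"
  assumes f: "Ck_on (Suc (Suc 0)) (ball x r) f" and h: "0 < h" "h * (norm v + norm w) < r"
  shows "\<exists>z. norm (z - x) \<le> h * (norm v + norm w) \<and>
     f (x + h *\<^sub>R v + h *\<^sub>R w) - f (x + h *\<^sub>R v) - f (x + h *\<^sub>R w) + f x = h * h * dd w (dd v f) z"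
proof -
  have inb: "x + s *\<^sub>R v + t *\<^sub>R w \<in> ball x r" "norm (s *\<^sub>R v + t *\<^sub>R w) \<le> h * (norm v + norm w)"
    if "0 \<le> s" "s \<le> h" "0 \<le> t" "t \<le> h" for s t
  proof -
    have "norm (s *\<^sub>R v + t *\<^sub>R w) \<le> s * norm v + t * norm w"
      using norm_triangle_ineq[of "s *\<^sub>R v" "t *\<^sub>R w"] that by simp
    also have "\<dots> \<le> h * norm v + h * norm w"
      using that by (intro add_mono mult_right_mono) auto
    finally show le: "norm (s *\<^sub>R v + t *\<^sub>R w) \<le> h * (norm v + norm w)" by (simp add: algebra_simps)
    have "dist x (x + s *\<^sub>R v + t *\<^sub>R w) = norm (s *\<^sub>R v + t *\<^sub>R w)"
      by (simp add: dist_norm) (metis add.assoc add_diff_cancel_left' norm_minus_commute minus_add_distrib diff_diff_eq norm_minus_cancel uminus_add_conv_diff)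
    then show "x + s *\<^sub>R v + t *\<^sub>R w \<in> ball x r" using le h by simp
  qed
  have df: "(f has_derivative frechet_derivative f (at z)) (at z)" if "z \<in> ball x r" for z
    using f that by (auto simp: frechet_derivative_works[symmetric])
  have ddf: "(dd v f has_derivative frechet_derivative (dd v f) (at z)) (at z)" if "z \<in> ball x r" for z
    using f that by (auto simp: frechet_derivative_works[symmetric])
  \<comment> \<open>The second difference is the increment of \<phi> over \<open>[0, h]\<close>; the
    mean value theorem in direction \<open>v\<close>, and then in direction \<open>w\<close>,
    produces the mixed derivative.\<close>
  define \<phi> where "\<phi> s = f (x + s *\<^sub>R v + h *\<^sub>R w) - f (x + s *\<^sub>R v)" for s
  define \<phi>' where "\<phi>' s = dd v f (x + s *\<^sub>R v + h *\<^sub>R w) - dd v f (x + s *\<^sub>R v)" for s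
  have lin: "linear (frechet_derivative f (at z))" if "z \<in> ball x r" for z
    using df[OF that] has_derivative_linear by blast
  have lin2: "linear (frechet_derivative (dd v f) (at z))" if "z \<in> ball x r" for z
    using ddf[OF that] has_derivative_linear by blast
  have "(\<phi> has_derivative (\<lambda>t. t * \<phi>' s)) (at s within {0..h})" if s: "0 \<le> s" "s \<le> h" for s
  proof -
    have 1: "((\<lambda>s. f (x + s *\<^sub>R v + h *\<^sub>R w)) has_derivative
        (\<lambda>t. frechet_derivative f (at (x + s *\<^sub>R v + h *\<^sub>R w)) (t *\<^sub>R v))) (at s within {0..h})"
      by (rule has_derivative_compose[OF _ df]) (use s h inb[of s h] in \<open>auto intro!: derivative_eq_intros\<close>)
    have 2: "((\<lambda>s. f (x + s *\<^sub>R v)) has_derivative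
        (\<lambda>t. frechet_derivative f (at (x + s *\<^sub>R v)) (t *\<^sub>R v))) (at s within {0..h})"
      by (rule has_derivative_compose[OF _ df]) (use s h inb[of s 0] in \<open>auto intro!: derivative_eq_intros\<close>)
    have "frechet_derivative f (at (x + s *\<^sub>R v + h *\<^sub>R w)) (t *\<^sub>R v) - frechet_derivative f (at (x + s *\<^sub>R v)) (t *\<^sub>R v)
        = t * \<phi>' s" for t
      using linear_cmul[OF lin[of "x + s *\<^sub>R v + h *\<^sub>R w"]] linear_cmul[OF lin[of "x + s *\<^sub>R v"]] s h inb[of s h] inb[of s 0]
      by (simp add: \<phi>'_def algebra_simps)
    then show ?thesis using has_derivative_diff[OF 1 2] by (simp add: \<phi>_def[abs_def])
  qed
  then obtain s where s: "s \<in> {0<..<h}" "\<phi> h - \<phi> 0 = h * \<phi>' s"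
    using mvt_simple[OF h(1), of \<phi> "\<lambda>s t. t * \<phi>' s"] by auto
  have "((\<lambda>t. dd v f (x + s *\<^sub>R v + t *\<^sub>R w)) has_derivative
      (\<lambda>t'. t' * dd w (dd v f) (x + s *\<^sub>R v + t *\<^sub>R w))) (at t within {0..h})" if t: "0 \<le> t" "t \<le> h" for t
  proof -
    have 1: "((\<lambda>t. dd v f (x + s *\<^sub>R v + t *\<^sub>R w)) has_derivative
        (\<lambda>t'. frechet_derivative (dd v f) (at (x + s *\<^sub>R v + t *\<^sub>R w)) (t' *\<^sub>R w))) (at t within {0..h})"
      by (rule has_derivative_compose[OF _ ddf]) (use s t h inb[of s t] in \<open>auto intro!: derivative_eq_intros\<close>)
    then show ?thesis
      using linear_cmul[OF lin2[of "x + s *\<^sub>R v + t *\<^sub>R w"]] s t inb[of s t] by simp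
  qed
  then obtain t where t: "t \<in> {0<..<h}" "\<phi>' s = h * dd w (dd v f) (x + s *\<^sub>R v + t *\<^sub>R w)"
    using mvt_simple[OF h(1), of "\<lambda>t. dd v f (x + s *\<^sub>R v + t *\<^sub>R w)"
        "\<lambda>t t'. t' * dd w (dd v f) (x + s *\<^sub>R v + t *\<^sub>R w)"] by (auto simp: \<phi>'_def)
  show ?thesis
    by (rule exI[of _ "x + s *\<^sub>R v + t *\<^sub>R w"]) (use s t inb[of s t] in \<open>auto simp: \<phi>_def add.assoc\<close>)
qed

text \<open>The second difference is symmetric in \<open>v\<close> and \<open>w\<close>, so the two
  mixed derivatives take equal values at points arbitrarily near \<open>x\<close>, and both are
  continuous there. This symmetry later identifies the limit of the Jacobians with the Jacobian of
  the limit.\<close>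

lemma dd_commute:
  fixes f :: "'a::real_normed_vector \<Rightarrow> real"
  assumes f: "smooth_on S f" and x: "x \<in> S"
  shows "dd v (dd w f) x = dd w (dd v f) x"
proof -
  obtain r where r: "r > 0" "ball x r \<subseteq> S" using f x smooth_on_open openE by metis
  have C2: "Ck_on (Suc (Suc 0)) (ball x r) f" using f r Ck_on_subset unfolding smooth_on_def by blast
  have cont: "isCont (dd v (dd w f)) x" for v w
    using f x smooth_on_dd smooth_on_continuous_on smooth_on_open continuous_on_eq_continuous_at by metis
  define N where "N = norm v + norm w + 1"
  have N: "N > 0" by (simp add: N_def add_nonneg_pos)
  have "\<bar>dd v (dd w f) x - dd w (dd v f) x\<bar> \<le> e" if "e > 0" for e
  proof -
    obtain d1 where d1: "d1 > 0" "\<And>z. norm (z - x) < d1 \<Longrightarrow> \<bar>dd v (dd w f) z - dd v (dd w f) x\<bar> < e / 2"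
      using cont[of w v, unfolded continuous_at_eps_delta, rule_format, of "e / 2"] \<open>e > 0\<close>
      by (auto simp: dist_norm)
    obtain d2 where d2: "d2 > 0" "\<And>z. norm (z - x) < d2 \<Longrightarrow> \<bar>dd w (dd v f) z - dd w (dd v f) x\<bar> < e / 2"
      using cont[of v w, unfolded continuous_at_eps_delta, rule_format, of "e / 2"] \<open>e > 0\<close>
      by (auto simp: dist_norm)
    \<comment> \<open>\<open>h\<close> keeps both mean value points within \<open>r\<close>,
      \<open>d1\<close> and \<open>d2\<close> of \<open>x\<close>; the summand 1 in \<open>N\<close>
      keeps the denominator positive when \<open>v\<close> and \<open>w\<close> vanish.\<close>
    define h where "h = min r (min d1 d2) / (2 * N)"
    have h: "h > 0" using r d1 d2 N by (simp add: h_def)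
    have "h * (norm v + norm w) < h * (2 * N)" using h N by (simp add: N_def)
    also have "\<dots> = min r (min d1 d2)" using N by (simp add: h_def)
    finally have hb: "h * (norm v + norm w) < min r (min d1 d2)" .
    obtain z1 where z1: "norm (z1 - x) \<le> h * (norm v + norm w)"
      "f (x + h *\<^sub>R v + h *\<^sub>R w) - f (x + h *\<^sub>R v) - f (x + h *\<^sub>R w) + f x = h * h * dd w (dd v f) z1"
      using second_difference_mvt[OF C2 h, of v w] hb by auto
    obtain z2 where z2: "norm (z2 - x) \<le> h * (norm v + norm w)"
      "f (x + h *\<^sub>R w + h *\<^sub>R v) - f (x + h *\<^sub>R w) - f (x + h *\<^sub>R v) + f x = h * h * dd v (dd w f) z2"
      using second_difference_mvt[OF C2 h, of w v] hb by (auto simp: add.commute)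
    have eq: "x + h *\<^sub>R w + h *\<^sub>R v = x + h *\<^sub>R v + h *\<^sub>R w" by simp
    have "h * h * dd w (dd v f) z1 = h * h * dd v (dd w f) z2"
      using z1(2) z2(2) unfolding eq by linarith
    then have "dd w (dd v f) z1 = dd v (dd w f) z2" using h by simp
    moreover have "norm (z1 - x) < d2" "norm (z2 - x) < d1" using z1 z2 hb by linarith+
    ultimately show ?thesis using d1(2)[of z2] d2(2)[of z1] by linarith
  qed
  then have "\<bar>dd v (dd w f) x - dd w (dd v f) x\<bar> \<le> 0" by (rule field_le_epsilon) simp
  then show ?thesis by simp
qed

subsection \<open>Isometric maps between metrics on open sets\<close>

lemma inner_transpose_mult:
  fixes x y :: "real^'m::finite" and A B :: "real^'m^'m"
  shows "x \<bullet> ((transpose A ** B ** A) *v y) = (A *v x) \<bullet> (B *v (A *v y))"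
proof -
  have "x \<bullet> (transpose A *v z) = (A *v x) \<bullet> z" for z
    using dot_lmul_matrix[of x "transpose A" z] by simp
  then show ?thesis by (simp add: matrix_vector_mul_assoc[symmetric])
qed

lemma matrix_eq_inner:
  fixes A B :: "real^'m::finite^'n::finite"
  assumes "\<And>x y. x \<bullet> (A *v y) = x \<bullet> (B *v y)"
  shows "A = B"
proof -
  have "A *v y = B *v y" for y
    using assms vector_eq_ldot[of "A *v y" "B *v y"] by blast
  then show ?thesis by (simp add: matrix_eq)
qed

lemma pullback_form_inner:
  assumes "f differentiable (at q)"
  shows "x \<bullet> (pullback_form f B q *v y)
    = frechet_derivative f (at q) x \<bullet> (B (f q) *v frechet_derivative f (at q) y)"
proof -
  have "frechet_derivative f (at q) = (\<lambda>h. jacobian f (at q) *v h)"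
    using frechet_derivative_at jacobian_works assms by metis
  then show ?thesis by (simp add: pullback_form_def inner_transpose_mult)
qed

text \<open>Invertibility is not part of the notion: bijectivity is obtained at the end from
  explicit two-sided inverses.\<close>

definition iso_on ::
  "(real^'m::finite) set \<Rightarrow> (real^'m \<Rightarrow> real^'m^'m) \<Rightarrow> (real^'m \<Rightarrow> real^'m^'m) \<Rightarrow> (real^'m \<Rightarrow> real^'m) \<Rightarrow> bool" where
  "iso_on W g h \<phi> \<longleftrightarrow> smooth_on W \<phi> \<and> (\<forall>q\<in>W. pullback_form \<phi> h q = g q)"

lemma iso_on_smooth: "iso_on W g h \<phi> \<Longrightarrow> smooth_on W \<phi>"
  by (simp add: iso_on_def)

lemma iso_on_inner:
  assumes "iso_on W g h \<phi>" "q \<in> W"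
  shows "frechet_derivative \<phi> (at q) x \<bullet> (h (\<phi> q) *v frechet_derivative \<phi> (at q) y) = x \<bullet> (g q *v y)"
  using assms pullback_form_inner[of \<phi> q x h y] smooth_on_differentiable[of W \<phi> q]
  unfolding iso_on_def by auto

lemma iso_onI:
  assumes "smooth_on W \<phi>"
    and "\<And>q x y. q \<in> W \<Longrightarrow>
      frechet_derivative \<phi> (at q) x \<bullet> (h (\<phi> q) *v frechet_derivative \<phi> (at q) y) = x \<bullet> (g q *v y)"
  shows "iso_on W g h \<phi>"
  unfolding iso_on_def
proof (intro conjI ballI assms(1) matrix_eq_inner)
  fix q x y assume "q \<in> W"
  then show "x \<bullet> (pullback_form \<phi> h q *v y) = x \<bullet> (g q *v y)"
    using assms(2)[of q x y] pullback_form_inner[of \<phi> q x h y] smooth_on_differentiable[OF assms(1), of q]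
    by simp
qed

lemma iso_on_cong:
  assumes "iso_on W g h \<phi>" "\<And>q. q \<in> W \<Longrightarrow> \<phi> q = \<psi> q"
  shows "iso_on W g h \<psi>"
proof (rule iso_onI)
  show "smooth_on W \<psi>" using assms smooth_on_cong iso_on_smooth by blast
  fix q x y assume q: "q \<in> W"
  have "open W" using assms(1) iso_on_smooth smooth_on_open by blast
  then have "frechet_derivative \<phi> (at q) = frechet_derivative \<psi> (at q)"
    using frechet_derivative_transform_open(2)[of W q \<phi> \<psi>] q assms(2) by blast
  then show "frechet_derivative \<psi> (at q) x \<bullet> (h (\<psi> q) *v frechet_derivative \<psi> (at q) y) = x \<bullet> (g q *v y)"
    using iso_on_inner[OF assms(1) q] assms(2)[OF q] by simp
qed

lemma iso_on_subset: "iso_on W g h \<phi> \<Longrightarrow> open T \<Longrightarrow> T \<subseteq> W \<Longrightarrow> iso_on T g h \<phi>"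
  unfolding iso_on_def using smooth_on_subset[of W \<phi> T] by blast

lemma iso_on_compose:
  assumes \<phi>: "iso_on W g h \<phi>" and \<psi>: "iso_on W' h k \<psi>" and im: "\<phi> ` W \<subseteq> W'"
  shows "iso_on W g k (\<lambda>q. \<psi> (\<phi> q))"
proof (rule iso_onI)
  show "smooth_on W (\<lambda>q. \<psi> (\<phi> q))"
    using smooth_on_compose[OF iso_on_smooth iso_on_smooth] assms by blast
  fix q x y assume q: "q \<in> W"
  have q': "\<phi> q \<in> W'" using q im by blast
  have "((\<lambda>q. \<psi> (\<phi> q)) has_derivative
      (\<lambda>v. frechet_derivative \<psi> (at (\<phi> q)) (frechet_derivative \<phi> (at q) v))) (at q)"
    by (rule has_derivative_compose[OF smooth_on_has_derivative[OF iso_on_smooth[OF \<phi>] q]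
          smooth_on_has_derivative[OF iso_on_smooth[OF \<psi>] q']])
  from fun_cong[OF frechet_derivative_at[OF this]]
  show "frechet_derivative (\<lambda>q. \<psi> (\<phi> q)) (at q) x \<bullet> (k (\<psi> (\<phi> q)) *v frechet_derivative (\<lambda>q. \<psi> (\<phi> q)) (at q) y)
    = x \<bullet> (g q *v y)"
    using iso_on_inner[OF \<psi> q'] iso_on_inner[OF \<phi> q] by metis
qed

subsection \<open>Local isometries of Lorentzian manifolds\<close>

abbreviation chart_inv :: "('a, 'm::finite) chart \<Rightarrow> real^'m \<Rightarrow> 'a" where
  "chart_inv c \<equiv> inv_into (fst c) (snd c)"

lemma lorentzian_manifold_chart_on:
  "lorentzian_manifold M \<Longrightarrow> c \<in> charts M \<Longrightarrow> chart_on (top_of M) c"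
  by (auto simp: lorentzian_manifold_def smooth_structure_def)

lemma chart_homeo:
  assumes "lorentzian_manifold M" "c \<in> charts M"
  shows "openin (top_of M) (fst c)" "open (snd c ` fst c)"
    "homeomorphic_map (subtopology (top_of M) (fst c)) (top_of_set (snd c ` fst c)) (snd c)"
  using lorentzian_manifold_chart_on[OF assms] by (auto simp: chart_on_def split: prod.splits)

lemma chart_topspace:
  assumes "lorentzian_manifold M" "c \<in> charts M"
  shows "fst c \<subseteq> topspace (top_of M)" "topspace (subtopology (top_of M) (fst c)) = fst c"
  using chart_homeo(1)[OF assms] openin_subset by (auto simp: topspace_subtopology)

lemma charts_cover:
  assumes "lorentzian_manifold M" "p \<in> topspace (top_of M)"
  obtains c where "c \<in> charts M" "p \<in> fst c"
proof -
  have "(\<Union>c\<in>charts M. fst c) = topspace (top_of M)"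
    using assms by (simp add: lorentzian_manifold_def smooth_structure_def)
  then show ?thesis using assms(2) that by blast
qed

lemma chart_inj_on:
  assumes "lorentzian_manifold M" "c \<in> charts M"
  shows "inj_on (snd c) (fst c)"
  using homeomorphic_imp_injective_map[OF chart_homeo(3)[OF assms]] chart_topspace[OF assms] by simp

lemma chart_inv_left:
  assumes "lorentzian_manifold M" "c \<in> charts M" "p \<in> fst c"
  shows "chart_inv c (snd c p) = p"
  using chart_inj_on[OF assms(1,2)] assms(3) by simp

lemma chart_inv_right:
  assumes "q \<in> snd c ` fst c"
  shows "chart_inv c q \<in> fst c" "snd c (chart_inv c q) = q"
  using assms by (auto simp: inv_into_into f_inv_into_f)

lemma chart_image_mem_iff:
  assumes "lorentzian_manifold M" "c \<in> charts M" "p \<in> fst c" "S \<subseteq> fst c"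
  shows "snd c p \<in> snd c ` S \<longleftrightarrow> p \<in> S"
  using inj_on_image_mem_iff[OF chart_inj_on[OF assms(1,2)] assms(3,4)] .

lemma chart_open_image:
  assumes "lorentzian_manifold M" "c \<in> charts M" "openin (top_of M) T" "T \<subseteq> fst c"
  shows "open (snd c ` T)"
proof -
  have "openin (subtopology (top_of M) (fst c)) T"
    using assms by (simp add: openin_subset_topspace_eq openin_open_subtopology chart_homeo(1))
  then have "openin (top_of_set (snd c ` fst c)) (snd c ` T)"
    using homeomorphic_imp_open_map[OF chart_homeo(3)[OF assms(1,2)]] by (simp add: open_map_def)
  then show ?thesis using chart_homeo(2)[OF assms(1,2)] openin_open_trans by blast
qed

lemma chart_open_preimage:
  assumes "lorentzian_manifold M" "c \<in> charts M" "open W"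
  shows "openin (top_of M) {p \<in> fst c. snd c p \<in> W}"
proof -
  have "continuous_map (subtopology (top_of M) (fst c)) (top_of_set (snd c ` fst c)) (snd c)"
    using homeomorphic_imp_continuous_map[OF chart_homeo(3)[OF assms(1,2)]] .
  then have "continuous_map (subtopology (top_of M) (fst c)) euclidean (snd c)"
    using continuous_map_in_subtopology by blast
  then have "openin (subtopology (top_of M) (fst c)) {p \<in> topspace (subtopology (top_of M) (fst c)). snd c p \<in> W}"
    using assms(3) openin_continuous_map_preimage open_openin by blast
  then show ?thesis
    using chart_topspace(2)[OF assms(1,2)] openin_open_subtopology[OF chart_homeo(1)[OF assms(1,2)]] by metis
qed

lemma local_metric_chart:
  assumes "lorentzian_manifold M" "c \<in> charts M" "p \<in> fst c"
  shows "local_metric M c (snd c p) = metric M c p"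
  by (simp add: local_metric_def chart_inv_left[OF assms])

lemma chart_transition_iso_on:
  assumes M: "lorentzian_manifold M" and c: "c \<in> charts M" and c': "c' \<in> charts M"
  shows "iso_on (snd c ` (fst c \<inter> fst c')) (local_metric M c) (local_metric M c')
    (\<lambda>q. snd c' (chart_inv c q))"
  unfolding iso_on_def
proof (intro conjI ballI)
  have "smooth_compatible c c'"
    using assms by (auto simp: lorentzian_manifold_def smooth_structure_def)
  then show "smooth_on (snd c ` (fst c \<inter> fst c')) (\<lambda>q. snd c' (chart_inv c q))"
    by (auto simp: smooth_compatible_def o_def split: prod.splits)
  fix q assume "q \<in> snd c ` (fst c \<inter> fst c')"
  then obtain p where p: "p \<in> fst c" "p \<in> fst c'" "q = snd c p" by blast
  have "metric M c p = pullback_form (snd c' \<circ> chart_inv c) (local_metric M c') (snd c p)"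
    using assms p unfolding lorentzian_manifold_def by blast
  then show "pullback_form (\<lambda>q. snd c' (chart_inv c q)) (local_metric M c') q = local_metric M c q"
    using local_metric_chart[OF M c p(1)] p(3) by (simp add: o_def)
qed

text \<open>\<open>W\<close> has to be mapped into the target chart, so continuity is built in.
  Quantifying over all pairs of charts matches \<open>isometry\<close>;
  \<open>locally_isometricI\<close> reduces it to one pair at each point.\<close>

definition locally_isometric ::
  "('a, 'm::finite) metric_mfd \<Rightarrow> ('b, 'm) metric_mfd \<Rightarrow> ('a \<Rightarrow> 'b) \<Rightarrow> bool" where
  "locally_isometric M N f \<longleftrightarrow>
     (\<forall>p\<in>topspace (top_of M). f p \<in> topspace (top_of N)) \<and>
     (\<forall>c\<in>charts M. \<forall>c'\<in>charts N. \<forall>p\<in>fst c. f p \<in> fst c' \<longrightarrow>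
       (\<exists>W. snd c p \<in> W \<and> W \<subseteq> snd c ` fst c \<and> (\<forall>q\<in>W. f (chart_inv c q) \<in> fst c') \<and>
          iso_on W (local_metric M c) (local_metric N c') (\<lambda>q. snd c' (f (chart_inv c q)))))"

text \<open>Chart changes are isometric for the local metrics, so conjugating with them carries the
  property from one pair of charts at \<open>p\<close> to every other pair, on a smaller
  neighbourhood.\<close>

lemma locally_isometricI:
  assumes M: "lorentzian_manifold M" and N: "lorentzian_manifold N"
    and ex: "\<And>p. p \<in> topspace (top_of M) \<Longrightarrow> \<exists>c\<in>charts M. \<exists>c'\<in>charts N. \<exists>W.
      p \<in> fst c \<and> snd c p \<in> W \<and> W \<subseteq> snd c ` fst c \<and> (\<forall>q\<in>W. f (chart_inv c q) \<in> fst c') \<and>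
      iso_on W (local_metric M c) (local_metric N c') (\<lambda>q. snd c' (f (chart_inv c q)))"
  shows "locally_isometric M N f"
  unfolding locally_isometric_def
proof (intro conjI ballI impI)
  fix p assume "p \<in> topspace (top_of M)"
  with ex[OF this] show "f p \<in> topspace (top_of N)"
    using chart_inv_left[OF M] chart_topspace(1)[OF N] by (metis in_mono)
next
  fix e e' p assume e: "e \<in> charts M" "e' \<in> charts N" "p \<in> fst e" "f p \<in> fst e'"
  have "p \<in> topspace (top_of M)" using chart_topspace(1)[OF M e(1)] e(3) by blast
  then obtain c c' W where c: "c \<in> charts M" "c' \<in> charts N" "p \<in> fst c" "snd c p \<in> W"
    "W \<subseteq> snd c ` fst c" "\<forall>q\<in>W. f (chart_inv c q) \<in> fst c'"
    and iso: "iso_on W (local_metric M c) (local_metric N c') (\<lambda>q. snd c' (f (chart_inv c q)))"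
    using ex by meson
  let ?t = "\<lambda>q. snd c (chart_inv e q)" and ?t' = "\<lambda>q. snd e' (chart_inv c' q)"
    and ?\<phi> = "\<lambda>q. snd c' (f (chart_inv c q))"
  let ?T = "snd e ` (fst e \<inter> fst c)" and ?T' = "snd c' ` (fst c' \<inter> fst e')"
  have t: "iso_on ?T (local_metric M e) (local_metric M c) ?t"
    by (rule chart_transition_iso_on[OF M e(1) c(1)])
  have t': "iso_on ?T' (local_metric N c') (local_metric N e') ?t'"
    by (rule chart_transition_iso_on[OF N c(2) e(2)])
  \<comment> \<open>First restrict to points landing in the overlap of the target charts, then pull
    back along the source transition, so that the three maps compose.\<close>
  define W1 where "W1 = W \<inter> ?\<phi> -` ?T'"
  have "continuous_on W ?\<phi>" "open W" "open ?T'" "open ?T" "continuous_on ?T ?t"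
    using iso t t' iso_on_smooth smooth_on_continuous_on smooth_on_open by blast+
  then have oW1: "open W1" unfolding W1_def by (simp add: continuous_open_preimage)
  define W2 where "W2 = ?T \<inter> ?t -` W1"
  have oW2: "open W2" unfolding W2_def using oW1 \<open>open ?T\<close> \<open>continuous_on ?T ?t\<close>
    by (simp add: continuous_open_preimage)
  have inv: "chart_inv c (?t q) = chart_inv e q" if "q \<in> ?T" for q
    using that chart_inv_left[OF M e(1)] chart_inv_left[OF M c(1)] by auto
  have inv': "f (chart_inv e q) \<in> fst e' \<and> ?t' (?\<phi> (?t q)) = snd e' (f (chart_inv e q))" if "q \<in> W2" for q
  proof -
    have q: "q \<in> ?T" "?t q \<in> W" "?\<phi> (?t q) \<in> ?T'" using that by (auto simp: W2_def W1_def)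
    have "f (chart_inv e q) \<in> fst c'" using c(6) q inv by metis
    moreover have "snd c' (f (chart_inv e q)) \<in> ?T'" using q inv by metis
    ultimately have "f (chart_inv e q) \<in> fst e'" 
      using chart_image_mem_iff[OF N c(2) \<open>f (chart_inv e q) \<in> fst c'\<close>, of "fst c' \<inter> fst e'"] by simp
    moreover have "chart_inv c' (?\<phi> (?t q)) = f (chart_inv e q)"
      using inv[OF q(1)] chart_inv_left[OF N c(2) \<open>f (chart_inv e q) \<in> fst c'\<close>] by simp
    ultimately show ?thesis by simp
  qed
  have iso1: "iso_on W1 (local_metric M c) (local_metric N e') (\<lambda>q. ?t' (?\<phi> q))"
    by (rule iso_on_compose[OF iso_on_subset[OF iso oW1] t']) (auto simp: W1_def)
  have "iso_on W2 (local_metric M e) (local_metric N e') (\<lambda>q. ?t' (?\<phi> (?t q)))"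
    by (rule iso_on_compose[OF iso_on_subset[OF t oW2] iso1]) (auto simp: W2_def)
  then have "iso_on W2 (local_metric M e) (local_metric N e') (\<lambda>q. snd e' (f (chart_inv e q)))"
    by (rule iso_on_cong) (use inv' in blast)
  moreover have "snd e p \<in> W2"
  proof -
    have "?t (snd e p) = snd c p" using chart_inv_left[OF M e(1,3)] by simp
    moreover have "?\<phi> (snd c p) = snd c' (f p)" using chart_inv_left[OF M c(1,3)] by simp
    moreover have "f p \<in> fst c'" using c(4,6) chart_inv_left[OF M c(1,3)] by metis
    ultimately show ?thesis using e c unfolding W2_def W1_def by auto
  qed
  moreover have "W2 \<subseteq> snd e ` fst e" unfolding W2_def by blast
  ultimately show "\<exists>W. snd e p \<in> W \<and> W \<subseteq> snd e ` fst e \<and> (\<forall>q\<in>W. f (chart_inv e q) \<in> fst e') \<and>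
       iso_on W (local_metric M e) (local_metric N e') (\<lambda>q. snd e' (f (chart_inv e q)))"
    using inv' by blast
qed

lemma locally_isometric_cong:
  assumes M: "lorentzian_manifold M" and f: "locally_isometric M N f"
    and eq: "\<And>p. p \<in> topspace (top_of M) \<Longrightarrow> f p = g p"
  shows "locally_isometric M N g"
  unfolding locally_isometric_def
proof (intro conjI ballI impI)
  fix p assume "p \<in> topspace (top_of M)"
  then show "g p \<in> topspace (top_of N)" using f eq by (metis locally_isometric_def)
next
  fix c c' p assume c: "c \<in> charts M" "c' \<in> charts N" "p \<in> fst c" "g p \<in> fst c'"
  have eqc: "f p = g p" if "p \<in> fst c" for p using eq chart_topspace(1)[OF M c(1)] that by blast
  then obtain W where W: "snd c p \<in> W" "W \<subseteq> snd c ` fst c" "\<forall>q\<in>W. f (chart_inv c q) \<in> fst c'"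
    "iso_on W (local_metric M c) (local_metric N c') (\<lambda>q. snd c' (f (chart_inv c q)))"
    using f c unfolding locally_isometric_def by metis
  have *: "f (chart_inv c q) = g (chart_inv c q)" if "q \<in> W" for q
    using eqc[OF chart_inv_right(1)[of q c]] W(2) that by blast
  have "iso_on W (local_metric M c) (local_metric N c') (\<lambda>q. snd c' (g (chart_inv c q)))"
    using iso_on_cong[OF W(4), of "\<lambda>q. snd c' (g (chart_inv c q))"] * by simp
  then show "\<exists>W. snd c p \<in> W \<and> W \<subseteq> snd c ` fst c \<and> (\<forall>q\<in>W. g (chart_inv c q) \<in> fst c') \<and>
       iso_on W (local_metric M c) (local_metric N c') (\<lambda>q. snd c' (g (chart_inv c q)))"
    using W(1,2,3) * by (intro exI[of _ W]) simp
qed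

lemma locally_isometric_compose:
  assumes M: "lorentzian_manifold M" and N: "lorentzian_manifold N"
    and L: "lorentzian_manifold L"
    and f: "locally_isometric M N f" and g: "locally_isometric N L g"
  shows "locally_isometric M L (\<lambda>p. g (f p))"
proof (rule locally_isometricI[OF M L])
  fix p assume p: "p \<in> topspace (top_of M)"
  have fp: "f p \<in> topspace (top_of N)" "g (f p) \<in> topspace (top_of L)"
    using f g p by (auto simp: locally_isometric_def)
  obtain a b c where abc: "a \<in> charts M" "p \<in> fst a" "b \<in> charts N" "f p \<in> fst b"
    "c \<in> charts L" "g (f p) \<in> fst c"
    using charts_cover[OF M p] charts_cover[OF N fp(1)] charts_cover[OF L fp(2)] by metis
  obtain V where V: "snd a p \<in> V" "V \<subseteq> snd a ` fst a" "\<forall>q\<in>V. f (chart_inv a q) \<in> fst b"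
    "iso_on V (local_metric M a) (local_metric N b) (\<lambda>q. snd b (f (chart_inv a q)))"
    using f abc unfolding locally_isometric_def by metis
  obtain W where W: "snd b (f p) \<in> W" "W \<subseteq> snd b ` fst b" "\<forall>q\<in>W. g (chart_inv b q) \<in> fst c"
    "iso_on W (local_metric N b) (local_metric L c) (\<lambda>q. snd c (g (chart_inv b q)))"
    using g abc unfolding locally_isometric_def by metis
  define V' where "V' = V \<inter> (\<lambda>q. snd b (f (chart_inv a q))) -` W"
  have oV': "open V'" unfolding V'_def
    using V(4) W(4) iso_on_smooth smooth_on_continuous_on smooth_on_open
    by (metis (no_types, lifting) continuous_open_preimage)
  have inv: "chart_inv b (snd b (f (chart_inv a q))) = f (chart_inv a q)" if "q \<in> V'" for q
    using that V(3) chart_inv_left[OF N abc(3)] by (auto simp: V'_def)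
  have "iso_on V' (local_metric M a) (local_metric L c)
      (\<lambda>q. snd c (g (chart_inv b (snd b (f (chart_inv a q))))))"
    by (rule iso_on_compose[OF iso_on_subset[OF V(4) oV'] W(4)]) (auto simp: V'_def)
  then have "iso_on V' (local_metric M a) (local_metric L c) (\<lambda>q. snd c (g (f (chart_inv a q))))"
    by (rule iso_on_cong) (simp add: inv)
  moreover have "snd a p \<in> V'"
    using V(1) W(1) chart_inv_left[OF M abc(1,2)] by (simp add: V'_def)
  moreover have "g (f (chart_inv a q)) \<in> fst c" if "q \<in> V'" for q
    using W(3) inv[OF that] that by (auto simp: V'_def dest!: bspec)
  moreover have "V' \<subseteq> snd a ` fst a" using V(2) by (auto simp: V'_def)
  ultimately show "\<exists>c\<in>charts M. \<exists>c'\<in>charts L. \<exists>W.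
      p \<in> fst c \<and> snd c p \<in> W \<and> W \<subseteq> snd c ` fst c \<and> (\<forall>q\<in>W. g (f (chart_inv c q)) \<in> fst c') \<and>
      iso_on W (local_metric M c) (local_metric L c') (\<lambda>q. snd c' (g (f (chart_inv c q))))"
    using abc by blast
qed

lemma locally_isometric_continuous_map:
  assumes M: "lorentzian_manifold M" and N: "lorentzian_manifold N" and f: "locally_isometric M N f"
  shows "continuous_map (top_of M) (top_of N) f"
unfolding continuous_map_def
proof (intro conjI allI impI)
  show "f \<in> topspace (top_of M) \<rightarrow> topspace (top_of N)" using f by (simp add: locally_isometric_def)
  fix S assume S: "openin (top_of N) S"
  show "openin (top_of M) {p \<in> topspace (top_of M). f p \<in> S}"
  proof (subst openin_subopen, intro ballI)
    fix p assume p: "p \<in> {p \<in> topspace (top_of M). f p \<in> S}"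
    then have "f p \<in> topspace (top_of N)" using S openin_subset by blast
    then obtain a b where ab: "a \<in> charts M" "p \<in> fst a" "b \<in> charts N" "f p \<in> fst b"
      using charts_cover[OF M] charts_cover[OF N] p by (metis (no_types, lifting) mem_Collect_eq)
    obtain W where W: "snd a p \<in> W" "W \<subseteq> snd a ` fst a" "\<forall>q\<in>W. f (chart_inv a q) \<in> fst b"
      "iso_on W (local_metric M a) (local_metric N b) (\<lambda>q. snd b (f (chart_inv a q)))"
      using f ab unfolding locally_isometric_def by metis
    let ?W = "W \<inter> (\<lambda>q. snd b (f (chart_inv a q))) -` (snd b ` (S \<inter> fst b))"
    have "open (snd b ` (S \<inter> fst b))"
      using chart_open_image[OF N ab(3)] S chart_homeo(1)[OF N ab(3)] by auto
    then have "open ?W"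
      using W(4) iso_on_smooth smooth_on_continuous_on smooth_on_open
      by (metis (no_types, lifting) continuous_open_preimage)
    then have "openin (top_of M) {p \<in> fst a. snd a p \<in> ?W}"
      by (rule chart_open_preimage[OF M ab(1)])
    moreover have "p \<in> {p \<in> fst a. snd a p \<in> ?W}"
      using p ab W(1) chart_inv_left[OF M ab(1,2)] by auto
    moreover have "{p \<in> fst a. snd a p \<in> ?W} \<subseteq> {p \<in> topspace (top_of M). f p \<in> S}"
    proof
      fix r assume "r \<in> {p \<in> fst a. snd a p \<in> ?W}"
      then have r: "r \<in> fst a" "snd a r \<in> W" "snd b (f r) \<in> snd b ` (S \<inter> fst b)"
        using chart_inv_left[OF M ab(1)] by auto
      then have "f r \<in> fst b" using W(3) chart_inv_left[OF M ab(1) r(1)] by metis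
      then have "f r \<in> S" using r(3) chart_image_mem_iff[OF N ab(3), of "f r" "S \<inter> fst b"] by simp
      then show "r \<in> {p \<in> topspace (top_of M). f p \<in> S}"
        using r(1) chart_topspace(1)[OF M ab(1)] by blast
    qed
    ultimately show "\<exists>T. openin (top_of M) T \<and> p \<in> T \<and> T \<subseteq> {p \<in> topspace (top_of M). f p \<in> S}" by blast
  qed
qed

lemma locally_isometric_smooth_map:
  assumes M: "lorentzian_manifold M" and N: "lorentzian_manifold N" and f: "locally_isometric M N f"
  shows "smooth_map M N f"
proof -
  have cont: "continuous_map (top_of M) (top_of N) f"
    by (rule locally_isometric_continuous_map[OF assms])
  have "smooth_on (snd c ` {p \<in> fst c. f p \<in> fst c'}) (snd c' \<circ> f \<circ> chart_inv c)"
    if c: "c \<in> charts M" "c' \<in> charts N" for c c'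
  proof (rule smooth_on_local)
    fix q assume "q \<in> snd c ` {p \<in> fst c. f p \<in> fst c'}"
    then obtain p where p: "p \<in> fst c" "f p \<in> fst c'" "q = snd c p" by blast
    obtain W where W: "snd c p \<in> W" "W \<subseteq> snd c ` fst c" "\<forall>q\<in>W. f (chart_inv c q) \<in> fst c'"
      "iso_on W (local_metric M c) (local_metric N c') (\<lambda>q. snd c' (f (chart_inv c q)))"
      using f c p unfolding locally_isometric_def by metis
    have "W \<subseteq> snd c ` {p \<in> fst c. f p \<in> fst c'}"
    proof
      fix z assume z: "z \<in> W"
      then have "chart_inv c z \<in> {p \<in> fst c. f p \<in> fst c'}" "snd c (chart_inv c z) = z"
        using W(2,3) chart_inv_right[of z c] by blast+
      then show "z \<in> snd c ` {p \<in> fst c. f p \<in> fst c'}" by (metis imageI)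
    qed
    then show "\<exists>T. q \<in> T \<and> T \<subseteq> snd c ` {p \<in> fst c. f p \<in> fst c'} \<and> smooth_on T (snd c' \<circ> f \<circ> chart_inv c)"
      using W(1) iso_on_smooth[OF W(4)] p(3) unfolding o_def by blast
  qed
  then show ?thesis using cont unfolding smooth_map_def by (simp add: case_prod_beta)
qed

text \<open>\<open>isometry\<close> asks for smoothness of \<open>inv_into\<close>, which is known
  to agree with \<open>g\<close> on the carrier; \<open>locally_isometric\<close> depends on the
  values there only, so it transfers.\<close>

lemma isometry_if_locally_isometric:
  assumes M: "lorentzian_manifold M" and N: "lorentzian_manifold N"
    and f: "locally_isometric M N f" and g: "locally_isometric N M g"
    and gf: "\<And>p. p \<in> topspace (top_of M) \<Longrightarrow> g (f p) = p"
    and fg: "\<And>p. p \<in> topspace (top_of N) \<Longrightarrow> f (g p) = p"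
  shows "isometry M N f"
proof -
  let ?M = "topspace (top_of M)" and ?N = "topspace (top_of N)"
  have bij: "bij_betw f ?M ?N"
    by (rule bij_betw_byWitness[of _ g]) (use gf fg f g in \<open>auto simp: locally_isometric_def\<close>)
  have inv: "g p = inv_into ?M f p" if "p \<in> ?N" for p
  proof -
    have "g p \<in> ?M" using g that by (simp add: locally_isometric_def)
    then show ?thesis
      using bij fg[OF that] by (metis bij_betw_imp_inj_on inv_into_f_f)
  qed
  have "smooth_map N M (inv_into ?M f)"
    by (rule locally_isometric_smooth_map[OF N M locally_isometric_cong[OF N g inv]])
  moreover have "metric M c p = pullback_form (snd c' \<circ> f \<circ> chart_inv c) (local_metric N c') (snd c p)"
    if c: "c \<in> charts M" "c' \<in> charts N" "p \<in> fst c" "f p \<in> fst c'" for c c' p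
  proof -
    obtain W where W: "snd c p \<in> W"
      "iso_on W (local_metric M c) (local_metric N c') (\<lambda>q. snd c' (f (chart_inv c q)))"
      using f c unfolding locally_isometric_def by metis
    then have "pullback_form (\<lambda>q. snd c' (f (chart_inv c q))) (local_metric N c') (snd c p)
        = local_metric M c (snd c p)"
      unfolding iso_on_def by blast
    then show ?thesis using local_metric_chart[OF M c(1,3)] by (simp add: o_def)
  qed
  ultimately show ?thesis
    using bij locally_isometric_smooth_map[OF M N f] unfolding isometry_def by blast
qed

lemma isometry_iso_on:
  assumes M: "lorentzian_manifold M" and f: "isometry M N f"
    and c: "c \<in> charts M" and c': "c' \<in> charts N"
  shows "iso_on (snd c ` {p \<in> fst c. f p \<in> fst c'}) (local_metric M c) (local_metric N c')
    (\<lambda>q. snd c' (f (chart_inv c q)))"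
  unfolding iso_on_def
proof (intro conjI ballI)
  show "smooth_on (snd c ` {p \<in> fst c. f p \<in> fst c'}) (\<lambda>q. snd c' (f (chart_inv c q)))"
    using f c c' unfolding isometry_def smooth_map_def o_def by (auto dest!: bspec split: prod.splits)
  fix q assume "q \<in> snd c ` {p \<in> fst c. f p \<in> fst c'}"
  then obtain p where p: "p \<in> fst c" "f p \<in> fst c'" "q = snd c p" by blast
  have "metric M c p = pullback_form (snd c' \<circ> f \<circ> chart_inv c) (local_metric N c') (snd c p)"
    using f c c' p unfolding isometry_def by blast
  then show "pullback_form (\<lambda>q. snd c' (f (chart_inv c q))) (local_metric N c') q = local_metric M c q"
    using local_metric_chart[OF M c p(1)] p(3) by (simp add: o_def)
qed

subsection \<open>Rosen metrics and their Heisenberg isometries\<close>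

lemma has_vector_derivative_0_unique_connected:
  fixes f :: "real \<Rightarrow> 'a::real_normed_vector"
  assumes "open L" "connected L" "\<And>u. u \<in> L \<Longrightarrow> (f has_vector_derivative 0) (at u)" "s \<in> L" "t \<in> L"
  shows "f s = f t"
  using has_derivative_zero_unique_connected[OF assms(1,2), of f s t] assms(3-)
  by (simp add: has_vector_derivative_def)

text \<open>Meant for functions known only through their derivative, such as a solution
  \<open>b\<close> of \<open>C b' = c\<close>.\<close>

lemma smooth_on_if_derivative_smooth:
  assumes "open S" "\<And>x. x \<in> S \<Longrightarrow> (f has_derivative f' x) (at x)"
    and "\<And>v. smooth_on S (\<lambda>x. f' x v)"
  shows "smooth_on S f"
  unfolding smooth_on_def
proof (intro conjI allI assms(1))
  have diff: "\<forall>x\<in>S. f differentiable (at x)" using assms(2) by (auto simp: differentiable_def)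
  fix k show "Ck_on k S f"
  proof (rule Ck_on_pred)
    have "Ck_on k S (dd v f)" for v
    proof (rule Ck_on_cong[OF assms(1)])
      show "Ck_on k S (\<lambda>x. f' x v)" using assms(3) by (simp add: smooth_on_def)
      show "f' x v = dd v f x" if "x \<in> S" for x
        by (rule fun_cong[OF frechet_derivative_at[OF assms(2)[OF that]]])
    qed
    then show "Ck_on (Suc k) S f" using diff by simp
  qed
qed

lemma smooth_on_det:
  fixes A :: "'a::real_normed_vector \<Rightarrow> real^'n::finite^'n"
  assumes "open S" "\<And>i j. smooth_on S (\<lambda>x. A x $ i $ j)"
  shows "smooth_on S (\<lambda>x. det (A x))"
  unfolding det_def
  by (intro smooth_on_sum smooth_on_mult smooth_on_prod smooth_on_const assms)

text \<open>Cramer's rule writes the entries of \<open>h\<close> as quotients of determinants, which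
  are polynomials in the entries of \<open>A\<close> and \<open>c\<close>.\<close>

lemma smooth_on_matrix_solution:
  fixes A :: "'a::real_normed_vector \<Rightarrow> real^'n::finite^'n"
  assumes "smooth_on S A" "\<And>x. x \<in> S \<Longrightarrow> det (A x) \<noteq> 0" "\<And>x. x \<in> S \<Longrightarrow> A x *v h x = c"
  shows "smooth_on S h"
proof -
  have S: "open S" using assms(1) smooth_on_open by blast
  have ij: "smooth_on S (\<lambda>x. A x $ i $ j)" for i j
    using smooth_on_vec_nth[OF smooth_on_vec_nth[OF assms(1)]] .
  have num: "smooth_on S (\<lambda>x. det (\<chi> i j. if j = k then c $ i else A x $ i $ j))" for k
  proof (rule smooth_on_det[OF S])
    show "smooth_on S (\<lambda>x. (\<chi> i j. if j = k then c $ i else A x $ i $ j) $ i $ j)" for i j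
      by (cases "j = k") (simp_all add: ij smooth_on_const S)
  qed
  have "smooth_on S (\<lambda>x. \<chi> k. det (\<chi> i j. if j = k then c $ i else A x $ i $ j) / det (A x))"
    by (intro smooth_on_vec_lambda S smooth_on_divide num smooth_on_det ij assms(2))
  then show ?thesis
  proof (rule smooth_on_cong)
    show "(\<chi> k. det (\<chi> i j. if j = k then c $ i else A x $ i $ j) / det (A x)) = h x" if "x \<in> S" for x
      using cramer[OF assms(2)[OF that], of "h x" c] assms(3)[OF that] by simp
  qed
qed

section \<open>Null coordinates and Rosen metrics\<close>

locale null_frame =
  fixes U V :: "'m::finite"
  assumes UV: "U \<noteq> V"
begin

text \<open>The transverse part stays in the full space, with zero \<open>u\<close> and
  \<open>v\<close> entries. Transverse vectors are those with \<open>Y w = w\<close>, and the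
  coordinates \<open>y\<close> need no index type of their own.\<close>

definition Y :: "real^'m \<Rightarrow> real^'m" where
  "Y q = (\<chi> i. if i = U \<or> i = V then 0 else q $ i)"

abbreviation ax :: "real \<Rightarrow> real^'m" where "ax u \<equiv> axis U u"

abbreviation slab :: "real set \<Rightarrow> (real^'m) set" where "slab L \<equiv> {q. q $ U \<in> L}"

lemma Y_nth [simp]: "Y q $ U = 0" "Y q $ V = 0" "i \<noteq> U \<Longrightarrow> i \<noteq> V \<Longrightarrow> Y q $ i = q $ i"
  by (simp_all add: Y_def)

lemma ax_nth [simp]: "ax u $ U = u" "ax u $ V = 0" "i \<noteq> U \<Longrightarrow> ax u $ i = 0"
  using UV by (simp_all add: axis_def)

lemma axV_nth [simp]: "axis V u $ V = u" "axis V u $ U = 0" "i \<noteq> V \<Longrightarrow> axis V u $ i = 0"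
  using UV by (simp_all add: axis_def)

lemma linear_Y: "linear Y"
  by (rule linearI) (simp_all add: vec_eq_iff Y_def)

lemmas Y_add = linear_add[OF linear_Y]
  and Y_scaleR = linear_cmul[OF linear_Y]

lemma Y_0 [simp]: "Y 0 = 0" by (rule linear_0[OF linear_Y])

lemma bounded_linear_Y: "bounded_linear Y" by (rule linear_linear[THEN iffD2, OF linear_Y])

lemma Y_Y [simp]: "Y (Y q) = Y q" by (simp add: vec_eq_iff Y_def)

lemma Y_axis [simp]: "Y (axis U a) = 0" "Y (axis V a) = 0"
  by (simp_all add: vec_eq_iff Y_def axis_def)

lemma vec_eqI3: "x $ U = y $ U \<Longrightarrow> x $ V = y $ V \<Longrightarrow> Y x = Y y \<Longrightarrow> x = y"
proof -
  assume *: "x $ U = y $ U" "x $ V = y $ V" "Y x = Y y"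
  have "x $ i = y $ i" for i
    using * Y_nth(3)[of i x] Y_nth(3)[of i y] by (cases "i = U"; cases "i = V") auto
  then show "x = y" by (simp add: vec_eq_iff)
qed

lemma inner_Y: "Y x \<bullet> y = Y x \<bullet> Y y"
  unfolding inner_vec_def by (rule sum.cong) (auto simp: Y_def)

lemma Y_fixed_nth: "Y c = c \<Longrightarrow> c $ U = 0" "Y c = c \<Longrightarrow> c $ V = 0"
  by (metis Y_nth(1), metis Y_nth(2))

lemma Y_fixedI: "c $ U = 0 \<Longrightarrow> c $ V = 0 \<Longrightarrow> Y c = c"
  by (rule vec_eqI3) simp_all

lemma open_slab: "open L \<Longrightarrow> open (slab L)"
  using open_vimage[of L "\<lambda>q. q $ U"] by (simp add: vimage_def continuous_on_component)

lemma has_derivative_nth: "((\<lambda>q. q $ i) has_derivative (\<lambda>v. v $ i)) F" for F :: "(real^'m) filter"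
  by (rule bounded_linear_imp_has_derivative[OF bounded_linear_vec_nth])

text \<open>The bilinear form of \<open>du dv + C dy dy\<close>; the half comes from the symmetric
  product. \<open>C\<close> is a full matrix of which only the transverse block enters, so the whole
  metric of \<open>M\<close> on the axis can later serve as \<open>C\<close>.\<close>

definition rosen :: "real^'m^'m \<Rightarrow> real^'m \<Rightarrow> real^'m \<Rightarrow> real" where
  "rosen C x y = (x $ U * y $ V + x $ V * y $ U) / 2 + Y x \<bullet> (C *v Y y)"

definition rosen_metric :: "(real^'m \<Rightarrow> real^'m^'m) \<Rightarrow> (real \<Rightarrow> real^'m^'m) \<Rightarrow> real set \<Rightarrow> bool" where
  "rosen_metric g C L \<longleftrightarrow> smooth_on (slab L) g \<and>
     (\<forall>q\<in>slab L. \<forall>x y. x \<bullet> (g q *v y) = rosen (C (q $ U)) x y) \<and>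
     (\<forall>u\<in>L. transpose (C u) = C u \<and> (\<forall>w. Y w = w \<longrightarrow> w \<noteq> 0 \<longrightarrow> 0 < w \<bullet> (C u *v w)))"

lemma rosen_metric_subset: "rosen_metric g C L \<Longrightarrow> open L' \<Longrightarrow> L' \<subseteq> L \<Longrightarrow> rosen_metric g C L'"
  unfolding rosen_metric_def using smooth_on_subset[of "slab L" g "slab L'"] open_slab[of L'] by auto

context
  fixes g C L assumes ros: "rosen_metric g C L"
begin

lemma rosen_inner: "q \<in> slab L \<Longrightarrow> x \<bullet> (g q *v y) = rosen (C (q $ U)) x y"
  using ros by (simp add: rosen_metric_def)

lemma rosen_sym: "u \<in> L \<Longrightarrow> x \<bullet> (C u *v y) = y \<bullet> (C u *v x)"
  using ros unfolding rosen_metric_def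
proof -
  assume "u \<in> L"
  then have "transpose (C u) = C u" using ros by (simp add: rosen_metric_def)
  then have "x v* C u = C u *v x" by (metis transpose_matrix_vector)
  then show ?thesis using dot_lmul_matrix[of x "C u" y] by (simp add: inner_commute)
qed

lemma rosen_pos: "u \<in> L \<Longrightarrow> Y w = w \<Longrightarrow> w \<bullet> (C u *v w) = 0 \<Longrightarrow> w = 0"
proof (rule ccontr)
  assume "u \<in> L" and w: "Y w = w" "w \<bullet> (C u *v w) = 0" "w \<noteq> 0"
  have "\<forall>u\<in>L. \<forall>w. Y w = w \<longrightarrow> w \<noteq> 0 \<longrightarrow> 0 < w \<bullet> (C u *v w)"
    using ros by (simp add: rosen_metric_def)
  with \<open>u \<in> L\<close> w show False by fastforce
qed

text \<open>A kernel vector pairs to zero with \<open>\<partial>_u\<close> and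
  \<open>\<partial>_v\<close>, which kills its \<open>v\<close> and \<open>u\<close> entries;
  pairing it with itself, positivity kills the transverse part.\<close>

lemma rosen_det: "q \<in> slab L \<Longrightarrow> det (g q) \<noteq> 0"
proof -
  assume q: "q \<in> slab L"
  have "x = 0" if x: "g q *v x = 0" for x
  proof -
    have 0: "rosen (C (q $ U)) y x = 0" for y using rosen_inner[OF q, of y x] x by simp
    have "x $ V = 0" "x $ U = 0"
      using 0[of "axis U 1"] 0[of "axis V 1"] by (simp_all add: rosen_def)
    moreover from this have "Y x = 0"
      using 0[of x] rosen_pos[of "q $ U" "Y x"] q by (simp add: rosen_def)
    ultimately show ?thesis by - (rule vec_eqI3, simp_all)
  qed
  then show ?thesis
    using matrix_left_invertible_ker[of "g q"] invertible_left_inverse[of "g q"] invertible_det_nz[of "g q"]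
    by simp
qed

text \<open>Converts the transverse equation \<open>C d = c\<close>, which involves only a block of
  \<open>C\<close>, into a full linear system with the invertible matrix \<open>g q\<close>, so that
  Cramer's rule applies.\<close>

lemma rosen_solution:
  assumes q: "q \<in> slab L" and c: "Y c = c"
  shows "g q *v d = c \<longleftrightarrow> Y d = d \<and> Y (C (q $ U) *v d) = c"
proof
  assume d: "g q *v d = c"
  have r: "y \<bullet> c = rosen (C (q $ U)) y d" for y using rosen_inner[OF q, of y d] d by simp
  have "d $ V = 0" "d $ U = 0"
    using r[of "axis U 1"] r[of "axis V 1"] Y_fixed_nth[OF c] by (simp_all add: rosen_def inner_axis')
  then have Yd: "Y d = d" by (rule Y_fixedI[rotated])
  have "y \<bullet> Y (C (q $ U) *v d) = y \<bullet> c" for y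
  proof -
    have "y \<bullet> Y (C (q $ U) *v d) = Y y \<bullet> (C (q $ U) *v d)"
      using inner_Y by (metis inner_commute)
    also have "\<dots> = rosen (C (q $ U)) y d"
      using \<open>d $ V = 0\<close> \<open>d $ U = 0\<close> Yd by (simp add: rosen_def)
    finally show ?thesis using r by simp
  qed
  then have "Y (C (q $ U) *v d) = c" using vector_eq_ldot by blast
  with Yd show "Y d = d \<and> Y (C (q $ U) *v d) = c" by simp
next
  assume d: "Y d = d \<and> Y (C (q $ U) *v d) = c"
  have "y \<bullet> (g q *v d) = y \<bullet> c" for y
  proof -
    have "y \<bullet> (g q *v d) = Y y \<bullet> (C (q $ U) *v d)"
      using rosen_inner[OF q, of y d] d Y_fixed_nth[of d] by (simp add: rosen_def)
    also have "\<dots> = y \<bullet> Y (C (q $ U) *v d)" using inner_Y by (metis inner_commute)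
    finally show ?thesis using d by simp
  qed
  then show "g q *v d = c" using vector_eq_ldot by blast
qed

lemma rosen_solution_exists:
  assumes q: "q \<in> slab L"
  obtains d where "g q *v d = c"
  by (rule that[OF iffD2[OF cramer[OF rosen_det[OF q]] refl]])

end

section \<open>Heisenberg isometries: normal form, uniqueness and extension\<close>

definition heis_on :: "(real^'m \<Rightarrow> real^'m^'m) \<Rightarrow> real set \<Rightarrow> (real^'m \<Rightarrow> real^'m) \<Rightarrow> bool" where
  "heis_on g L \<phi> \<longleftrightarrow> iso_on (slab L) g g \<phi> \<and>
     (\<exists>b. \<forall>q\<in>slab L. \<phi> q $ U = q $ U \<and> Y (\<phi> q) = Y q + b (q $ U))"

definition heis_data :: "(real \<Rightarrow> real^'m^'m) \<Rightarrow> real set \<Rightarrow> (real \<Rightarrow> real^'m) \<Rightarrow> real^'m \<Rightarrow> bool" where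
  "heis_data C L b c \<longleftrightarrow> Y c = c \<and> (\<forall>u\<in>L. Y (b u) = b u \<and>
     (\<exists>d. (b has_vector_derivative d) (at u) \<and> Y d = d \<and> Y (C u *v d) = c))"

text \<open>When \<open>dy\<close> becomes \<open>dy + b' du\<close> with \<open>C b' = c\<close>,
  the form \<open>C dy dy\<close> gains \<open>2 (c . dy) du + (c . b') du du\<close>. The terms
  \<open>- 2 (c . y) - c . b\<close> added to \<open>v\<close> change \<open>du dv\<close> by
  exactly the opposite amount.\<close>

definition heis_map :: "(real \<Rightarrow> real^'m) \<Rightarrow> real^'m \<Rightarrow> real \<Rightarrow> real^'m \<Rightarrow> real^'m" where
  "heis_map b c k q = q + b (q $ U) + (k - 2 * (c \<bullet> q) - c \<bullet> b (q $ U)) *\<^sub>R axis V 1"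

text \<open>The assumed shape of \<phi> fixes the \<open>u\<close> and \<open>y\<close> rows of its
  derivative. Preservation of the pairing with the image of \<open>\<partial>_u\<close> then
  determines the \<open>v\<close> row, and integrating it leaves the constants \<open>c\<close> and
  \<open>k\<close>.\<close>

lemma heis_classify:
  assumes ros: "rosen_metric g C L" and L: "open L" "connected L" and h: "heis_on g L \<phi>"
  obtains b c k where "heis_data C L b c" "\<And>q. q \<in> slab L \<Longrightarrow> \<phi> q = heis_map b c k q"
proof (cases "L = {}")
  case True
  then show ?thesis using that[of "\<lambda>u. 0" 0] by (simp add: heis_data_def)
next
  case False
  then obtain u0 where u0: "u0 \<in> L" by blast
  let ?S = "slab L"
  have S: "open ?S" by (rule open_slab[OF L(1)])
  define D where "D q = frechet_derivative \<phi> (at q)" for q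
  have iso: "iso_on ?S g g \<phi>" using h by (simp add: heis_on_def)
  obtain b0 where \<phi>U: "\<And>q. q \<in> ?S \<Longrightarrow> \<phi> q $ U = q $ U"
    and \<phi>Y: "\<And>q. q \<in> ?S \<Longrightarrow> Y (\<phi> q) = Y q + b0 (q $ U)"
    using h by (auto simp: heis_on_def)
  have D: "(\<phi> has_derivative D q) (at q)" if "q \<in> ?S" for q
    unfolding D_def by (rule smooth_on_has_derivative[OF iso_on_smooth[OF iso] that])
  \<comment> \<open>\<open>b0\<close> comes without any regularity; on \<open>L\<close> it is
    recovered from the smooth \<phi> along the axis.\<close>
  define b where "b u = Y (\<phi> (ax u))" for u
  define b' where "b' u = Y (D (ax u) (axis U 1))" for u
  have YD: "((\<lambda>q. Y (\<phi> q)) has_derivative (\<lambda>v. Y (D q v))) (at q)" if "q \<in> ?S" for q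
    using bounded_linear.has_derivative[OF bounded_linear_Y D[OF that]] .
  have axd: "(ax has_derivative (\<lambda>t. t *\<^sub>R axis U 1)) (at u)" for u
  proof -
    have eq: "ax = (\<lambda>t. t *\<^sub>R axis U 1)" by (auto simp: fun_eq_iff vec_eq_iff axis_def)
    show ?thesis by (subst eq) (auto intro!: derivative_eq_intros)
  qed
  have comp_ax: "((\<lambda>u. f (ax u + w)) has_vector_derivative f' (axis U 1)) (at u)"
    if "(f has_derivative f') (at (ax u + w))"
    for f :: "real^'m \<Rightarrow> 'z::real_normed_vector" and f' u w
  proof -
    have "((\<lambda>u. ax u + w) has_derivative (\<lambda>t. t *\<^sub>R axis U 1)) (at u)"
      using axd by (auto intro!: derivative_eq_intros)
    from has_derivative_compose[OF this that]
    show ?thesis using linear_cmul[OF has_derivative_linear[OF that]]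
      by (simp add: has_vector_derivative_def)
  qed
  have bd: "(b has_vector_derivative b' u) (at u)" if "u \<in> L" for u
    using comp_ax[of "\<lambda>q. Y (\<phi> q)" "\<lambda>v. Y (D (ax u) v)" u 0] YD[of "ax u"] that
    by (simp add: b_def[abs_def] b'_def)
  have Yb: "Y (b u) = b u" "Y (b' u) = b' u" for u by (simp_all add: b_def b'_def)
  have b0: "b0 u = b u" if "u \<in> L" for u using \<phi>Y[of "ax u"] that by (simp add: b_def)
  have DU: "D q x $ U = x $ U" if q: "q \<in> ?S" for q x
  proof -
    have "((\<lambda>q. \<phi> q $ U) has_derivative (\<lambda>v. D q v $ U)) (at q)"
      using bounded_linear.has_derivative[OF bounded_linear_vec_nth D[OF q]] .
    then have "((\<lambda>q. q $ U) has_derivative (\<lambda>v. D q v $ U)) (at q)"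
      by (rule has_derivative_transform_within_open[OF _ S q]) (rule \<phi>U)
    from fun_cong[OF has_derivative_unique[OF this has_derivative_nth]] show ?thesis .
  qed
  have DY: "Y (D q x) = Y x + x $ U *\<^sub>R b' (q $ U)" if q: "q \<in> ?S" for q x
  proof -
    have d1: "((\<lambda>q. Y q + b0 (q $ U)) has_derivative (\<lambda>v. Y (D q v))) (at q)"
      by (rule has_derivative_transform_within_open[OF YD[OF q] S q]) (rule \<phi>Y)
    have d2: "((\<lambda>q. Y q + b0 (q $ U)) has_derivative (\<lambda>v. Y v + v $ U *\<^sub>R b' (q $ U))) (at q)"
    proof (rule has_derivative_add[OF bounded_linear_imp_has_derivative[OF bounded_linear_Y]])
      have "(b0 has_derivative (\<lambda>t. t *\<^sub>R b' (q $ U))) (at (q $ U))"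
      proof (rule has_derivative_transform_within_open[OF _ L(1)])
        show "(b has_derivative (\<lambda>t. t *\<^sub>R b' (q $ U))) (at (q $ U))"
          using bd[of "q $ U"] q by (simp add: has_vector_derivative_def)
      qed (use q b0 in auto)
      from has_derivative_compose[OF has_derivative_nth this]
      show "((\<lambda>q. b0 (q $ U)) has_derivative (\<lambda>v. v $ U *\<^sub>R b' (q $ U))) (at q)" .
    qed
    show ?thesis by (rule fun_cong[OF has_derivative_unique[OF d1 d2]])
  qed
  have ros': "rosen (C (q $ U)) (D q x) (D q y) = rosen (C (q $ U)) x y" if q: "q \<in> ?S" for q x y
    using iso_on_inner[OF iso q, of x y] \<phi>U[OF q] rosen_inner[OF ros q] rosen_inner[OF ros, of "\<phi> q"] q
    unfolding D_def by auto
  \<comment> \<open>The momentum of the translation; its independence of \<open>u\<close> is derived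
    in \<open>c_const\<close>.\<close>
  define c where "c u = Y (C u *v b' u)" for u
  have c_inner: "b' u \<bullet> (C u *v Y x) = c u \<bullet> x" if "u \<in> L" for u x
    using rosen_sym[OF ros that, of "b' u" "Y x"] inner_Y[of x "C u *v b' u"] inner_Y[of "C u *v b' u" x]
    by (simp add: c_def inner_commute)
  have DV: "D q x $ V = x $ V - 2 * (c (q $ U) \<bullet> x) - x $ U * (c (q $ U) \<bullet> b' (q $ U))"
    if q: "q \<in> ?S" for q x
  proof -
    let ?u = "q $ U" and ?e = "axis U 1 :: real^'m"
    have u: "?u \<in> L" using q by simp
    \<comment> \<open>Pairing \<open>\<partial>_u\<close> with itself gives the
      \<open>v\<close>-entry of its image; pairing it with \<open>x\<close> then gives that of
      \<open>D q x\<close>.\<close>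
    have e: "D q ?e $ V + c ?u \<bullet> b' ?u = 0"
      using ros'[OF q, of ?e ?e] DU[OF q, of ?e] DY[OF q, of ?e] c_inner[OF u, of "b' ?u"] Yb
      by (simp add: rosen_def)
    have h1: "(D q x $ V + D q ?e $ V * x $ U) / 2 + b' ?u \<bullet> (C ?u *v (Y x + x $ U *\<^sub>R b' ?u)) = x $ V / 2"
      using ros'[OF q, of ?e x] DU[OF q] DY[OF q] Yb by (simp add: rosen_def)
    have h2: "b' ?u \<bullet> (C ?u *v (Y x + x $ U *\<^sub>R b' ?u)) = c ?u \<bullet> x + x $ U * (c ?u \<bullet> b' ?u)"
      using c_inner[OF u, of x] c_inner[OF u, of "b' ?u"] Yb
      by (simp add: matrix_vector_right_distrib matrix_vector_mult_scaleR inner_add_right)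
    have h3: "D q ?e $ V = - (c ?u \<bullet> b' ?u)" using e by simp
    show ?thesis using h1[unfolded h2 h3] by (simp add: field_simps)
  qed
  have VD: "((\<lambda>q. \<phi> q $ V) has_derivative (\<lambda>v. D q v $ V)) (at q)" if "q \<in> ?S" for q
    using bounded_linear.has_derivative[OF bounded_linear_vec_nth D[OF that]] .
  have cU: "c u $ U = 0" "c u $ V = 0" for u by (simp_all add: c_def)
  \<comment> \<open>Within a slice the \<open>v\<close> row of the derivative is constant, so the
    \<open>v\<close>-entry of \<phi> is affine there.\<close>
  have slice: "\<phi> (ax u + w) $ V = \<phi> (ax u) $ V + w $ V - 2 * (c u \<bullet> w)"
    if u: "u \<in> L" and w: "w $ U = 0" for u w
  proof -
    let ?r = "w $ V - 2 * (c u \<bullet> w)"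
    define f where "f t = \<phi> (ax u + t *\<^sub>R w) $ V - t * ?r" for t
    have "(f has_real_derivative 0) (at t)" for t
    proof -
      let ?q = "ax u + t *\<^sub>R w"
      have q: "?q \<in> ?S" "?q $ U = u" using u w by simp_all
      have "((\<lambda>t. ax u + t *\<^sub>R w) has_derivative (\<lambda>s. s *\<^sub>R w)) (at t)"
        by (auto intro!: derivative_eq_intros)
      from has_derivative_compose[OF this VD[OF q(1)]]
      have "((\<lambda>t. \<phi> (ax u + t *\<^sub>R w) $ V) has_derivative (\<lambda>s. D ?q (s *\<^sub>R w) $ V)) (at t)" .
      moreover have "D ?q (s *\<^sub>R w) $ V = s * ?r" for s
        unfolding DV[OF q(1)] using q(2) w by (simp add: algebra_simps)
      ultimately have "(f has_derivative (\<lambda>s. s * ?r - s * ?r)) (at t)"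
        unfolding f_def by (auto intro!: derivative_eq_intros)
      then show ?thesis by (simp add: has_field_derivative_def lambda_zero)
    qed
    then have "f 1 = f 0" using DERIV_isconst_all by blast
    then show ?thesis by (simp add: f_def)
  qed
  have Vu: "((\<lambda>u. \<phi> (ax u + w) $ V) has_vector_derivative - (c u \<bullet> b' u)) (at u)"
    if u: "u \<in> L" and w: "w $ U = 0" for u w
    using comp_ax[OF VD, of u w] DV[of "ax u + w" "axis U 1"] u w cU[of u]
    by (simp add: inner_axis)
  \<comment> \<open>By \<open>slice\<close>, the \<open>v\<close>-entry grows by
    \<open>w $ V - 2 * (c u \<bullet> w)\<close> from \<open>ax u\<close> to
    \<open>ax u + w\<close>. By \<open>Vu\<close> its \<open>u\<close>-derivative is the same at
    both points, so this increment, and with it \<open>c u\<close>, is constant.\<close>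
  have c_const: "c u = c u0" if u: "u \<in> L" for u
  proof -
    have "c u \<bullet> w = c u0 \<bullet> w" if w: "w $ U = 0" for w
    proof -
      have "((\<lambda>u. \<phi> (ax u + w) $ V - \<phi> (ax u + 0) $ V) has_vector_derivative 0) (at t)" if "t \<in> L" for t
        using has_vector_derivative_diff[OF Vu[OF that w] Vu[OF that, of 0]] by simp
      from has_vector_derivative_0_unique_connected[OF L this u u0]
      show ?thesis using slice[OF u w] slice[OF u0 w] by simp
    qed
    from this[of "c u - c u0"] have "(c u - c u0) \<bullet> (c u - c u0) = 0"
      by (simp add: cU inner_diff_left)
    then show ?thesis by simp
  qed
  define c0 where "c0 = c u0"
  \<comment> \<open>The last constant of integration, which becomes \<open>k\<close>; the inert
    \<open>+ 0\<close> matches the shape of \<open>Vu\<close>.\<close>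
  have "((\<lambda>u. \<phi> (ax u + 0) $ V + c0 \<bullet> b u) has_vector_derivative 0) (at u)" if u: "u \<in> L" for u
  proof -
    have "((\<lambda>u. c0 \<bullet> b u) has_vector_derivative c0 \<bullet> b' u) (at u)"
      using bounded_linear.has_vector_derivative[OF bounded_linear_inner_right bd[OF u]] .
    from has_vector_derivative_add[OF Vu[OF u, of 0] this]
    show ?thesis using c_const[OF u] by (simp add: c0_def)
  qed
  then have k: "\<phi> (ax u) $ V + c0 \<bullet> b u = \<phi> (ax u0) $ V + c0 \<bullet> b u0" if "u \<in> L" for u
    using has_vector_derivative_0_unique_connected[OF L _ that u0,
        of "\<lambda>u. \<phi> (ax u + 0) $ V + c0 \<bullet> b u"] by simp
  define k0 where "k0 = \<phi> (ax u0) $ V + c0 \<bullet> b u0"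
  have "\<phi> q = heis_map b c0 k0 q" if q: "q \<in> ?S" for q
  proof (rule vec_eqI3)
    have u: "q $ U \<in> L" using q by simp
    show "\<phi> q $ U = heis_map b c0 k0 q $ U"
      using \<phi>U[OF q] Y_fixed_nth[OF Yb(1)] by (simp add: heis_map_def)
    show "Y (\<phi> q) = Y (heis_map b c0 k0 q)"
      using \<phi>Y[OF q] b0[OF u] Yb by (simp add: heis_map_def Y_add Y_scaleR)
    have "\<phi> (ax (q $ U) + (q - ax (q $ U))) $ V
      = \<phi> (ax (q $ U)) $ V + (q - ax (q $ U)) $ V - 2 * (c (q $ U) \<bullet> (q - ax (q $ U)))"
      by (rule slice[OF u]) simp
    moreover have "c (q $ U) \<bullet> (q - ax (q $ U)) = c0 \<bullet> q"
      using c_const[OF u] cU by (simp add: c0_def inner_diff_right inner_axis)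
    ultimately have "\<phi> q $ V = \<phi> (ax (q $ U)) $ V + q $ V - 2 * (c0 \<bullet> q)" by simp
    then show "\<phi> q $ V = heis_map b c0 k0 q $ V"
      using k[OF u] Y_fixed_nth[OF Yb(1)] by (simp add: heis_map_def k0_def)
  qed
  moreover have "heis_data C L b c0"
    unfolding heis_data_def
  proof (intro conjI ballI)
    fix u assume u: "u \<in> L"
    have "Y (C u *v b' u) = c0" using c_const[OF u] by (simp add: c0_def c_def)
    then show "\<exists>d. (b has_vector_derivative d) (at u) \<and> Y d = d \<and> Y (C u *v d) = c0"
      using bd[OF u] Yb by blast
  qed (simp_all add: Yb c0_def c_def)
  ultimately show ?thesis using that by blast
qed

text \<open>\<open>heis_data\<close> gives \<open>b\<close> only a first derivative, but this
  derivative solves a linear system with smooth invertible matrix. Hence it is smooth, and so is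
  \<open>b\<close>.\<close>

lemma heis_map_heis_on:
  assumes ros: "rosen_metric g C L" and L: "open L" and h: "heis_data C L b c"
  shows "heis_on g L (heis_map b c k)"
proof -
  let ?S = "slab L"
  have S: "open ?S" by (rule open_slab[OF L])
  have c: "Y c = c" using h by (simp add: heis_data_def)
  define d where "d u = vector_derivative b (at u)" for u
  have d: "(b has_vector_derivative d u) (at u)" "Y (d u) = d u" "Y (C u *v d u) = c" "Y (b u) = b u"
    if "u \<in> L" for u
    using h that unfolding heis_data_def d_def by (metis vector_derivative_at)+
  have dsol: "g q *v d (q $ U) = c" if "q \<in> ?S" for q
    using rosen_solution[OF ros that c] d that by simp
  have smd: "smooth_on ?S (\<lambda>q. d (q $ U))"
    by (rule smooth_on_matrix_solution[of _ g _ c])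
      (use ros rosen_det[OF ros] dsol in \<open>auto simp: rosen_metric_def\<close>)
  have bder: "((\<lambda>q. b (q $ U)) has_derivative (\<lambda>v. v $ U *\<^sub>R d (q $ U))) (at q)" if "q \<in> ?S" for q
    using has_derivative_compose[OF has_derivative_nth, of b "\<lambda>t. t *\<^sub>R d (q $ U)" q U] d(1)[of "q $ U"] that
    by (simp add: has_vector_derivative_def)
  have smb: "smooth_on ?S (\<lambda>q. b (q $ U))"
    by (rule smooth_on_if_derivative_smooth[OF S bder]) (simp_all add: smooth_on_scaleR smooth_on_const S smd)
  have inner_smooth: "smooth_on ?S (\<lambda>q. r * (c \<bullet> f q))" if "smooth_on ?S f" for f :: "real^'m \<Rightarrow> real^'m" and r
    using smooth_on_compose[OF that smooth_on_linear[OF open_UNIV bounded_linear_inner_right], of c]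
    by (simp add: smooth_on_mult smooth_on_const S)
  have sm: "smooth_on ?S (heis_map b c k)"
  proof -
    have "smooth_on ?S (\<lambda>q. q + b (q $ U) + (k + (- 2) * (c \<bullet> q) + (- 1) * (c \<bullet> b (q $ U))) *\<^sub>R axis V 1)"
      by (intro smooth_on_add smooth_on_scaleR smooth_on_const S inner_smooth smb smooth_on_linear bounded_linear_ident)
    then show ?thesis by (simp add: heis_map_def[abs_def] algebra_simps)
  qed
  have der: "frechet_derivative (heis_map b c k) (at q) x
      = x + x $ U *\<^sub>R d (q $ U) + (- 2 * (c \<bullet> x) - x $ U * (c \<bullet> d (q $ U))) *\<^sub>R axis V 1" if q: "q \<in> ?S" for q x
  proof -
    have "(heis_map b c k has_derivative
      (\<lambda>x. x + x $ U *\<^sub>R d (q $ U) + (0 - 2 * (c \<bullet> x) - c \<bullet> (x $ U *\<^sub>R d (q $ U))) *\<^sub>R axis V 1)) (at q)"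
      unfolding heis_map_def[abs_def]
      by (intro has_derivative_add has_derivative_diff has_derivative_scaleR_left bder[OF q]
          has_derivative_ident has_derivative_const has_derivative_mult_right has_derivative_inner_right)
    from fun_cong[OF frechet_derivative_at[OF this], of x] show ?thesis by simp
  qed
  have mU: "heis_map b c k q $ U = q $ U" "Y (heis_map b c k q) = Y q + b (q $ U)" if "q \<in> ?S" for q
    using d(4)[of "q $ U"] Y_fixed_nth(1)[OF d(4), of "q $ U"] that
    by (simp_all add: heis_map_def Y_add Y_scaleR)
  have "iso_on ?S g g (heis_map b c k)"
  proof (rule iso_onI[OF sm])
    fix q x y assume q: "q \<in> ?S"
    let ?u = "q $ U" let ?d = "d ?u"
    let ?D = "frechet_derivative (heis_map b c k) (at q)"
    have u: "?u \<in> L" using q by simp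
    have dU: "?d $ U = 0" "?d $ V = 0" using Y_fixed_nth[OF d(2)[OF u]] by auto
    have D: "?D x $ U = x $ U" "?D x $ V = x $ V - 2 * (c \<bullet> x) - x $ U * (c \<bullet> ?d)"
      "Y (?D x) = Y x + x $ U *\<^sub>R ?d" for x
      using d(2)[OF u] by (simp_all add: der[OF q] dU Y_add Y_scaleR)
    have 1: "?d \<bullet> (C ?u *v Y x) = c \<bullet> x" for x
      using rosen_sym[OF ros u, of ?d "Y x"] inner_Y[of x "C ?u *v ?d"] inner_Y[of "C ?u *v ?d" x] d(3)[OF u]
      by (simp add: inner_commute)
    have 2: "Y x \<bullet> (C ?u *v ?d) = c \<bullet> x" for x using rosen_sym[OF ros u, of ?d "Y x"] 1[of x] by simp
    have 3: "?d \<bullet> (C ?u *v ?d) = c \<bullet> ?d" using 1[of ?d] d(2)[OF u] by simp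
    have "rosen (C ?u) (?D x) (?D y) = rosen (C ?u) x y"
      unfolding rosen_def D
      by (simp add: matrix_vector_right_distrib matrix_vector_mult_scaleR inner_add_right inner_add_left 1 2 3)
        (simp add: field_simps)
    then show "?D x \<bullet> (g (heis_map b c k q) *v ?D y) = x \<bullet> (g q *v y)"
      using rosen_inner[OF ros q] rosen_inner[OF ros, of "heis_map b c k q"] mU(1)[OF q] u by simp
  qed
  then show ?thesis using mU unfolding heis_on_def by blast
qed

text \<open>Agreement on a thin slab determines \<open>c\<close>, \<open>k\<close> and an initial
  value of \<open>b\<close>; as \<open>c\<close> determines \<open>b'\<close>, equality spreads over
  the connected \<open>L\<close>.\<close>

lemma heis_unique:
  assumes ros: "rosen_metric g C L" and L: "open L" "connected L"
    and h: "heis_on g L \<phi>" "heis_on g L \<psi>"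
    and L': "open L'" "L' \<subseteq> L" "L' \<noteq> {}" and eq: "\<And>q. q \<in> slab L' \<Longrightarrow> \<phi> q = \<psi> q"
    and q: "q \<in> slab L"
  shows "\<phi> q = \<psi> q"
proof -
  obtain b1 c1 k1 where 1: "heis_data C L b1 c1" "\<And>q. q \<in> slab L \<Longrightarrow> \<phi> q = heis_map b1 c1 k1 q"
    using heis_classify[OF ros L h(1)] by blast
  obtain b2 c2 k2 where 2: "heis_data C L b2 c2" "\<And>q. q \<in> slab L \<Longrightarrow> \<psi> q = heis_map b2 c2 k2 q"
    using heis_classify[OF ros L h(2)] by blast
  have e: "heis_map b1 c1 k1 q = heis_map b2 c2 k2 q" if "q \<in> slab L'" for q
    using eq[OF that] 1(2)[of q] 2(2)[of q] that L'(2) by auto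
  obtain u0 where u0: "u0 \<in> L'" using L'(3) by blast
  have Yb: "Y (b1 u) = b1 u" "Y (b2 u) = b2 u" if "u \<in> L" for u
    using 1(1) 2(1) that by (auto simp: heis_data_def)
  have Yc: "Y c1 = c1" "Y c2 = c2" using 1(1) 2(1) by (auto simp: heis_data_def)
  have b_eq: "b1 u = b2 u" if u: "u \<in> L'" for u
  proof -
    have "Y (heis_map b1 c1 k1 (ax u)) = Y (heis_map b2 c2 k2 (ax u))" using e[of "ax u"] u by simp
    moreover have "u \<in> L" using u L'(2) by blast
    ultimately show ?thesis by (simp add: heis_map_def Y_add Y_scaleR Yb)
  qed
  have Vh: "k1 - 2 * (c1 \<bullet> q) - c1 \<bullet> b1 u0 = k2 - 2 * (c2 \<bullet> q) - c2 \<bullet> b1 u0" if "q $ U = u0" for q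
  proof -
    have "heis_map b1 c1 k1 q $ V = heis_map b2 c2 k2 q $ V" using e[of q] that u0 by simp
    then show ?thesis using b_eq[OF u0] that by (simp add: heis_map_def)
  qed
  \<comment> \<open>Compare \<open>v\<close>-entries at the axis point and at its translate by
    \<open>c1 - c2\<close>, which remains in the slice because both vectors are transverse.\<close>
  have "c1 \<bullet> (c1 - c2) = c2 \<bullet> (c1 - c2)"
    using Vh[of "ax u0"] Vh[of "ax u0 + (c1 - c2)"] Y_fixed_nth[OF Yc(1)] Y_fixed_nth[OF Yc(2)]
    by (simp add: inner_axis inner_add_right)
  then have "(c1 - c2) \<bullet> (c1 - c2) = 0" by (simp add: inner_diff_left)
  then have c_eq: "c1 = c2" by simp
  then have k_eq: "k1 = k2" using Vh[of "ax u0"] by simp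
  have "((\<lambda>u. b1 u - b2 u) has_vector_derivative 0) (at u)" if u: "u \<in> L" for u
  proof -
    obtain d1 d2 where d: "(b1 has_vector_derivative d1) (at u)" "Y d1 = d1" "Y (C u *v d1) = c1"
      "(b2 has_vector_derivative d2) (at u)" "Y d2 = d2" "Y (C u *v d2) = c2"
      using 1(1) 2(1) u unfolding heis_data_def by blast
    have "g (ax u) *v d1 = c1" "g (ax u) *v d2 = c1"
      using rosen_solution[OF ros, of "ax u"] d u Yc c_eq by auto
    moreover have "det (g (ax u)) \<noteq> 0" using rosen_det[OF ros, of "ax u"] u by simp
    ultimately have "d1 = d2" using cramer[of "g (ax u)" d1 c1] cramer[of "g (ax u)" d2 c1] by simp
    then show ?thesis using has_vector_derivative_diff[OF d(1,4)] by simp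
  qed
  from has_vector_derivative_0_unique_connected[OF L this, of "q $ U" u0]
  have "b1 (q $ U) = b2 (q $ U)" using q u0 L'(2) b_eq[OF u0] by auto
  then show ?thesis using 1(2)[OF q] 2(2)[OF q] c_eq k_eq by (simp add: heis_map_def)
qed

text \<open>The same \<open>c\<close> prescribes \<open>b'\<close> on the whole interval, so
  integrating from a point of \<open>L'\<close> continues \<open>b\<close>, while \<open>c\<close>
  and \<open>k\<close> are kept.\<close>

lemma heis_extend:
  assumes ros: "rosen_metric g C {\<alpha><..<\<beta>}"
    and L': "open L'" "connected L'" "L' \<subseteq> {\<alpha><..<\<beta>}" "L' \<noteq> {}" and h: "heis_on g L' \<phi>"
  obtains \<psi> where "heis_on g {\<alpha><..<\<beta>} \<psi>" "\<And>q. q \<in> slab L' \<Longrightarrow> \<psi> q = \<phi> q"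
proof -
  let ?L = "{\<alpha><..<\<beta>}"
  obtain b c k where 1: "heis_data C L' b c" "\<And>q. q \<in> slab L' \<Longrightarrow> \<phi> q = heis_map b c k q"
    using heis_classify[OF rosen_metric_subset[OF ros L'(1,3)] L'(1,2) h] by blast
  obtain u0 where u0: "u0 \<in> L'" using L'(4) by blast
  have Yc: "Y c = c" using 1(1) by (simp add: heis_data_def)
  have "\<exists>d. g q *v d = c" if "q \<in> slab ?L" for q using rosen_solution_exists[OF ros that] by metis
  \<comment> \<open>Solving on the whole slab gives access to the smoothness of \<open>g\<close>;
    along the axis \<open>hs\<close> is the prescribed derivative of \<open>b\<close>.\<close>
  then obtain hs where hs: "\<And>q. q \<in> slab ?L \<Longrightarrow> g q *v hs q = c" by metis
  have "smooth_on (slab ?L) hs"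
    by (rule smooth_on_matrix_solution[of _ g _ c])
      (use ros rosen_det[OF ros] hs in \<open>auto simp: rosen_metric_def\<close>)
  then have "continuous_on (slab ?L) hs" by (rule smooth_on_continuous_on)
  moreover have "continuous_on ?L ax"
  proof -
    have eq: "ax = (\<lambda>t. t *\<^sub>R axis U 1)" by (auto simp: fun_eq_iff vec_eq_iff axis_def)
    show ?thesis by (subst eq) (auto intro!: continuous_intros)
  qed
  ultimately have contL: "continuous_on ?L (\<lambda>u. hs (ax u))"
    by (rule continuous_on_compose2) auto
  have cont: "isCont (\<lambda>u. hs (ax u)) u" if "ereal \<alpha> < ereal u" "ereal u < ereal \<beta>" for u
    by (rule bspec[OF iffD1[OF continuous_on_eq_continuous_at[OF open_greaterThanLessThan] contL]])
      (use that in simp)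
  have ab: "ereal \<alpha> < ereal \<beta>" using u0 L'(3) by auto
  obtain F where F: "\<And>u. u \<in> ?L \<Longrightarrow> (F has_vector_derivative hs (ax u)) (at u)"
    using einterval_antiderivative[OF ab cont] by (auto simp: greaterThanLessThan_iff)
  have hs2: "Y (hs (ax u)) = hs (ax u)" "Y (C u *v hs (ax u)) = c" if "u \<in> ?L" for u
    using rosen_solution[OF ros, of "ax u" c "hs (ax u)"] hs[of "ax u"] that Yc by auto
  \<comment> \<open>Start from the given value at \<open>u0\<close>. Applying \<open>Y\<close> makes
    \<open>bb\<close> transverse and leaves its derivative unchanged, since that is transverse
    already.\<close>
  define bb where "bb u = b u0 + Y (F u - F u0)" for u
  have bbd: "(bb has_vector_derivative hs (ax u)) (at u)" if u: "u \<in> ?L" for u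
  proof -
    have "((\<lambda>u. F u - F u0) has_vector_derivative hs (ax u)) (at u)"
      using F[OF u] by (auto intro!: derivative_eq_intros)
    from bounded_linear.has_vector_derivative[OF bounded_linear_Y this]
    show ?thesis unfolding bb_def hs2(1)[OF u]
      using has_vector_derivative_add[OF has_vector_derivative_const] by fastforce
  qed
  have data: "heis_data C ?L bb c"
    unfolding heis_data_def
  proof (intro conjI ballI Yc)
    fix u assume u: "u \<in> ?L"
    show "Y (bb u) = bb u"
      using 1(1) u0 by (simp add: bb_def Y_add heis_data_def)
    show "\<exists>d. (bb has_vector_derivative d) (at u) \<and> Y d = d \<and> Y (C u *v d) = c"
      using bbd[OF u] hs2[OF u] by blast
  qed
  have "bb u = b u" if u: "u \<in> L'" for u
  proof -
    have "((\<lambda>u. bb u - b u) has_vector_derivative 0) (at t)" if t: "t \<in> L'" for t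
    proof -
      obtain d where d: "(b has_vector_derivative d) (at t)" "Y d = d" "Y (C t *v d) = c"
        using 1(1) t unfolding heis_data_def by blast
      have tL: "t \<in> ?L" using t L'(3) by blast
      have "g (ax t) *v d = c" "g (ax t) *v hs (ax t) = c"
        using rosen_solution[OF ros, of "ax t" c d] d Yc tL hs[of "ax t"] by auto
      moreover have "det (g (ax t)) \<noteq> 0" using rosen_det[OF ros, of "ax t"] tL by simp
      ultimately have "d = hs (ax t)"
        using cramer[of "g (ax t)" d c] cramer[of "g (ax t)" "hs (ax t)" c] by simp
      then show ?thesis using has_vector_derivative_diff[OF bbd[OF tL] d(1)] by simp
    qed
    from has_vector_derivative_0_unique_connected[OF L'(1,2) this u u0]
    show ?thesis by (simp add: bb_def)
  qed
  then have "heis_map bb c k q = \<phi> q" if "q \<in> slab L'" for q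
    using 1(2)[OF that] that by (simp add: heis_map_def)
  from that[OF heis_map_heis_on[OF ros _ data] this] show ?thesis by simp
qed

end

subsection \<open>Extending Heisenberg isometries along a Rosen atlas\<close>

lemma connected_Int_real: "connected S \<Longrightarrow> connected T \<Longrightarrow> connected (S \<inter> T)" for S T :: "real set"
  using is_interval_Int by (simp add: is_interval_connected_1[symmetric])

text \<open>\<open>heis_extend\<close> works on intervals with real endpoints, while a patch
  interval \<open>J\<close> may be unbounded; any two points of \<open>J\<close> nevertheless lie in
  such an interval inside \<open>J\<close>.\<close>

lemma interval_between:
  fixes x y :: real
  assumes "open J" "connected J" "x \<in> J" "y \<in> J"
  obtains \<alpha> \<beta> where "x \<in> {\<alpha><..<\<beta>}" "y \<in> {\<alpha><..<\<beta>}" "{\<alpha><..<\<beta>} \<subseteq> J"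
proof -
  define m M where "m = min x y" and "M = max x y"
  have mM: "m \<in> J" "M \<in> J" using assms by (auto simp: m_def M_def min_def max_def)
  obtain e1 where e1: "e1 > 0" "cball m e1 \<subseteq> J" using assms(1) mM open_contains_cball by blast
  obtain e2 where e2: "e2 > 0" "cball M e2 \<subseteq> J" using assms(1) mM open_contains_cball by blast
  have "m - e1 \<in> J" "M + e2 \<in> J" using e1 e2 by (auto simp: subset_eq dist_real_def)
  then have "{m - e1<..<M + e2} \<subseteq> J"
    using connected_contains_Icc[OF assms(2), of "m - e1" "M + e2"] by auto
  moreover have "x \<in> {m - e1<..<M + e2}" "y \<in> {m - e1<..<M + e2}"
    using e1(1) e2(1) by (simp_all add: m_def M_def min_def max_def)
  ultimately show ?thesis using that by blast
qed

lemma (in null_frame) heis_on_cong: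
  assumes "heis_on g L \<phi>" "\<And>q. q \<in> slab L \<Longrightarrow> \<phi> q = \<psi> q"
  shows "heis_on g L \<psi>"
  using assms iso_on_cong[of "slab L" g g \<phi> \<psi>] unfolding heis_on_def by simp

lemma (in null_frame) heis_on_subset:
  assumes "heis_on g L \<phi>" "open L'" "L' \<subseteq> L"
  shows "heis_on g L' \<phi>"
proof -
  have "slab L' \<subseteq> slab L" using assms by blast
  then show ?thesis
    using assms iso_on_subset[of "slab L" g g \<phi> "slab L'"] open_slab[of L'] unfolding heis_on_def by blast
qed

lemma (in null_frame) heis_on_compose:
  assumes \<phi>: "heis_on g L \<phi>" and \<psi>: "heis_on g L \<psi>"
  shows "heis_on g L (\<lambda>q. \<psi> (\<phi> q))"
proof -
  obtain b c where b: "\<And>q. q \<in> slab L \<Longrightarrow> \<phi> q $ U = q $ U \<and> Y (\<phi> q) = Y q + b (q $ U)"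
    and c: "\<And>q. q \<in> slab L \<Longrightarrow> \<psi> q $ U = q $ U \<and> Y (\<psi> q) = Y q + c (q $ U)"
    using \<phi> \<psi> unfolding heis_on_def by blast
  have "iso_on (slab L) g g (\<lambda>q. \<psi> (\<phi> q))"
    by (rule iso_on_compose[of "slab L" g g \<phi> "slab L"]) (use \<phi> \<psi> b in \<open>auto simp: heis_on_def\<close>)
  moreover have "\<forall>q\<in>slab L. \<psi> (\<phi> q) $ U = q $ U \<and> Y (\<psi> (\<phi> q)) = Y q + (b (q $ U) + c (q $ U))"
    using b c by auto
  ultimately show ?thesis unfolding heis_on_def by (intro conjI exI[of _ "\<lambda>u. b u + c u"])
qed

lemma (in null_frame) heis_on_translation:
  assumes ros: "rosen_metric g C L" and L: "open L" and w: "w $ U = 0"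
  shows "heis_on g L (\<lambda>q. q + w)"
proof -
  have "heis_data C L (\<lambda>u. Y w) 0"
    by (auto simp: heis_data_def intro!: exI[of _ 0] has_vector_derivative_const)
  moreover have "heis_map (\<lambda>u. Y w) 0 (w $ V) q = q + w" for q
    by (rule vec_eqI3) (simp_all add: heis_map_def w Y_add Y_scaleR)
  ultimately show ?thesis using heis_map_heis_on[OF ros L, of "\<lambda>u. Y w" 0 "w $ V"] heis_on_cong by simp
qed

text \<open>The gluing data that make Heisenberg isometries independent of the patch: transitions
  preserve \<open>u\<close> and act on the transverse part by a linear map depending on
  \<open>u\<close> alone. The \<open>v\<close>-entry is constrained only through the metric.\<close>

locale rosen_atlas = null_frame U V for U V :: "'m::finite" +
  fixes N :: "('b, 'm) metric_mfd" and I :: "real set" and A :: "(real set \<times> ('b, 'm) chart) set"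
  assumes N: "lorentzian_manifold N"
    and I: "connected I"
    and cover_I: "(\<Union>(J, d)\<in>A. J) = I"
    and cover_N: "(\<Union>(J, d)\<in>A. fst d) = topspace (top_of N)"
    and patch: "(J, d) \<in> A \<Longrightarrow> d \<in> charts N \<and> open J \<and> connected J \<and> snd d ` fst d = slab J"
    and patch_metric: "(J, d) \<in> A \<Longrightarrow> \<exists>C. rosen_metric (local_metric N d) C J"
    and glue: "(J, d) \<in> A \<Longrightarrow> (J', d') \<in> A \<Longrightarrow> fst d \<inter> fst d' = {p \<in> fst d. snd d p $ U \<in> J'}"
    and trans_U: "(J, d) \<in> A \<Longrightarrow> (J', d') \<in> A \<Longrightarrow> p \<in> fst d \<Longrightarrow> p \<in> fst d' \<Longrightarrow> snd d' p $ U = snd d p $ U"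
    and trans_Y: "(J, d) \<in> A \<Longrightarrow> (J', d') \<in> A \<Longrightarrow>
      \<exists>T. \<forall>p. p \<in> fst d \<longrightarrow> p \<in> fst d' \<longrightarrow> linear (T (snd d p $ U)) \<and>
        Y (snd d' p) = T (snd d p $ U) (Y (snd d p))"
begin

text \<open>The choice is unambiguous by \<open>trans_U\<close>, so \<open>u\<close> becomes a
  global function on \<open>N\<close>.\<close>

definition u_coord :: "'b \<Rightarrow> real" where
  "u_coord p = (SOME t. \<exists>(J, d)\<in>A. p \<in> fst d \<and> snd d p $ U = t)"

lemma u_coord_eq:
  assumes "(J, d) \<in> A" "p \<in> fst d"
  shows "u_coord p = snd d p $ U"
proof -
  have "\<exists>(J, d)\<in>A. p \<in> fst d \<and> snd d p $ U = u_coord p"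
    unfolding u_coord_def by (rule someI[of _ "snd d p $ U"]) (use assms in blast)
  then obtain J' d' where "(J', d') \<in> A" "p \<in> fst d'" "snd d' p $ U = u_coord p" by blast
  then show ?thesis using trans_U[of J d J' d' p] assms by simp
qed

text \<open>Patches are glued over the whole common part of their intervals, so a chart domain is
  the full preimage of its interval under \<open>u_coord\<close>.\<close>

lemma patch_dom:
  assumes "(J, d) \<in> A"
  shows "p \<in> fst d \<longleftrightarrow> p \<in> topspace (top_of N) \<and> u_coord p \<in> J"
proof
  assume p: "p \<in> fst d"
  then have "snd d p \<in> slab J" using patch[OF assms] by blast
  then show "p \<in> topspace (top_of N) \<and> u_coord p \<in> J" using u_coord_eq[OF assms p] cover_N assms p by auto
next
  assume p: "p \<in> topspace (top_of N) \<and> u_coord p \<in> J"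
  then obtain J' d' where d': "(J', d') \<in> A" "p \<in> fst d'" using cover_N by blast
  then have "p \<in> {p \<in> fst d'. snd d' p $ U \<in> J}" using p u_coord_eq by simp
  then show "p \<in> fst d" using glue[OF d'(1) assms] by blast
qed

lemma patch_at:
  assumes "t \<in> I"
  obtains J d where "(J, d) \<in> A" "t \<in> J"
  using assms cover_I by blast

lemma u_coord_in: "p \<in> topspace (top_of N) \<Longrightarrow> u_coord p \<in> I"
proof -
  assume "p \<in> topspace (top_of N)"
  then obtain J d where "(J, d) \<in> A" "p \<in> fst d" using cover_N by blast
  then have "(J, d) \<in> A" "u_coord p \<in> J" using patch_dom by simp_all
  then show "u_coord p \<in> I" using cover_I by blast
qed

lemma patch_inv:
  assumes "(J, d) \<in> A"
  shows "p \<in> fst d \<Longrightarrow> chart_inv d (snd d p) = p"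
    and "q \<in> slab J \<Longrightarrow> chart_inv d q \<in> fst d \<and> snd d (chart_inv d q) = q \<and> u_coord (chart_inv d q) = q $ U"
proof -
  show "p \<in> fst d \<Longrightarrow> chart_inv d (snd d p) = p"
    using chart_inv_left[OF N] patch[OF assms] by blast
  assume "q \<in> slab J"
  then have *: "chart_inv d q \<in> fst d" "snd d (chart_inv d q) = q"
    using chart_inv_right[of q d] patch[OF assms] by auto
  then show "chart_inv d q \<in> fst d \<and> snd d (chart_inv d q) = q \<and> u_coord (chart_inv d q) = q $ U"
    using u_coord_eq[OF assms *(1)] by simp
qed

definition heis_in :: "('b, 'm) chart \<Rightarrow> real set \<Rightarrow> ('b \<Rightarrow> 'b) \<Rightarrow> bool" where
  "heis_in d L f \<longleftrightarrow> open L \<and> connected L \<and> (\<forall>p\<in>fst d. u_coord p \<in> L \<longrightarrow> f p \<in> fst d) \<and>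
     heis_on (local_metric N d) L (\<lambda>q. snd d (f (chart_inv d q)))"

definition heis_near :: "real \<Rightarrow> ('b \<Rightarrow> 'b) \<Rightarrow> bool" where
  "heis_near t f \<longleftrightarrow> (\<exists>J d L. (J, d) \<in> A \<and> t \<in> L \<and> L \<subseteq> J \<and> heis_in d L f)"

lemma heis_in_subset:
  "heis_in d L f \<Longrightarrow> open L' \<Longrightarrow> connected L' \<Longrightarrow> L' \<subseteq> L \<Longrightarrow> heis_in d L' f"
  unfolding heis_in_def using heis_on_subset[of _ L _ L'] by blast

lemma heis_in_cong:
  assumes A: "(J, d) \<in> A" "L \<subseteq> J" and f: "heis_in d L f"
    and eq: "\<And>p. p \<in> topspace (top_of N) \<Longrightarrow> u_coord p \<in> L \<Longrightarrow> f p = g p"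
  shows "heis_in d L g"
proof -
  have "f (chart_inv d q) = g (chart_inv d q)" if "q \<in> slab L" for q
    using patch_inv(2)[OF A(1), of q] that A patch_dom[OF A(1)] eq by auto
  then have "heis_on (local_metric N d) L (\<lambda>q. snd d (g (chart_inv d q)))"
    using f heis_on_cong[of _ L "\<lambda>q. snd d (f (chart_inv d q))"] unfolding heis_in_def by simp
  moreover have "\<forall>p\<in>fst d. u_coord p \<in> L \<longrightarrow> g p \<in> fst d"
    using f eq patch_dom[OF A(1)] unfolding heis_in_def by metis
  ultimately show ?thesis using f unfolding heis_in_def by blast
qed

lemma heis_in_preserves:
  assumes A: "(J, d) \<in> A" "L \<subseteq> J" and f: "heis_in d L f"
    and p: "p \<in> topspace (top_of N)" "u_coord p \<in> L"
  shows "p \<in> fst d" "f p \<in> fst d" "u_coord (f p) = u_coord p"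
proof -
  show pd: "p \<in> fst d" using patch_dom[OF A(1)] p A(2) by blast
  then show fp: "f p \<in> fst d" using f p unfolding heis_in_def by blast
  have "snd d p \<in> slab L" using u_coord_eq[OF A(1) pd] p by simp
  then have "snd d (f (chart_inv d (snd d p))) $ U = snd d p $ U"
    using f unfolding heis_in_def heis_on_def by blast
  then show "u_coord (f p) = u_coord p"
    using u_coord_eq[OF A(1) pd] u_coord_eq[OF A(1) fp] patch_inv(1)[OF A(1) pd] by simp
qed

lemma heis_in_compose:
  assumes A: "(J, d) \<in> A" "L \<subseteq> J" and f: "heis_in d L f" and g: "heis_in d L g"
  shows "heis_in d L (\<lambda>p. g (f p))"
proof -
  have pres: "f p \<in> fst d \<and> u_coord (f p) = u_coord p" if "p \<in> fst d" "u_coord p \<in> L" for p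
    using heis_in_preserves[OF A f, of p] that patch_dom[OF A(1)] by blast
  have "heis_on (local_metric N d) L (\<lambda>q. snd d (g (chart_inv d (snd d (f (chart_inv d q))))))"
    using heis_on_compose f g unfolding heis_in_def by blast
  then have "heis_on (local_metric N d) L (\<lambda>q. snd d (g (f (chart_inv d q))))"
  proof (rule heis_on_cong)
    fix q assume "q \<in> slab L"
    then have "chart_inv d q \<in> fst d" "u_coord (chart_inv d q) \<in> L"
      using patch_inv(2)[OF A(1), of q] A(2) by auto
    then show "snd d (g (chart_inv d (snd d (f (chart_inv d q))))) = snd d (g (f (chart_inv d q)))"
      using pres patch_inv(1)[OF A(1)] by simp
  qed
  then show ?thesis using f g pres unfolding heis_in_def by simp
qed

text \<open>Conjugation with a transition preserves \<open>u\<close> and the isometry property, and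
  by linearity turns the translation \<open>b u\<close> into \<open>T u (b u)\<close>. The patch in
  \<open>heis_near\<close> can thus be exchanged for any other one around \<open>t\<close>.\<close>

lemma heis_in_patch:
  assumes f: "heis_near t f" and A': "(J', d') \<in> A" "t \<in> J'"
  obtains L where "t \<in> L" "L \<subseteq> J'" "heis_in d' L f"
proof -
  obtain J d L0 where A: "(J, d) \<in> A" "t \<in> L0" "L0 \<subseteq> J" and f0: "heis_in d L0 f"
    using f unfolding heis_near_def by blast
  define L where "L = L0 \<inter> J'"
  have L: "open L" "connected L" "L \<subseteq> L0" "L \<subseteq> J'" "L \<subseteq> J"
    using f0 patch[OF A'(1)] A connected_Int_real unfolding L_def heis_in_def by auto
  have fL: "heis_in d L f" by (rule heis_in_subset[OF f0 L(1-3)])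
  note pres = heis_in_preserves[OF A(1) L(5) fL]
  let ?\<phi> = "\<lambda>q. snd d (f (chart_inv d q))" and ?\<phi>' = "\<lambda>q. snd d' (f (chart_inv d' q))"
  let ?\<psi> = "\<lambda>q. snd d' (chart_inv d q)" and ?\<psi>' = "\<lambda>q. snd d (chart_inv d' q)"
  have loc: "chart_inv d' q \<in> fst d'" "chart_inv d' q \<in> fst d" "?\<psi>' q $ U = q $ U" "snd d' (chart_inv d' q) = q"
    "chart_inv d (?\<psi>' q) = chart_inv d' q" "f (chart_inv d' q) \<in> fst d" "f (chart_inv d' q) \<in> fst d'"
    "u_coord (f (chart_inv d' q)) = q $ U"
    if q: "q \<in> slab L" for q
  proof -
    have 1: "chart_inv d' q \<in> fst d' \<and> snd d' (chart_inv d' q) = q \<and> u_coord (chart_inv d' q) = q $ U"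
      using patch_inv(2)[OF A'(1), of q] q L(4) by blast
    then have 2: "chart_inv d' q \<in> topspace (top_of N)" "u_coord (chart_inv d' q) \<in> L"
      using q patch_dom[OF A'(1)] by auto
    note 3 = pres[OF 2]
    have "f (chart_inv d' q) \<in> fst d'"
      using 3 1 q L patch_dom[OF A(1)] patch_dom[OF A'(1)] by auto
    then show "chart_inv d' q \<in> fst d'" "chart_inv d' q \<in> fst d" "?\<psi>' q $ U = q $ U" "snd d' (chart_inv d' q) = q"
    "chart_inv d (?\<psi>' q) = chart_inv d' q" "f (chart_inv d' q) \<in> fst d" "f (chart_inv d' q) \<in> fst d'"
    "u_coord (f (chart_inv d' q)) = q $ U"
      using 1 3 u_coord_eq[OF A(1) 3(1)] patch_inv(1)[OF A(1) 3(1)] by auto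
  qed
  have iso_psi: "iso_on (snd d ` (fst d \<inter> fst d')) (local_metric N d) (local_metric N d') ?\<psi>"
    and iso_psi': "iso_on (snd d' ` (fst d' \<inter> fst d)) (local_metric N d') (local_metric N d) ?\<psi>'"
    using chart_transition_iso_on[OF N] patch[OF A(1)] patch[OF A'(1)] by blast+
  have oL: "open (slab L)" by (rule open_slab[OF L(1)])
  have "slab L \<subseteq> snd d' ` (fst d' \<inter> fst d)"
    using loc(1,2,4) by (metis (no_types, lifting) IntI image_eqI subsetI)
  then have 1: "iso_on (slab L) (local_metric N d') (local_metric N d) ?\<psi>'"
    by (rule iso_on_subset[OF iso_psi' oL])
  have phi: "iso_on (slab L) (local_metric N d) (local_metric N d) ?\<phi>"
    using fL unfolding heis_in_def heis_on_def by blast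
  have 2: "iso_on (slab L) (local_metric N d') (local_metric N d) (\<lambda>q. ?\<phi> (?\<psi>' q))"
    by (rule iso_on_compose[OF 1 phi]) (use loc(3) in auto)
  have "iso_on (slab L) (local_metric N d') (local_metric N d') (\<lambda>q. ?\<psi> (?\<phi> (?\<psi>' q)))"
    by (rule iso_on_compose[OF 2 iso_psi]) (use loc(5-7) in auto)
  then have iso: "iso_on (slab L) (local_metric N d') (local_metric N d') ?\<phi>'"
    by (rule iso_on_cong) (use loc(5,6) patch_inv(1)[OF A(1)] in simp)
  obtain T where T: "\<And>p. p \<in> fst d \<Longrightarrow> p \<in> fst d' \<Longrightarrow> linear (T (snd d p $ U)) \<and>
        Y (snd d' p) = T (snd d p $ U) (Y (snd d p))"
    using trans_Y[OF A(1) A'(1)] by blast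
  obtain b where b: "\<And>q. q \<in> slab L \<Longrightarrow> ?\<phi> q $ U = q $ U \<and> Y (?\<phi> q) = Y q + b (q $ U)"
    using fL unfolding heis_in_def heis_on_def by blast
  have "?\<phi>' q $ U = q $ U \<and> Y (?\<phi>' q) = Y q + T (q $ U) (b (q $ U))" if q: "q \<in> slab L" for q
  proof -
    let ?p = "chart_inv d' q" and ?u = "q $ U"
    have p: "?p \<in> fst d" "?p \<in> fst d'" "f ?p \<in> fst d" "f ?p \<in> fst d'" using loc[OF q] by auto
    have Up: "snd d ?p $ U = ?u" "snd d (f ?p) $ U = ?u" "snd d' (f ?p) $ U = ?u"
      using loc[OF q] u_coord_eq[OF A(1) p(3)] u_coord_eq[OF A'(1) p(4)] by auto
    have lin: "linear (T ?u)" "Y (snd d' (f ?p)) = T ?u (Y (snd d (f ?p)))" "Y q = T ?u (Y (snd d ?p))"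
      using T[OF p(3,4)] T[OF p(1,2)] Up loc(4)[OF q] by auto
    have "Y (snd d (f ?p)) = Y (snd d ?p) + b ?u"
      using b[of "snd d ?p"] q Up loc(5)[OF q] by simp
    then show ?thesis using lin Up linear_add[OF lin(1)] by simp
  qed
  then have "heis_on (local_metric N d') L ?\<phi>'"
    unfolding heis_on_def using iso by (intro conjI exI[of _ "\<lambda>u. T u (b u)"]) simp_all
  moreover have "\<forall>p\<in>fst d'. u_coord p \<in> L \<longrightarrow> f p \<in> fst d'"
    using pres L patch_dom[OF A'(1)] patch_dom[OF A(1)] by (metis subsetD)
  ultimately have "heis_in d' L f" using L by (simp add: heis_in_def)
  then show ?thesis using that[of L] A A'(2) L(4) unfolding L_def by blast
qed

lemma heis_near_cong:
  assumes f: "heis_near t f" and L: "open L" "connected L" "t \<in> L"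
    and eq: "\<And>p. p \<in> topspace (top_of N) \<Longrightarrow> u_coord p \<in> L \<Longrightarrow> f p = g p"
  shows "heis_near t g"
proof -
  obtain J d L0 where A: "(J, d) \<in> A" "t \<in> L0" "L0 \<subseteq> J" and f0: "heis_in d L0 f"
    using f unfolding heis_near_def by blast
  have "heis_in d (L0 \<inter> L) f"
    by (rule heis_in_subset[OF f0]) (use f0 L connected_Int_real in \<open>auto simp: heis_in_def\<close>)
  then have "heis_in d (L0 \<inter> L) g"
    by (rule heis_in_cong[OF A(1), rotated]) (use A eq in auto)
  then show ?thesis unfolding heis_near_def using A L by blast
qed

lemma heis_near_compose:
  assumes f: "heis_near t f" and g: "heis_near t g"
  shows "heis_near t (\<lambda>p. g (f p))"
proof -
  obtain J d L0 where A: "(J, d) \<in> A" "t \<in> L0" "L0 \<subseteq> J" and f0: "heis_in d L0 f"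
    using f unfolding heis_near_def by blast
  obtain L1 where L1: "t \<in> L1" "L1 \<subseteq> J" "heis_in d L1 g" using heis_in_patch[OF g A(1)] A by blast
  have oc: "open (L0 \<inter> L1)" "connected (L0 \<inter> L1)"
    using f0 L1 connected_Int_real unfolding heis_in_def by auto
  have "heis_in d (L0 \<inter> L1) (\<lambda>p. g (f p))"
    by (rule heis_in_compose[OF A(1) _ heis_in_subset[OF f0 oc] heis_in_subset[OF L1(3) oc]]) (use A in auto)
  then show ?thesis unfolding heis_near_def using A L1 by blast
qed

section \<open>Unique continuation and extension along the parameter interval\<close>

definition heis_section :: "real set \<Rightarrow> ('b \<Rightarrow> 'b) \<Rightarrow> bool" where
  "heis_section K f \<longleftrightarrow> (\<forall>t\<in>K. heis_near t f)"

lemma heis_section_preserves: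
  assumes "heis_section K f" "p \<in> topspace (top_of N)" "u_coord p \<in> K"
  shows "f p \<in> topspace (top_of N)" "u_coord (f p) = u_coord p"
proof -
  obtain J d L0 where A: "(J, d) \<in> A" "u_coord p \<in> L0" "L0 \<subseteq> J" and f0: "heis_in d L0 f"
    using assms unfolding heis_section_def heis_near_def by blast
  show "f p \<in> topspace (top_of N)" "u_coord (f p) = u_coord p"
    using heis_in_preserves[OF A(1,3) f0 assms(2) A(2)] patch_dom[OF A(1)] by auto
qed

text \<open>Identity principle: agreement near one parameter spreads over a common slab by
  \<open>heis_unique\<close>, and from slab to slab along the connected \<open>K\<close>.\<close>

lemma heis_section_unique:
  assumes K: "connected K" "K \<subseteq> I" and f: "heis_section K f" and g: "heis_section K g"
    and t: "t0 \<in> K" and L0: "open L0" "t0 \<in> L0"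
    and eq: "\<And>p. p \<in> topspace (top_of N) \<Longrightarrow> u_coord p \<in> L0 \<Longrightarrow> f p = g p"
    and p: "p \<in> topspace (top_of N)" "u_coord p \<in> K"
  shows "f p = g p"
proof -
  \<comment> \<open>Agreement over a neighbourhood of \<open>t\<close>, not merely at
    \<open>t\<close>, is what \<open>heis_unique\<close> can propagate.\<close>
  define P where "P t \<longleftrightarrow> (\<exists>L. open L \<and> t \<in> L \<and> (\<forall>p\<in>topspace (top_of N). u_coord p \<in> L \<longrightarrow> f p = g p))" for t
  have "P (u_coord p)"
  proof (rule connected_induction_simple[OF K(1) t p(2)])
    show "P t0" unfolding P_def using L0 eq by blast
    fix a assume a: "a \<in> K"
    obtain J d where A: "(J, d) \<in> A" "a \<in> J" using patch_at K(2) a by blast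
    obtain L1 where L1: "a \<in> L1" "L1 \<subseteq> J" "heis_in d L1 f"
      using heis_in_patch[OF _ A] f a unfolding heis_section_def by blast
    obtain L2 where L2: "a \<in> L2" "L2 \<subseteq> J" "heis_in d L2 g"
      using heis_in_patch[OF _ A] g a unfolding heis_section_def by blast
    define L where "L = L1 \<inter> L2"
    have L: "open L" "connected L" "L \<subseteq> J" "a \<in> L"
      using L1 L2 connected_Int_real unfolding heis_in_def L_def by auto
    have fL: "heis_in d L f" "heis_in d L g"
      using heis_in_subset[OF L1(3) L(1,2)] heis_in_subset[OF L2(3) L(1,2)] by (auto simp: L_def)
    obtain C where ros: "rosen_metric (local_metric N d) C L"
      using patch_metric[OF A(1)] rosen_metric_subset[OF _ L(1,3)] by blast
    have "P y" if x: "x \<in> L" and y: "y \<in> L" and Px: "P x" for x y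
    proof -
      obtain L' where L': "open L'" "x \<in> L'" "\<forall>p\<in>topspace (top_of N). u_coord p \<in> L' \<longrightarrow> f p = g p"
        using Px unfolding P_def by blast
      have eqL: "snd d (f (chart_inv d q)) = snd d (g (chart_inv d q))" if q: "q \<in> slab L" for q
      proof (rule heis_unique[OF ros L(1,2) _ _ _ _ _ _ q])
        show "open (L' \<inter> L)" "L' \<inter> L \<subseteq> L" "L' \<inter> L \<noteq> {}" using L' L x by auto
        show "snd d (f (chart_inv d q)) = snd d (g (chart_inv d q))" if "q \<in> slab (L' \<inter> L)" for q
          using patch_inv(2)[OF A(1), of q] patch_dom[OF A(1)] that L(3) L'(3) by auto
      qed (use fL in \<open>auto simp: heis_in_def\<close>)
      have "f p = g p" if p: "p \<in> topspace (top_of N)" "u_coord p \<in> L" for p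
      proof -
        have "p \<in> fst d" "f p \<in> fst d" "g p \<in> fst d"
          using heis_in_preserves[OF A(1) L(3) fL(1) p] heis_in_preserves[OF A(1) L(3) fL(2) p] by auto
        moreover from this have "snd d (f p) = snd d (g p)"
          using eqL[of "snd d p"] u_coord_eq[OF A(1)] patch_inv(1)[OF A(1)] p by simp
        ultimately show ?thesis using patch_inv(1)[OF A(1)] by metis
      qed
      then show ?thesis unfolding P_def using L y by blast
    qed
    then show "\<exists>T. openin (top_of_set K) T \<and> a \<in> T \<and> (\<forall>x\<in>T. \<forall>y\<in>T. P x \<longrightarrow> P y)"
      using L a by (intro exI[of _ "K \<inter> L"]) auto
  qed
  then show ?thesis unfolding P_def using p by blast
qed

text \<open>\<open>f\<close> is known to be of Heisenberg type only near \<open>x\<close>, so the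
  extension \<open>g\<close> may differ from it elsewhere over the interval.\<close>

lemma heis_extend_patch:
  assumes A: "(J, d) \<in> A" and ab: "{\<alpha><..<\<beta>} \<subseteq> J" and x: "x \<in> {\<alpha><..<\<beta>}" and f: "heis_near x f"
  obtains g L where "heis_section {\<alpha><..<\<beta>} g" "open L" "x \<in> L"
    "\<And>p. p \<in> topspace (top_of N) \<Longrightarrow> u_coord p \<in> L \<Longrightarrow> f p = g p"
proof -
  let ?K = "{\<alpha><..<\<beta>}"
  obtain L1 where L1: "x \<in> L1" "L1 \<subseteq> J" "heis_in d L1 f" using heis_in_patch[OF f A] x ab by blast
  define L where "L = L1 \<inter> ?K"
  have L: "open L" "connected L" "L \<subseteq> ?K" "x \<in> L" "L \<subseteq> J" "L \<subseteq> L1"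
    using L1 x connected_Int_real[of L1 ?K] unfolding heis_in_def L_def by auto
  have fL: "heis_in d L f" by (rule heis_in_subset[OF L1(3) L(1,2,6)])
  obtain C where ros: "rosen_metric (local_metric N d) C ?K"
    using patch_metric[OF A] rosen_metric_subset[OF _ open_greaterThanLessThan ab] by blast
  obtain \<psi> where \<psi>: "heis_on (local_metric N d) ?K \<psi>"
    "\<And>q. q \<in> slab L \<Longrightarrow> \<psi> q = snd d (f (chart_inv d q))"
    using heis_extend[OF ros L(1-3), of "\<lambda>q. snd d (f (chart_inv d q))"] L(4) fL unfolding heis_in_def by blast
  have \<psi>U: "\<psi> q $ U = q $ U" if "q \<in> slab ?K" for q using \<psi>(1) that unfolding heis_on_def by blast
  define g where "g p = chart_inv d (\<psi> (snd d p))" for p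
  have gd: "g p \<in> fst d \<and> snd d (g p) = \<psi> (snd d p)" if "p \<in> fst d" "u_coord p \<in> ?K" for p
  proof -
    have "snd d p \<in> slab ?K" using u_coord_eq[OF A that(1)] that(2) by simp
    then have "\<psi> (snd d p) \<in> slab J" using \<psi>U ab by auto
    then show ?thesis using patch_inv(2)[OF A, of "\<psi> (snd d p)"] by (simp add: g_def)
  qed
  have "heis_in d ?K g"
    unfolding heis_in_def
  proof (intro conjI ballI impI)
    show "heis_on (local_metric N d) ?K (\<lambda>q. snd d (g (chart_inv d q)))"
    proof (rule heis_on_cong[OF \<psi>(1)])
      fix q assume "q \<in> slab ?K"
      then show "\<psi> q = snd d (g (chart_inv d q))"
        using gd[of "chart_inv d q"] patch_inv(2)[OF A, of q] ab by auto
    qed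
  qed (use gd in auto)
  then have "heis_section ?K g" unfolding heis_section_def heis_near_def using A ab by blast
  moreover have "f p = g p" if p: "p \<in> topspace (top_of N)" "u_coord p \<in> L" for p
  proof -
    have pd: "p \<in> fst d" "f p \<in> fst d" using heis_in_preserves[OF A L(5) fL p] by auto
    have "snd d (g p) = \<psi> (snd d p)" using gd[OF pd(1)] p L(3) by blast
    also have "\<dots> = snd d (f p)"
      using \<psi>(2)[of "snd d p"] u_coord_eq[OF A pd(1)] p patch_inv(1)[OF A pd(1)] by simp
    finally show ?thesis
      using patch_inv(1)[OF A pd(2)] patch_inv(1)[OF A, of "g p"] gd[OF pd(1)] p L(3) by (metis subsetD)
  qed
  ultimately show ?thesis using that L by blast
qed

text \<open>Continuation of the germ of \<open>f0\<close> at \<open>t0\<close> along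
  \<open>I\<close>. Two continuations are compared on the intersection of their intervals, which is
  again connected, so the result depends on no route.\<close>

lemma heis_global:
  assumes t0: "t0 \<in> I" and f0: "heis_near t0 f0"
  obtains F L where "heis_section I F" "open L" "t0 \<in> L"
    "\<And>p. p \<in> topspace (top_of N) \<Longrightarrow> u_coord p \<in> L \<Longrightarrow> F p = f0 p"
proof -
  let ?N = "topspace (top_of N)"
  \<comment> \<open>A partial continuation: a section over an open interval around \<open>t0\<close>
    with the prescribed germ there.\<close>
  define Q where "Q K f \<longleftrightarrow> open K \<and> connected K \<and> K \<subseteq> I \<and> t0 \<in> K \<and> heis_section K f \<and>
    (\<exists>L. open L \<and> t0 \<in> L \<and> (\<forall>p\<in>?N. u_coord p \<in> L \<longrightarrow> f p = f0 p))" for K f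
  have JI: "J \<subseteq> I" if "(J, d) \<in> A" for J d using that cover_I by blast
  have Q_eq: "f p = f' p" if Q: "Q K f" "Q K' f'" and p: "p \<in> ?N" "u_coord p \<in> K" "u_coord p \<in> K'" for K f K' f' p
  proof -
    obtain L1 L2 where L: "open L1" "t0 \<in> L1" "\<forall>p\<in>?N. u_coord p \<in> L1 \<longrightarrow> f p = f0 p"
       "open L2" "t0 \<in> L2" "\<forall>p\<in>?N. u_coord p \<in> L2 \<longrightarrow> f' p = f0 p"
      using Q unfolding Q_def by blast
    show ?thesis
    proof (rule heis_section_unique[of "K \<inter> K'" f f' t0 "L1 \<inter> L2" p])
      show "connected (K \<inter> K')" using Q connected_Int_real unfolding Q_def by blast
    qed (use Q L p in \<open>auto simp: Q_def heis_section_def\<close>)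
  qed
  have ex: "\<exists>K f. t \<in> K \<and> Q K f" if t: "t \<in> I" for t
  proof (rule connected_induction_simple[OF I t0 t])
    obtain J d L where A: "(J, d) \<in> A" "t0 \<in> L" "L \<subseteq> J" and fL: "heis_in d L f0"
      using f0 unfolding heis_near_def by blast
    have "heis_section L f0" unfolding heis_section_def heis_near_def using A fL by blast
    then have "Q L f0"
      using fL A JI[OF A(1)] unfolding Q_def heis_in_def by blast
    then show "\<exists>K f. t0 \<in> K \<and> Q K f" using A by blast
    fix a assume a: "a \<in> I"
    obtain J d where A: "(J, d) \<in> A" "a \<in> J" using patch_at a by blast
    \<comment> \<open>A continuation reaching \<open>x\<close> is prolonged to \<open>y\<close>:
      extend its germ at \<open>x\<close> over an interval inside \<open>J\<close> containing both
      points, and glue. The two pieces agree on their overlap by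
      \<open>heis_section_unique\<close>.\<close>
    have step: "\<exists>K f. y \<in> K \<and> Q K f" if x: "x \<in> J" and y: "y \<in> J" and ex: "\<exists>K f. x \<in> K \<and> Q K f" for x y
    proof -
      obtain K f where K: "x \<in> K" "Q K f" using ex by blast
      obtain \<alpha> \<beta> where ab: "x \<in> {\<alpha><..<\<beta>}" "y \<in> {\<alpha><..<\<beta>}" "{\<alpha><..<\<beta>} \<subseteq> J"
        using interval_between patch[OF A(1)] x y by metis
      let ?K = "{\<alpha><..<\<beta>}"
      have fK: "heis_section K f" using K(2) by (simp add: Q_def)
      then have "heis_near x f" using K(1) unfolding heis_section_def by blast
      then obtain g L where g: "heis_section ?K g" and L: "open L" "x \<in> L"
        "\<And>p. p \<in> ?N \<Longrightarrow> u_coord p \<in> L \<Longrightarrow> f p = g p"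
        using heis_extend_patch[OF A(1) ab(3,1)] by blast
      have fg: "f p = g p" if p: "p \<in> ?N" "u_coord p \<in> K" "u_coord p \<in> ?K" for p
      proof (rule heis_section_unique[of "K \<inter> ?K" f g x L p])
        show "connected (K \<inter> ?K)"
          using K(2) connected_Int_real[of K ?K] unfolding Q_def by simp
      qed (use K fK g L ab p in \<open>auto simp: Q_def heis_section_def\<close>)
      define h where "h p = (if u_coord p \<in> K then f p else g p)" for p
      have "heis_near t h" if "t \<in> K \<union> ?K" for t
      proof (cases "t \<in> K")
        case True
        show ?thesis
          by (rule heis_near_cong[of t f K]) (use True K(2) fK in \<open>auto simp: Q_def heis_section_def h_def\<close>)
      next
        case False
        show ?thesis
          by (rule heis_near_cong[of t g ?K]) (use False that g fg in \<open>auto simp: heis_section_def h_def\<close>)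
      qed
      then have "heis_section (K \<union> ?K) h" by (simp add: heis_section_def)
      moreover have "connected (K \<union> ?K)"
        by (rule connected_Un) (use K ab in \<open>auto simp: Q_def\<close>)
      moreover have "K \<union> ?K \<subseteq> I" using K(2) ab(3) JI[OF A(1)] unfolding Q_def by blast
      moreover have "\<exists>L. open L \<and> t0 \<in> L \<and> (\<forall>p\<in>?N. u_coord p \<in> L \<longrightarrow> h p = f0 p)"
      proof -
        obtain L1 where L1: "open L1" "t0 \<in> L1" "\<forall>p\<in>?N. u_coord p \<in> L1 \<longrightarrow> f p = f0 p"
          using K(2) unfolding Q_def by blast
        then show ?thesis using K(2) unfolding Q_def h_def by (intro exI[of _ "L1 \<inter> K"]) auto
      qed
      ultimately have "Q (K \<union> ?K) h" using K(2) unfolding Q_def by auto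
      then show ?thesis using ab(2) by blast
    qed
    have op: "openin (top_of_set I) J"
      using patch[OF A(1)] JI[OF A(1)] by (simp add: open_subset)
    show "\<exists>T. openin (top_of_set I) T \<and> a \<in> T \<and>
        (\<forall>x\<in>T. \<forall>y\<in>T. (\<exists>K f. x \<in> K \<and> Q K f) \<longrightarrow> (\<exists>K f. y \<in> K \<and> Q K f))"
      by (rule exI[of _ J], intro conjI ballI impI op A(2)) (rule step)
  qed
  then obtain KK ff where KK: "\<And>t. t \<in> I \<Longrightarrow> t \<in> KK t" "\<And>t. t \<in> I \<Longrightarrow> Q (KK t) (ff t)" by metis
  \<comment> \<open>Each point uses the continuation chosen for its own parameter;
    \<open>Q_eq\<close> makes the choice immaterial.\<close>
  define F where "F p = ff (u_coord p) p" for p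
  have F_eq: "F p = ff t p" if "t \<in> I" "p \<in> ?N" "u_coord p \<in> KK t" for t p
    unfolding F_def using Q_eq[OF KK(2) KK(2), of "u_coord p" t p] u_coord_in[OF that(2)] KK(1) that by blast
  have "heis_near t F" if t: "t \<in> I" for t
    by (rule heis_near_cong[of t "ff t" "KK t"]) (use KK[OF t] F_eq[OF t] t in \<open>auto simp: Q_def heis_section_def\<close>)
  then have "heis_section I F" by (simp add: heis_section_def)
  moreover obtain L where L: "open L" "t0 \<in> L" "\<forall>p\<in>?N. u_coord p \<in> L \<longrightarrow> ff t0 p = f0 p"
    using KK(2)[OF t0] unfolding Q_def by blast
  ultimately show ?thesis
    using that[of F "L \<inter> KK t0"] KK[OF t0] F_eq[OF t0] unfolding Q_def by auto
qed

lemma heis_section_locally_isometric: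
  assumes F: "heis_section I F"
  shows "locally_isometric N N F"
proof (rule locally_isometricI[OF N N])
  fix p assume p: "p \<in> topspace (top_of N)"
  obtain J d L where A: "(J, d) \<in> A" "u_coord p \<in> L" "L \<subseteq> J" and fL: "heis_in d L F"
    using F u_coord_in[OF p] unfolding heis_section_def heis_near_def by blast
  have pd: "p \<in> fst d" using patch_dom[OF A(1)] p A by blast
  have "snd d p \<in> slab L" using u_coord_eq[OF A(1) pd] A by simp
  moreover have "slab L \<subseteq> snd d ` fst d" using patch[OF A(1)] A(3) by auto
  moreover have "F (chart_inv d q) \<in> fst d" if "q \<in> slab L" for q
    using patch_inv(2)[OF A(1), of q] that fL A(3) unfolding heis_in_def by auto
  moreover have "iso_on (slab L) (local_metric N d) (local_metric N d) (\<lambda>q. snd d (F (chart_inv d q)))"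
    using fL unfolding heis_in_def heis_on_def by blast
  ultimately show "\<exists>c\<in>charts N. \<exists>c'\<in>charts N. \<exists>W. p \<in> fst c \<and> snd c p \<in> W \<and> W \<subseteq> snd c ` fst c \<and>
      (\<forall>q\<in>W. F (chart_inv c q) \<in> fst c') \<and>
      iso_on W (local_metric N c) (local_metric N c') (\<lambda>q. snd c' (F (chart_inv c q)))"
    using patch[OF A(1)] pd by (intro bexI[of _ d] exI[of _ "slab L"]) auto
qed

text \<open>A coordinate translation in one patch moves \<open>p\<close> to \<open>q\<close> and
  continues along \<open>I\<close>. The opposite translation continues to the inverse, because both
  composites are sections that agree with the identity near \<open>t0\<close>.\<close>

lemma slice_transitive:
  assumes p: "p \<in> topspace (top_of N)" and q: "q \<in> topspace (top_of N)" and pq: "u_coord p = u_coord q"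
  obtains F G where "locally_isometric N N F" "locally_isometric N N G"
    "\<And>r. r \<in> topspace (top_of N) \<Longrightarrow> G (F r) = r" "\<And>r. r \<in> topspace (top_of N) \<Longrightarrow> F (G r) = r" "F p = q"
proof -
  let ?N = "topspace (top_of N)"
  define t0 where "t0 = u_coord p"
  have t0: "t0 \<in> I" using u_coord_in[OF p] by (simp add: t0_def)
  obtain J d where A: "(J, d) \<in> A" "t0 \<in> J" using patch_at[OF t0] by blast
  obtain C where ros: "rosen_metric (local_metric N d) C J" using patch_metric[OF A(1)] by blast
  have pqd: "p \<in> fst d" "q \<in> fst d" using patch_dom[OF A(1)] p q A(2) pq by (auto simp: t0_def)
  define tr where "tr w r = chart_inv d (snd d r + w)" for w r
  have tr: "tr w r \<in> fst d \<and> snd d (tr w r) = snd d r + w" if "r \<in> fst d" "w $ U = 0" for w r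
  proof -
    have "snd d r \<in> slab J" using patch[OF A(1)] that(1) by blast
    then show ?thesis using patch_inv(2)[OF A(1), of "snd d r + w"] that(2) by (simp add: tr_def)
  qed
  have tr_near: "heis_near t0 (tr w)" if w: "w $ U = 0" for w
  proof -
    have "heis_on (local_metric N d) J (\<lambda>q. snd d (tr w (chart_inv d q)))"
    proof (rule heis_on_cong[OF heis_on_translation[OF ros _ w]])
      show "open J" using patch[OF A(1)] by blast
      show "q + w = snd d (tr w (chart_inv d q))" if "q \<in> slab J" for q
        using tr[OF _ w, of "chart_inv d q"] patch_inv(2)[OF A(1) that] by simp
    qed
    then have "heis_in d J (tr w)" using patch[OF A(1)] tr[OF _ w] by (simp add: heis_in_def)
    then show ?thesis unfolding heis_near_def using A by blast
  qed
  have id: "heis_section I (\<lambda>r. r)"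
  proof (unfold heis_section_def, intro ballI)
    fix t assume "t \<in> I"
    then obtain J d where B: "(J, d) \<in> A" "t \<in> J" using patch_at by blast
    obtain C where ros: "rosen_metric (local_metric N d) C J" using patch_metric[OF B(1)] by blast
    have "heis_on (local_metric N d) J (\<lambda>q. snd d (chart_inv d q))"
      by (rule heis_on_cong[OF heis_on_translation[OF ros, of 0]]) (use patch[OF B(1)] patch_inv(2)[OF B(1)] in auto)
    then have "heis_in d J (\<lambda>r. r)" using patch[OF B(1)] by (simp add: heis_in_def)
    then show "heis_near t (\<lambda>r. r)" unfolding heis_near_def using B by blast
  qed
  define w where "w = snd d q - snd d p"
  have w: "w $ U = 0" "(- w) $ U = 0" using u_coord_eq[OF A(1)] pqd pq by (simp_all add: w_def)
  obtain F L where F: "heis_section I F" "open L" "t0 \<in> L" "\<And>r. r \<in> ?N \<Longrightarrow> u_coord r \<in> L \<Longrightarrow> F r = tr w r"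
    using heis_global[OF t0 tr_near[OF w(1)]] by blast
  obtain G L' where G: "heis_section I G" "open L'" "t0 \<in> L'" "\<And>r. r \<in> ?N \<Longrightarrow> u_coord r \<in> L' \<Longrightarrow> G r = tr (- w) r"
    using heis_global[OF t0 tr_near[OF w(2)]] by blast
  \<comment> \<open>A general \<open>z\<close> serves both orders of composition, with
    \<open>z = w\<close> and with \<open>z = - w\<close>.\<close>
  have inv: "g (f r) = r" if fg: "heis_section I f" "heis_section I g" "open L" "t0 \<in> L" "open L'" "t0 \<in> L'"
    "\<And>r. r \<in> ?N \<Longrightarrow> u_coord r \<in> L \<Longrightarrow> f r = tr z r" "\<And>r. r \<in> ?N \<Longrightarrow> u_coord r \<in> L' \<Longrightarrow> g r = tr (- z) r"
    "z $ U = 0" "r \<in> ?N" for f g L L' z r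
  proof (rule heis_section_unique[OF I subset_refl _ id t0, of "\<lambda>r. g (f r)" "J \<inter> L \<inter> L'"])
    show "heis_section I (\<lambda>r. g (f r))"
      using fg(1,2) heis_near_compose unfolding heis_section_def by blast
    show "g (f s) = s" if s: "s \<in> ?N" "u_coord s \<in> J \<inter> L \<inter> L'" for s
    proof -
      have sd: "s \<in> fst d" using patch_dom[OF A(1)] s by blast
      have z': "(- z) $ U = 0" using fg(9) by simp
      have "f s = tr z s" using fg(7) s by blast
      moreover have "u_coord (f s) = u_coord s" "f s \<in> ?N"
        using heis_section_preserves[OF fg(1) s(1)] u_coord_in[OF s(1)] by auto
      ultimately have "g (f s) = tr (- z) (tr z s)" using fg(8)[of "f s"] s by simp
      moreover have "tr (- z) (tr z s) = s"
        using tr[OF sd fg(9)] patch_inv(1)[OF A(1) sd] by (simp add: tr_def[of "- z"])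
      ultimately show ?thesis by simp
    qed
  qed (use fg A patch[OF A(1)] u_coord_in in auto)
  have "F p = q"
    using F(4)[OF p] F(3) patch_inv(1)[OF A(1) pqd(2)] by (simp add: t0_def tr_def w_def)
  moreover have "G (F r) = r" if "r \<in> ?N" for r
    using inv[OF F(1) G(1) F(2,3) G(2,3) F(4) G(4) w(1) that] by simp
  moreover have "F (G r) = r" if "r \<in> ?N" for r
    using inv[OF G(1) F(1) G(2,3) F(2,3) G(4) _ w(2) that] F(4) by simp
  ultimately show ?thesis
    using that heis_section_locally_isometric F(1) G(1) by blast
qed

end

subsection \<open>Rescaled limits along the axis\<close>

lemma frechet_derivative_axis_expansion:
  fixes f :: "real^'m::finite \<Rightarrow> real"
  assumes "f differentiable (at y)"
  shows "frechet_derivative f (at y) w = (\<Sum>i\<in>UNIV. w $ i * dd (axis i 1) f y)"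
proof -
  have lin: "linear (frechet_derivative f (at y))"
    using assms linear_frechet_derivative by blast
  have "frechet_derivative f (at y) w = frechet_derivative f (at y) (\<Sum>i\<in>UNIV. w $ i *\<^sub>R axis i 1)"
    using basis_expansion[of w] by (simp add: scalar_mult_eq_scaleR)
  then show ?thesis by (simp add: linear_sum[OF lin] linear_cmul[OF lin])
qed

text \<open>In the Taylor remainder the direction depends on \<Omega>; the expansion leaves fixed
  partial derivatives, which converge by continuity.\<close>

lemma dd_dd_axis_expansion:
  fixes f :: "real^'m::finite \<Rightarrow> real"
  assumes f: "smooth_on W f" and y: "y \<in> W"
  shows "dd w (dd w f) y = (\<Sum>i\<in>UNIV. \<Sum>j\<in>UNIV. w $ i * w $ j * dd (axis j 1) (dd (axis i 1) f) y)"
proof -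
  have eq: "dd w f x = (\<Sum>i\<in>UNIV. w $ i * dd (axis i 1) f x)" if "x \<in> W" for x
    by (rule frechet_derivative_axis_expansion[OF smooth_on_differentiable[OF f that]])
  have fi: "smooth_on W (dd (axis i 1) f)" for i by (rule smooth_on_dd[OF f])
  have "((\<lambda>x. \<Sum>i\<in>UNIV. w $ i * dd (axis i 1) f x) has_derivative
      (\<lambda>v. \<Sum>i\<in>UNIV. w $ i * dd v (dd (axis i 1) f) y)) (at y)"
    by (intro has_derivative_sum has_derivative_mult_right smooth_on_has_derivative[OF fi y])
  from fun_cong[OF frechet_derivative_at[OF this], of w]
  have "dd w (dd w f) y = (\<Sum>i\<in>UNIV. w $ i * dd w (dd (axis i 1) f) y)"
    using frechet_derivative_transform_open(2)[OF smooth_on_open[OF f] y, of "dd w f"] eq by auto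
  also have "\<dots> = (\<Sum>i\<in>UNIV. w $ i * (\<Sum>j\<in>UNIV. w $ j * dd (axis j 1) (dd (axis i 1) f) y))"
    by (intro sum.cong refl arg_cong2[where f="(*)"])
      (rule frechet_derivative_axis_expansion[OF smooth_on_differentiable[OF fi y]])
  finally show ?thesis by (simp add: sum_distrib_left mult.assoc)
qed

lemma smooth_on_line_derivative:
  fixes f :: "'a::real_normed_vector \<Rightarrow> real"
  assumes f: "smooth_on W f" and t: "a + t *\<^sub>R w \<in> W"
  shows "((\<lambda>t. f (a + t *\<^sub>R w)) has_real_derivative dd w f (a + t *\<^sub>R w)) (at t)"
proof -
  note D = smooth_on_has_derivative[OF f t]
  have "((\<lambda>t. a + t *\<^sub>R w) has_derivative (\<lambda>s. s *\<^sub>R w)) (at t)"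
    by (auto intro!: derivative_eq_intros)
  from has_derivative_compose[OF this D]
  have "((\<lambda>t. f (a + t *\<^sub>R w)) has_derivative (\<lambda>s. s * dd w f (a + t *\<^sub>R w))) (at t)"
    using linear_cmul[OF has_derivative_linear[OF D]] by simp
  moreover have "(\<lambda>s. s * dd w f (a + t *\<^sub>R w)) = (*) (dd w f (a + t *\<^sub>R w))"
    by (simp add: fun_eq_iff)
  ultimately show ?thesis unfolding has_field_derivative_def by metis
qed

lemma taylor_first_order:
  fixes f :: "'a::real_normed_vector \<Rightarrow> real"
  assumes f: "smooth_on W f" and seg: "\<And>t. 0 \<le> t \<Longrightarrow> t \<le> 1 \<Longrightarrow> a + t *\<^sub>R w \<in> W"
  shows "\<exists>t. 0 < t \<and> t < 1 \<and> f (a + w) = f a + dd w f (a + t *\<^sub>R w)"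
proof -
  obtain t where "0 < t" "t < 1" "f (a + 1 *\<^sub>R w) - f (a + 0 *\<^sub>R w) = (1 - 0) * dd w f (a + t *\<^sub>R w)"
    using MVT2[of 0 1 "\<lambda>t. f (a + t *\<^sub>R w)" "\<lambda>t. dd w f (a + t *\<^sub>R w)"]
      smooth_on_line_derivative[OF f seg] by auto
  then show ?thesis by (intro exI[of _ t]) simp
qed

lemma taylor_second_order:
  fixes f :: "'a::real_normed_vector \<Rightarrow> real"
  assumes f: "smooth_on W f" and seg: "\<And>t. 0 \<le> t \<Longrightarrow> t \<le> 1 \<Longrightarrow> a + t *\<^sub>R w \<in> W"
  shows "\<exists>t. 0 < t \<and> t < 1 \<and> f (a + w) = f a + dd w f a + dd w (dd w f) (a + t *\<^sub>R w) / 2"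
proof -
  define diff where "diff m t = (if m = 0 then f (a + t *\<^sub>R w) else if m = 1 then dd w f (a + t *\<^sub>R w)
     else dd w (dd w f) (a + t *\<^sub>R w))" for m :: nat and t
  have "\<exists>t. 0 < t \<and> t < 1 \<and> diff 0 1 = (\<Sum>m<2. diff m 0 / fact m * 1 ^ m) + diff 2 t / fact 2 * 1 ^ 2"
  proof (rule Maclaurin)
    show "\<forall>m t. m < 2 \<and> 0 \<le> t \<and> t \<le> 1 \<longrightarrow> (diff m has_real_derivative diff (Suc m) t) (at t)"
    proof (intro allI impI)
      fix m :: nat and t :: real assume mt: "m < 2 \<and> 0 \<le> t \<and> t \<le> 1"
      then have "m = 0 \<or> m = 1" by auto
      then show "(diff m has_real_derivative diff (Suc m) t) (at t)"
        using smooth_on_line_derivative[OF f seg, of t] smooth_on_line_derivative[OF smooth_on_dd[OF f] seg, of t] mt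
        by (auto simp: diff_def[abs_def])
    qed
  qed auto
  then show ?thesis by (simp add: diff_def numeral_2_eq_2)
qed

section \<open>Dilations and weighted Taylor limits\<close>

context null_frame
begin

abbreviation dil :: "real \<Rightarrow> real^'m \<Rightarrow> real^'m" where "dil \<equiv> dilate U V"

abbreviation pd :: "'m \<Rightarrow> (real^'m \<Rightarrow> real) \<Rightarrow> real^'m \<Rightarrow> real" where "pd i f \<equiv> dd (axis i 1) f"

lemma dil_nth [simp]: "dil \<Omega> q $ U = q $ U" "dil \<Omega> q $ V = \<Omega>\<^sup>2 * q $ V"
  "i \<noteq> U \<Longrightarrow> i \<noteq> V \<Longrightarrow> dil \<Omega> q $ i = \<Omega> * q $ i"
  using UV by (simp_all add: dilate_def)

lemma Y_dil [simp]: "Y (dil \<Omega> q) = \<Omega> *\<^sub>R Y q"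
  by (simp add: vec_eq_iff Y_def)

text \<open>Splits a dilated point into a point of the axis and a small displacement without
  \<open>u\<close>-entry; the Taylor expansions start from the former in the direction of the
  latter.\<close>

lemma dil_eq: "dil \<Omega> q = ax (q $ U) + (\<Omega> *\<^sub>R Y q + (\<Omega>\<^sup>2 * q $ V) *\<^sub>R axis V 1)"
  by (rule vec_eqI3) (simp_all add: Y_add Y_scaleR)

lemma dil_dil [simp]: "dil a (dil b q) = dil (a * b) q"
  by (rule vec_eqI3) (simp_all add: power_mult_distrib)

lemma dil_1 [simp]: "dil 1 q = q"
  by (rule vec_eqI3) simp_all

lemma linear_dil: "linear (dil \<Omega>)"
  by (rule linearI; rule vec_eqI3) (simp_all add: Y_add Y_scaleR algebra_simps)

lemma ax_scaleR: "ax u = u *\<^sub>R axis U 1"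
  by (simp add: vec_eq_iff axis_def)

lemma tendsto_ax: "(f \<longlongrightarrow> u) F \<Longrightarrow> ((\<lambda>x. ax (f x)) \<longlongrightarrow> ax u) F"
  unfolding ax_scaleR[of "f _"] ax_scaleR[of u] by (intro tendsto_intros)

lemma at_right_ident: "((\<lambda>\<Omega>. \<Omega>) \<longlongrightarrow> 0) (at_right (0::real))"
  by (rule tendsto_ident_at)

lemma at_right_pos: "\<forall>\<^sub>F \<Omega> in at_right (0::real). 0 < \<Omega>"
  by (rule eventually_at_right_less)

lemma tendsto_Y: "(f \<longlongrightarrow> q) F \<Longrightarrow> ((\<lambda>x. Y (f x)) \<longlongrightarrow> Y q) F"
  by (rule bounded_linear.tendsto[OF bounded_linear_Y])

lemma tendsto_dil:
  assumes "(qq \<longlongrightarrow> q) (at_right 0)"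
  shows "((\<lambda>\<Omega>. dil \<Omega> (qq \<Omega>)) \<longlongrightarrow> ax (q $ U)) (at_right 0)"
proof -
  have "((\<lambda>\<Omega>. ax (qq \<Omega> $ U) + (\<Omega> *\<^sub>R Y (qq \<Omega>) + (\<Omega>\<^sup>2 * qq \<Omega> $ V) *\<^sub>R axis V 1)) \<longlongrightarrow>
      ax (q $ U) + (0 *\<^sub>R Y q + (0\<^sup>2 * q $ V) *\<^sub>R axis V 1)) (at_right 0)"
    by (intro tendsto_add tendsto_scaleR tendsto_mult tendsto_power at_right_ident tendsto_const
        tendsto_ax tendsto_Y tendsto_vec_nth assms)
  then show ?thesis by (simp add: dil_eq)
qed

lemma dil_limit_0:
  assumes "isCont f (ax (q $ U))" "(qq \<longlongrightarrow> q) (at_right 0)"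
  shows "((\<lambda>\<Omega>. f (dil \<Omega> (qq \<Omega>))) \<longlongrightarrow> f (ax (q $ U))) (at_right 0)"
  by (rule isCont_tendsto_compose[OF assms(1) tendsto_dil[OF assms(2)]])

text \<open>The Taylor point is an unknown point of the segment from the axis to the dilated point.
  Balls are convex, so the entire segment shrinks to the limit point on the axis, which controls
  it.\<close>

lemma dil_segment:
  assumes W: "open W" "ax (q $ U) \<in> W" and qq: "(qq \<longlongrightarrow> q) (at_right 0)"
  obtains r where "r > 0" "ball (ax (q $ U)) r \<subseteq> W"
    "\<And>e. 0 < e \<Longrightarrow> \<forall>\<^sub>F \<Omega> in at_right 0. \<forall>t. 0 \<le> t \<and> t \<le> 1 \<longrightarrow>
      ax (qq \<Omega> $ U) + t *\<^sub>R (\<Omega> *\<^sub>R Y (qq \<Omega>) + (\<Omega>\<^sup>2 * qq \<Omega> $ V) *\<^sub>R axis V 1) \<in> ball (ax (q $ U)) e"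
proof -
  obtain r where r: "r > 0" "ball (ax (q $ U)) r \<subseteq> W" using W openE by blast
  have "\<forall>\<^sub>F \<Omega> in at_right 0. \<forall>t. 0 \<le> t \<and> t \<le> 1 \<longrightarrow>
      ax (qq \<Omega> $ U) + t *\<^sub>R (\<Omega> *\<^sub>R Y (qq \<Omega>) + (\<Omega>\<^sup>2 * qq \<Omega> $ V) *\<^sub>R axis V 1) \<in> ball (ax (q $ U)) e"
    if e: "0 < e" for e
  proof -
    have 1: "((\<lambda>\<Omega>. ax (qq \<Omega> $ U)) \<longlongrightarrow> ax (q $ U)) (at_right 0)"
      by (intro tendsto_ax tendsto_vec_nth qq)
    have "\<forall>\<^sub>F \<Omega> in at_right 0. dil \<Omega> (qq \<Omega>) \<in> ball (ax (q $ U)) e \<and> ax (qq \<Omega> $ U) \<in> ball (ax (q $ U)) e"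
      using topological_tendstoD[OF tendsto_dil[OF qq], of "ball (ax (q $ U)) e"]
        topological_tendstoD[OF 1, of "ball (ax (q $ U)) e"] e by (auto intro: eventually_conj)
    then show ?thesis
    proof eventually_elim
      case (elim \<Omega>)
      have "convex (ball (ax (q $ U)) e)" by simp
      then have "(1 - t) *\<^sub>R ax (qq \<Omega> $ U) + t *\<^sub>R dil \<Omega> (qq \<Omega>) \<in> ball (ax (q $ U)) e"
        if "0 \<le> t" "t \<le> 1" for t
        using elim that convexD[of "ball (ax (q $ U)) e" "ax (qq \<Omega> $ U)" "dil \<Omega> (qq \<Omega>)" "1 - t" t] by simp
      then show ?case by (simp add: dil_eq[of \<Omega>] algebra_simps)
    qed
  qed
  with r that show ?thesis by blast
qed

text \<open>The displacement off the axis has order \<Omega> in \<open>y\<close> and \<Omega>^2 in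
  \<open>v\<close>, so after division by \<Omega> only transverse derivatives survive. The point
  \<open>qq \<Omega>\<close> may move, as composition of limits will require.\<close>

lemma dil_limit_1:
  assumes f: "smooth_on W f" and K: "open K" "q $ U \<in> K" "\<And>u. u \<in> K \<Longrightarrow> ax u \<in> W"
    and 0: "\<And>u. u \<in> K \<Longrightarrow> f (ax u) = 0" and qq: "(qq \<longlongrightarrow> q) (at_right 0)"
  shows "((\<lambda>\<Omega>. f (dil \<Omega> (qq \<Omega>)) / \<Omega>) \<longlongrightarrow> (\<Sum>i\<in>UNIV. Y q $ i * pd i f (ax (q $ U)))) (at_right 0)"
proof -
  let ?a = "ax (q $ U)"
  let ?a' = "\<lambda>\<Omega>. ax (qq \<Omega> $ U)" and ?w = "\<lambda>\<Omega>. \<Omega> *\<^sub>R Y (qq \<Omega>) + (\<Omega>\<^sup>2 * qq \<Omega> $ V) *\<^sub>R axis V 1"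
  let ?v = "\<lambda>\<Omega>. Y (qq \<Omega>) + (\<Omega> * qq \<Omega> $ V) *\<^sub>R axis V 1"
  have W: "open W" "?a \<in> W" using f smooth_on_open K by blast+
  obtain r where r: "r > 0" "ball ?a r \<subseteq> W" and
    seg: "\<And>e. 0 < e \<Longrightarrow> \<forall>\<^sub>F \<Omega> in at_right 0. \<forall>t. 0 \<le> t \<and> t \<le> 1 \<longrightarrow> ?a' \<Omega> + t *\<^sub>R ?w \<Omega> \<in> ball ?a e"
    using dil_segment[OF W qq] by blast
  have qK: "\<forall>\<^sub>F \<Omega> in at_right 0. qq \<Omega> $ U \<in> K"
    using topological_tendstoD[OF tendsto_vec_nth[OF qq] K(1,2)] .
  \<comment> \<open>The Taylor point is selected for every \<Omega>, so that its convergence can be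
    stated; the selection is meaningful for all small \<Omega>, by \<open>ev\<close>.\<close>
  define P where "P \<Omega> t \<longleftrightarrow> 0 < t \<and> t < 1 \<and> f (?a' \<Omega> + ?w \<Omega>) = f (?a' \<Omega>) + dd (?w \<Omega>) f (?a' \<Omega> + t *\<^sub>R ?w \<Omega>)" for \<Omega> t
  define \<xi> where "\<xi> \<Omega> = ?a' \<Omega> + (SOME t. P \<Omega> t) *\<^sub>R ?w \<Omega>" for \<Omega>
  have ev: "\<forall>\<^sub>F \<Omega> in at_right 0. P \<Omega> (SOME t. P \<Omega> t)"
    using seg[OF r(1)]
  proof eventually_elim
    case (elim \<Omega>)
    then have "\<exists>t. P \<Omega> t" unfolding P_def using r(2) by (intro taylor_first_order[OF f]) blast
    then show ?case by (rule someI_ex)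
  qed
  have \<xi>: "(\<xi> \<longlongrightarrow> ?a) (at_right 0)"
  proof (rule tendstoI)
    fix e :: real assume "0 < e"
    show "\<forall>\<^sub>F \<Omega> in at_right 0. dist (\<xi> \<Omega>) ?a < e"
      using seg[OF \<open>0 < e\<close>] ev
    proof eventually_elim
      case (elim \<Omega>)
      then have "\<xi> \<Omega> \<in> ball ?a e" unfolding \<xi>_def P_def by auto
      then show ?case by (simp add: dist_commute)
    qed
  qed
  have cont: "isCont (pd i f) ?a" for i
    using smooth_on_continuous_on[OF smooth_on_dd[OF f]] W continuous_on_eq_continuous_at by blast
  have "((\<lambda>\<Omega>. \<Sum>i\<in>UNIV. ?v \<Omega> $ i * pd i f (\<xi> \<Omega>)) \<longlongrightarrow>
      (\<Sum>i\<in>UNIV. (Y q + (0 * q $ V) *\<^sub>R axis V 1) $ i * pd i f ?a)) (at_right 0)"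
    by (intro tendsto_sum tendsto_mult tendsto_vec_nth tendsto_add tendsto_scaleR tendsto_const
        tendsto_Y at_right_ident qq isCont_tendsto_compose[OF cont \<xi>])
  then have "((\<lambda>\<Omega>. \<Sum>i\<in>UNIV. ?v \<Omega> $ i * pd i f (\<xi> \<Omega>)) \<longlongrightarrow> (\<Sum>i\<in>UNIV. Y q $ i * pd i f ?a)) (at_right 0)"
    by simp
  moreover have "\<forall>\<^sub>F \<Omega> in at_right 0. (\<Sum>i\<in>UNIV. ?v \<Omega> $ i * pd i f (\<xi> \<Omega>)) = f (dil \<Omega> (qq \<Omega>)) / \<Omega>"
    using seg[OF r(1)] ev qK at_right_pos
  proof eventually_elim
    case (elim \<Omega>)
    have "\<xi> \<Omega> \<in> W" using elim(1,2) r(2) unfolding \<xi>_def P_def by (meson less_imp_le subsetD)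
    have "f (dil \<Omega> (qq \<Omega>)) = dd (?w \<Omega>) f (\<xi> \<Omega>)"
      using elim(2) 0[OF elim(3)] unfolding P_def \<xi>_def by (simp add: dil_eq[of \<Omega>])
    also have "\<dots> = (\<Sum>i\<in>UNIV. ?w \<Omega> $ i * pd i f (\<xi> \<Omega>))"
      by (rule frechet_derivative_axis_expansion[OF smooth_on_differentiable[OF f \<open>\<xi> \<Omega> \<in> W\<close>]])
    also have "?w \<Omega> = \<Omega> *\<^sub>R ?v \<Omega>" by (simp add: algebra_simps power2_eq_square)
    also have "(\<Sum>i\<in>UNIV. (\<Omega> *\<^sub>R ?v \<Omega>) $ i * pd i f (\<xi> \<Omega>)) = \<Omega> * (\<Sum>i\<in>UNIV. ?v \<Omega> $ i * pd i f (\<xi> \<Omega>))"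
      by (simp add: sum_distrib_left mult.assoc distrib_right distrib_left)
    finally show ?case using elim(4) by simp
  qed
  ultimately show ?thesis by (rule Lim_transform_eventually)
qed

text \<open>If the transverse first derivatives vanish on the axis too, the function has order
  \<Omega>^2: the \<open>v\<close>-derivative, whose displacement has that order already, joins the
  transverse Hessian.\<close>

lemma dil_limit_2:
  assumes f: "smooth_on W f" and K: "open K" "q $ U \<in> K" "\<And>u. u \<in> K \<Longrightarrow> ax u \<in> W"
    and 0: "\<And>u. u \<in> K \<Longrightarrow> f (ax u) = 0"
    and 1: "\<And>u i. u \<in> K \<Longrightarrow> i \<noteq> U \<Longrightarrow> i \<noteq> V \<Longrightarrow> pd i f (ax u) = 0"
    and qq: "(qq \<longlongrightarrow> q) (at_right 0)"
  shows "((\<lambda>\<Omega>. f (dil \<Omega> (qq \<Omega>)) / \<Omega>\<^sup>2) \<longlongrightarrow> q $ V * pd V f (ax (q $ U)) +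
    (\<Sum>i\<in>UNIV. \<Sum>j\<in>UNIV. Y q $ i * Y q $ j * pd j (pd i f) (ax (q $ U))) / 2) (at_right 0)"
proof -
  let ?a = "ax (q $ U)"
  let ?a' = "\<lambda>\<Omega>. ax (qq \<Omega> $ U)" and ?w = "\<lambda>\<Omega>. \<Omega> *\<^sub>R Y (qq \<Omega>) + (\<Omega>\<^sup>2 * qq \<Omega> $ V) *\<^sub>R axis V 1"
  let ?v = "\<lambda>\<Omega>. Y (qq \<Omega>) + (\<Omega> * qq \<Omega> $ V) *\<^sub>R axis V 1"
  have W: "open W" "?a \<in> W" using f smooth_on_open K by blast+
  obtain r where r: "r > 0" "ball ?a r \<subseteq> W" and
    seg: "\<And>e. 0 < e \<Longrightarrow> \<forall>\<^sub>F \<Omega> in at_right 0. \<forall>t. 0 \<le> t \<and> t \<le> 1 \<longrightarrow> ?a' \<Omega> + t *\<^sub>R ?w \<Omega> \<in> ball ?a e"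
    using dil_segment[OF W qq] by blast
  have qK: "\<forall>\<^sub>F \<Omega> in at_right 0. qq \<Omega> $ U \<in> K"
    using topological_tendstoD[OF tendsto_vec_nth[OF qq] K(1,2)] .
  define P where "P \<Omega> t \<longleftrightarrow> 0 < t \<and> t < 1 \<and> f (?a' \<Omega> + ?w \<Omega>) = f (?a' \<Omega>) + dd (?w \<Omega>) f (?a' \<Omega>)
    + dd (?w \<Omega>) (dd (?w \<Omega>) f) (?a' \<Omega> + t *\<^sub>R ?w \<Omega>) / 2" for \<Omega> t
  define \<xi> where "\<xi> \<Omega> = ?a' \<Omega> + (SOME t. P \<Omega> t) *\<^sub>R ?w \<Omega>" for \<Omega>
  have ev: "\<forall>\<^sub>F \<Omega> in at_right 0. P \<Omega> (SOME t. P \<Omega> t)"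
    using seg[OF r(1)]
  proof eventually_elim
    case (elim \<Omega>)
    then have "\<exists>t. P \<Omega> t" unfolding P_def using r(2) by (intro taylor_second_order[OF f]) blast
    then show ?case by (rule someI_ex)
  qed
  have \<xi>: "(\<xi> \<longlongrightarrow> ?a) (at_right 0)"
  proof (rule tendstoI)
    fix e :: real assume "0 < e"
    show "\<forall>\<^sub>F \<Omega> in at_right 0. dist (\<xi> \<Omega>) ?a < e"
      using seg[OF \<open>0 < e\<close>] ev
    proof eventually_elim
      case (elim \<Omega>)
      then have "\<xi> \<Omega> \<in> ball ?a e" unfolding \<xi>_def P_def by auto
      then show ?case by (simp add: dist_commute)
    qed
  qed
  have cont: "isCont (pd i f) ?a" for i
    using smooth_on_continuous_on[OF smooth_on_dd[OF f]] W continuous_on_eq_continuous_at by blast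
  have cont2: "isCont (pd j (pd i f)) ?a" for i j
    using smooth_on_continuous_on[OF smooth_on_dd[OF smooth_on_dd[OF f]]] W continuous_on_eq_continuous_at by blast
  have a': "(?a' \<longlongrightarrow> ?a) (at_right 0)" by (intro tendsto_ax tendsto_vec_nth qq)
  define E where "E \<Omega> = qq \<Omega> $ V * pd V f (?a' \<Omega>) +
     (\<Sum>i\<in>UNIV. \<Sum>j\<in>UNIV. ?v \<Omega> $ i * ?v \<Omega> $ j * pd j (pd i f) (\<xi> \<Omega>)) / 2" for \<Omega>
  have "(E \<longlongrightarrow> q $ V * pd V f ?a + (\<Sum>i\<in>UNIV. \<Sum>j\<in>UNIV. (Y q + (0 * q $ V) *\<^sub>R axis V 1) $ i *
     (Y q + (0 * q $ V) *\<^sub>R axis V 1) $ j * pd j (pd i f) ?a) / 2) (at_right 0)"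
    unfolding E_def
    by (intro tendsto_sum tendsto_mult tendsto_vec_nth tendsto_add tendsto_scaleR tendsto_const tendsto_divide
        tendsto_Y at_right_ident qq isCont_tendsto_compose[OF cont2 \<xi>] isCont_tendsto_compose[OF cont a']) simp
  then have "(E \<longlongrightarrow> q $ V * pd V f ?a + (\<Sum>i\<in>UNIV. \<Sum>j\<in>UNIV. Y q $ i * Y q $ j * pd j (pd i f) ?a) / 2) (at_right 0)"
    by simp
  moreover have "\<forall>\<^sub>F \<Omega> in at_right 0. E \<Omega> = f (dil \<Omega> (qq \<Omega>)) / \<Omega>\<^sup>2"
    using seg[OF r(1)] ev qK at_right_pos
  proof eventually_elim
    case (elim \<Omega>)
    have \<xi>W: "\<xi> \<Omega> \<in> W" using elim(1,2) r(2) unfolding \<xi>_def P_def by (meson less_imp_le subsetD)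
    have aW: "?a' \<Omega> \<in> W" using K(3) elim(3) by blast
    have "dd (?w \<Omega>) f (?a' \<Omega>) = (\<Sum>i\<in>UNIV. ?w \<Omega> $ i * pd i f (?a' \<Omega>))"
      by (rule frechet_derivative_axis_expansion[OF smooth_on_differentiable[OF f aW]])
    \<comment> \<open>The displacement has no \<open>u\<close>-entry and the transverse derivatives
      vanish on the axis, so only \<open>v\<close> contributes.\<close>
    also have "\<dots> = (\<Sum>i\<in>UNIV. if i = V then \<Omega>\<^sup>2 * qq \<Omega> $ V * pd V f (?a' \<Omega>) else 0)"
    proof (rule sum.cong)
      show "?w \<Omega> $ i * pd i f (?a' \<Omega>) = (if i = V then \<Omega>\<^sup>2 * qq \<Omega> $ V * pd V f (?a' \<Omega>) else 0)" for i
        using 1[OF elim(3), of i] UV by (cases "i = V"; cases "i = U") auto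
    qed simp
    also have "\<dots> = \<Omega>\<^sup>2 * (qq \<Omega> $ V * pd V f (?a' \<Omega>))" by simp
    finally have d1: "dd (?w \<Omega>) f (?a' \<Omega>) = \<Omega>\<^sup>2 * (qq \<Omega> $ V * pd V f (?a' \<Omega>))" .
    have "dd (?w \<Omega>) (dd (?w \<Omega>) f) (\<xi> \<Omega>) = (\<Sum>i\<in>UNIV. \<Sum>j\<in>UNIV. ?w \<Omega> $ i * ?w \<Omega> $ j * pd j (pd i f) (\<xi> \<Omega>))"
      by (rule dd_dd_axis_expansion[OF f \<xi>W])
    also have "\<dots> = (\<Sum>i\<in>UNIV. \<Sum>j\<in>UNIV. (\<Omega> * ?v \<Omega> $ i) * (\<Omega> * ?v \<Omega> $ j) * pd j (pd i f) (\<xi> \<Omega>))"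
      by (intro sum.cong refl) (simp add: algebra_simps power2_eq_square)
    also have "\<dots> = \<Omega>\<^sup>2 * (\<Sum>i\<in>UNIV. \<Sum>j\<in>UNIV. ?v \<Omega> $ i * ?v \<Omega> $ j * pd j (pd i f) (\<xi> \<Omega>))"
      unfolding sum_distrib_left by (intro sum.cong refl) (simp add: power2_eq_square)
    finally have d2: "dd (?w \<Omega>) (dd (?w \<Omega>) f) (\<xi> \<Omega>)
      = \<Omega>\<^sup>2 * (\<Sum>i\<in>UNIV. \<Sum>j\<in>UNIV. ?v \<Omega> $ i * ?v \<Omega> $ j * pd j (pd i f) (\<xi> \<Omega>))" .
    have "f (dil \<Omega> (qq \<Omega>)) = dd (?w \<Omega>) f (?a' \<Omega>) + dd (?w \<Omega>) (dd (?w \<Omega>) f) (\<xi> \<Omega>) / 2"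
      using elim(2) 0[OF elim(3)] unfolding P_def \<xi>_def by (simp add: dil_eq[of \<Omega>])
    also have "\<dots> = \<Omega>\<^sup>2 * E \<Omega>" unfolding d1 d2 E_def by (simp add: distrib_left)
    finally show ?case using elim(4) by simp
  qed
  ultimately show ?thesis by (rule Lim_transform_eventually)
qed

section \<open>Adapted metrics under dilations\<close>

lemma adapted_metric_axis_U:
  assumes "adapted_metric U V G"
  shows "axis U 1 \<bullet> (G *v y) = y $ V / 2"
proof -
  have "axis U 1 \<bullet> (G *v y) = (\<Sum>j\<in>UNIV. G $ U $ j * y $ j)"
    by (simp add: inner_axis' matrix_vector_mult_def)
  also have "\<dots> = (\<Sum>j\<in>UNIV. if j = V then y $ V / 2 else 0)"
  proof (rule sum.cong)
    show "G $ U $ j * y $ j = (if j = V then y $ V / 2 else 0)" for j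
      using assms UV by (cases "j = U"; cases "j = V") (auto simp: adapted_metric_def)
  qed simp
  finally show ?thesis by simp
qed

lemma adapted_metric_sym:
  assumes "adapted_metric U V G"
  shows "x \<bullet> (G *v y) = y \<bullet> (G *v x)"
proof -
  have "transpose G = G" using assms by (simp add: adapted_metric_def)
  then have "x v* G = G *v x" by (metis transpose_matrix_vector)
  then show ?thesis using dot_lmul_matrix[of x G y] by (simp add: inner_commute)
qed

lemma adapted_metric_inner:
  assumes G: "adapted_metric U V G"
  shows "x \<bullet> (G *v y) = rosen G x y + (y $ V * (Y x \<bullet> (G *v axis V 1)) + x $ V * (Y y \<bullet> (G *v axis V 1)))
    + x $ V * y $ V * (axis V 1 \<bullet> (G *v axis V 1))"
proof -
  have dec: "z = z $ U *\<^sub>R axis U 1 + (z $ V *\<^sub>R axis V 1 + Y z)" for z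
    by (rule vec_eqI3) (simp_all add: Y_add Y_scaleR)
  have U1: "axis U 1 \<bullet> (G *v z) = z $ V / 2" "z \<bullet> (G *v axis U 1) = z $ V / 2" for z
    using adapted_metric_axis_U[OF G] adapted_metric_sym[OF G, of z "axis U 1"] by auto
  have V1: "axis V 1 \<bullet> (G *v z) = z \<bullet> (G *v axis V 1)" for z
    by (rule adapted_metric_sym[OF G])
  have "x \<bullet> (G *v y) = (x $ U *\<^sub>R axis U 1 + (x $ V *\<^sub>R axis V 1 + Y x)) \<bullet>
      (G *v (y $ U *\<^sub>R axis U 1 + (y $ V *\<^sub>R axis V 1 + Y y)))"
    using dec[of x] dec[of y] by simp
  also have "\<dots> = rosen G x y + (y $ V * (Y x \<bullet> (G *v axis V 1)) + x $ V * (Y y \<bullet> (G *v axis V 1)))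
    + x $ V * y $ V * (axis V 1 \<bullet> (G *v axis V 1))"
    by (simp add: matrix_vector_right_distrib matrix_vector_mult_scaleR inner_add_left inner_add_right
        U1 V1[of "Y y"] rosen_def algebra_simps)
  finally show ?thesis .
qed

text \<open>The Rosen part has weight two throughout and is invariant under the rescaling, while the
  \<beta> terms keep a factor \<Omega> and the \<alpha> term a factor \<Omega>^2.\<close>

lemma adapted_metric_dil_inner:
  assumes G: "adapted_metric U V G" and "\<Omega> \<noteq> 0"
  shows "dil \<Omega> x \<bullet> (G *v dil \<Omega> y) / \<Omega>\<^sup>2 = rosen G x y +
    \<Omega> * (y $ V * (Y x \<bullet> (G *v axis V 1)) + x $ V * (Y y \<bullet> (G *v axis V 1)))
    + \<Omega>\<^sup>2 * (x $ V * y $ V * (axis V 1 \<bullet> (G *v axis V 1)))"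
proof -
  have "dil \<Omega> x \<bullet> (G *v dil \<Omega> y) = \<Omega>\<^sup>2 * (rosen G x y +
    \<Omega> * (y $ V * (Y x \<bullet> (G *v axis V 1)) + x $ V * (Y y \<bullet> (G *v axis V 1)))
    + \<Omega>\<^sup>2 * (x $ V * y $ V * (axis V 1 \<bullet> (G *v axis V 1))))"
    unfolding adapted_metric_inner[OF G, of "dil \<Omega> x"] rosen_def
    by (simp add: matrix_vector_mult_scaleR power2_eq_square algebra_simps)
  then show ?thesis using assms(2) by simp
qed

text \<open>Base point and vectors may vary with \<Omega>, so that images under the conjugated
  Jacobians can be inserted.\<close>

lemma dil_limit_metric:
  assumes g: "isCont g a" and zz: "(zz \<longlongrightarrow> a) (at_right 0)"
    and ad: "\<forall>\<^sub>F \<Omega> in at_right 0. adapted_metric U V (g (zz \<Omega>))"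
    and xx: "(xx \<longlongrightarrow> x) (at_right 0)" and yy: "(yy \<longlongrightarrow> y) (at_right 0)"
  shows "((\<lambda>\<Omega>. dil \<Omega> (xx \<Omega>) \<bullet> (g (zz \<Omega>) *v dil \<Omega> (yy \<Omega>)) / \<Omega>\<^sup>2) \<longlongrightarrow> rosen (g a) x y) (at_right 0)"
proof -
  have gz: "((\<lambda>\<Omega>. g (zz \<Omega>)) \<longlongrightarrow> g a) (at_right 0)" by (rule isCont_tendsto_compose[OF g zz])
  have mv: "((\<lambda>\<Omega>. g (zz \<Omega>) *v w \<Omega>) \<longlongrightarrow> g a *v w0) (at_right 0)" if "(w \<longlongrightarrow> w0) (at_right 0)" for w w0
    unfolding matrix_vector_mult_def
    by (intro vec_tendstoI) (auto intro!: tendsto_intros gz that)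
  let ?e = "axis V 1 :: real^'m"
  have "((\<lambda>\<Omega>. rosen (g (zz \<Omega>)) (xx \<Omega>) (yy \<Omega>) +
    \<Omega> * (yy \<Omega> $ V * (Y (xx \<Omega>) \<bullet> (g (zz \<Omega>) *v ?e)) + xx \<Omega> $ V * (Y (yy \<Omega>) \<bullet> (g (zz \<Omega>) *v ?e)))
    + \<Omega>\<^sup>2 * (xx \<Omega> $ V * yy \<Omega> $ V * (?e \<bullet> (g (zz \<Omega>) *v ?e)))) \<longlongrightarrow>
    rosen (g a) x y + 0 * (y $ V * (Y x \<bullet> (g a *v ?e)) + x $ V * (Y y \<bullet> (g a *v ?e)))
    + 0\<^sup>2 * (x $ V * y $ V * (?e \<bullet> (g a *v ?e)))) (at_right 0)"
    unfolding rosen_def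
    by (intro tendsto_add tendsto_mult tendsto_inner tendsto_divide tendsto_power mv tendsto_Y xx yy
        tendsto_vec_nth at_right_ident tendsto_const) simp
  then have "((\<lambda>\<Omega>. rosen (g (zz \<Omega>)) (xx \<Omega>) (yy \<Omega>) +
    \<Omega> * (yy \<Omega> $ V * (Y (xx \<Omega>) \<bullet> (g (zz \<Omega>) *v ?e)) + xx \<Omega> $ V * (Y (yy \<Omega>) \<bullet> (g (zz \<Omega>) *v ?e)))
    + \<Omega>\<^sup>2 * (xx \<Omega> $ V * yy \<Omega> $ V * (?e \<bullet> (g (zz \<Omega>) *v ?e)))) \<longlongrightarrow> rosen (g a) x y) (at_right 0)"
    by simp
  then show ?thesis
  proof (rule Lim_transform_eventually)
    show "\<forall>\<^sub>F \<Omega> in at_right 0. rosen (g (zz \<Omega>)) (xx \<Omega>) (yy \<Omega>) +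
      \<Omega> * (yy \<Omega> $ V * (Y (xx \<Omega>) \<bullet> (g (zz \<Omega>) *v ?e)) + xx \<Omega> $ V * (Y (yy \<Omega>) \<bullet> (g (zz \<Omega>) *v ?e)))
      + \<Omega>\<^sup>2 * (xx \<Omega> $ V * yy \<Omega> $ V * (?e \<bullet> (g (zz \<Omega>) *v ?e))) =
      dil \<Omega> (xx \<Omega>) \<bullet> (g (zz \<Omega>) *v dil \<Omega> (yy \<Omega>)) / \<Omega>\<^sup>2"
      using ad at_right_pos
    proof eventually_elim
      case (elim \<Omega>)
      then show ?case using adapted_metric_dil_inner[OF elim(1), of \<Omega>] by simp
    qed
  qed
qed

end

text \<open>The local situation shared by the flow of \<open>M\<close> seen in two adapted charts
  and, at time zero, by a change of adapted charts. \<open>K\<close> collects the parameters of the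
  axis points considered, and \<sigma> is the induced map of parameters.\<close>

locale axis_isometry = null_frame U V for U V :: "'m::finite" +
  fixes W W' :: "(real^'m) set" and g g' :: "real^'m \<Rightarrow> real^'m^'m"
    and \<kappa> :: "real^'m \<Rightarrow> real^'m" and K :: "real set" and \<sigma> :: "real \<Rightarrow> real"
  assumes iso: "iso_on W g g' \<kappa>" and W': "open W'" "\<kappa> ` W \<subseteq> W'"
    and cont_g: "continuous_on W g" and cont_g': "continuous_on W' g'"
    and adapted_g: "\<And>z. z \<in> W \<Longrightarrow> adapted_metric U V (g z)"
    and adapted_g': "\<And>z. z \<in> W' \<Longrightarrow> adapted_metric U V (g' z)"
    and K: "open K" and axW: "\<And>u. u \<in> K \<Longrightarrow> ax u \<in> W"
    and \<kappa>_ax: "\<And>u. u \<in> K \<Longrightarrow> \<kappa> (ax u) = ax (\<sigma> u)"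
begin

abbreviation kc :: "'m \<Rightarrow> real^'m \<Rightarrow> real" where "kc j \<equiv> \<lambda>q. \<kappa> q $ j"

lemma smooth_\<kappa>: "smooth_on W \<kappa>" by (rule iso_on_smooth[OF iso])

lemma open_W: "open W" by (rule smooth_on_open[OF smooth_\<kappa>])

lemma smooth_kc: "smooth_on W (kc j)" by (rule smooth_on_vec_nth[OF smooth_\<kappa>])

lemma pd_kc: "z \<in> W \<Longrightarrow> dd v (kc j) z = dd v \<kappa> z $ j"
  using frechet_derivative_vec_nth[OF smooth_on_differentiable[OF smooth_\<kappa>]] .

lemma axis_derivative:
  assumes f: "smooth_on W f" and u: "u \<in> K"
  shows "((\<lambda>u. f (ax u)) has_real_derivative pd U f (ax u)) (at u)"
proof -
  have "0 + u *\<^sub>R axis U 1 \<in> W" using axW[OF u] by (simp add: ax_scaleR[symmetric])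
  from smooth_on_line_derivative[OF f this] show ?thesis by (simp add: ax_scaleR[symmetric])
qed

lemma pd_U_zero:
  assumes f: "smooth_on W f" and 0: "\<And>u. u \<in> K \<Longrightarrow> f (ax u) = 0" and u: "u \<in> K"
  shows "pd U f (ax u) = 0"
proof -
  have "((\<lambda>u. 0) has_real_derivative pd U f (ax u)) (at u)"
    by (rule DERIV_cong_ev[THEN iffD1, OF refl _ refl axis_derivative[OF f u]])
      (use 0 eventually_nhds_in_open[OF K u] in \<open>auto elim: eventually_mono\<close>)
  then show ?thesis using DERIV_unique DERIV_const by blast
qed

lemma kc_axis: "u \<in> K \<Longrightarrow> kc U (ax u) = \<sigma> u" "u \<in> K \<Longrightarrow> j \<noteq> U \<Longrightarrow> kc j (ax u) = 0"
  using \<kappa>_ax by auto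

lemma pd_U_kc: "u \<in> K \<Longrightarrow> j \<noteq> U \<Longrightarrow> pd U (kc j) (ax u) = 0"
  by (rule pd_U_zero[OF smooth_kc]) (auto simp: kc_axis)

text \<open>Pairing with \<open>\<partial>_u\<close> is half the \<open>v\<close>-entry in both
  adapted metrics, and on the axis \<kappa> sends \<open>\<partial>_u\<close> to
  \<open>pd U (kc U)\<close> times \<open>\<partial>_u\<close>. The claim is the invariance of this
  pairing.\<close>

lemma pd_kc_V:
  assumes u: "u \<in> K"
  shows "pd U (kc U) (ax u) * dd y (kc V) (ax u) = y $ V"
proof -
  have aW: "ax u \<in> W" by (rule axW[OF u])
  have "dd (axis U 1) \<kappa> (ax u) = pd U (kc U) (ax u) *\<^sub>R axis U 1"
    using pd_U_kc[OF u] pd_kc[OF aW] by (auto simp: vec_eq_iff axis_def)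
  then have "pd U (kc U) (ax u) * (axis U 1 \<bullet> (g' (\<kappa> (ax u)) *v dd y \<kappa> (ax u))) = axis U 1 \<bullet> (g (ax u) *v y)"
    using iso_on_inner[OF iso aW, of "axis U 1" y] by simp
  moreover have "\<kappa> (ax u) \<in> W'" using aW W' by blast
  ultimately show ?thesis
    using adapted_metric_axis_U[OF adapted_g] adapted_metric_axis_U[OF adapted_g'] aW
      pd_kc[OF aW, where v = y and j = V] by simp
qed

text \<open>The case of \<open>\<partial>_v\<close> in \<open>pd_kc_V\<close> shows that the factor
  \<open>pd U (kc U)\<close> is nonzero, so the other derivatives of the \<open>v\<close>-entry
  vanish. This is what makes division by \<Omega>^2 possible.\<close>

lemma pd_i_kc_V: "u \<in> K \<Longrightarrow> i \<noteq> V \<Longrightarrow> pd i (kc V) (ax u) = 0"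
proof -
  assume u: "u \<in> K" and i: "i \<noteq> V"
  have "axis i 1 $ V = (0::real)" using i by (simp add: axis_def)
  then show ?thesis using pd_kc_V[OF u, of "axis i 1"] pd_kc_V[OF u, of "axis V 1"] by auto
qed

text \<open>The leading part of the Taylor expansion of \<kappa> along the axis, where
  \<open>u\<close>, \<open>y\<close> and \<open>v\<close> have weights 0, 1 and 2; the
  \<open>v\<close>-entry therefore contains half the transverse Hessian.\<close>

definition lim_map :: "real^'m \<Rightarrow> real^'m" where
  "lim_map q = (\<chi> j. if j = U then kc U (ax (q $ U)) else
     if j = V then q $ V * pd V (kc V) (ax (q $ U)) +
       (\<Sum>i\<in>UNIV. \<Sum>k\<in>UNIV. Y q $ i * Y q $ k * pd k (pd i (kc V)) (ax (q $ U))) / 2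
     else (\<Sum>i\<in>UNIV. Y q $ i * pd i (kc j) (ax (q $ U))))"

lemma lim_map_nth:
  "lim_map q $ U = kc U (ax (q $ U))"
  "lim_map q $ V = q $ V * pd V (kc V) (ax (q $ U)) +
       (\<Sum>i\<in>UNIV. \<Sum>k\<in>UNIV. Y q $ i * Y q $ k * pd k (pd i (kc V)) (ax (q $ U))) / 2"
  "j \<noteq> U \<Longrightarrow> j \<noteq> V \<Longrightarrow> lim_map q $ j = (\<Sum>i\<in>UNIV. Y q $ i * pd i (kc j) (ax (q $ U)))"
  using UV by (simp_all add: lim_map_def)

lemma lim_map_U: "q \<in> slab K \<Longrightarrow> lim_map q $ U = \<sigma> (q $ U)"
  by (simp add: lim_map_nth kc_axis)

lemma isCont_W: "smooth_on W f \<Longrightarrow> z \<in> W \<Longrightarrow> isCont f z"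
  using smooth_on_continuous_on open_W continuous_on_eq_continuous_at by blast

text \<open>The convergence is continuous, not merely pointwise: this is what makes the limits of
  composite maps compose.\<close>

lemma lim_map_limit:
  assumes q: "q \<in> slab K" and qq: "(qq \<longlongrightarrow> q) (at_right 0)"
  shows "((\<lambda>\<Omega>. dil (1 / \<Omega>) (\<kappa> (dil \<Omega> (qq \<Omega>)))) \<longlongrightarrow> lim_map q) (at_right 0)"
proof (rule vec_tendstoI)
  fix j
  have qK: "q $ U \<in> K" using q by simp
  consider "j = U" | "j = V" | "j \<noteq> U" "j \<noteq> V" by blast
  then show "((\<lambda>\<Omega>. dil (1 / \<Omega>) (\<kappa> (dil \<Omega> (qq \<Omega>))) $ j) \<longlongrightarrow> lim_map q $ j) (at_right 0)"
  proof cases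
    case 1
    then show ?thesis
      using dil_limit_0[OF isCont_W[OF smooth_kc axW[OF qK]] qq, of U] by (simp add: lim_map_nth)
  next
    case 2
    have "((\<lambda>\<Omega>. kc V (dil \<Omega> (qq \<Omega>)) / \<Omega>\<^sup>2) \<longlongrightarrow> lim_map q $ V) (at_right 0)"
      unfolding lim_map_nth
      by (rule dil_limit_2[OF smooth_kc K qK axW _ _ qq]) (use kc_axis pd_i_kc_V UV in auto)
    then show ?thesis using 2 by (simp add: power_one_over divide_inverse mult.commute power_inverse)
  next
    case 3
    have "((\<lambda>\<Omega>. kc j (dil \<Omega> (qq \<Omega>)) / \<Omega>) \<longlongrightarrow> lim_map q $ j) (at_right 0)"
      unfolding lim_map_nth(3)[OF 3]
      by (rule dil_limit_1[OF smooth_kc K qK axW _ qq]) (use kc_axis 3 in auto)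
    then show ?thesis using 3 by simp
  qed
qed

lemma bounded_linear_ax_U: "bounded_linear (\<lambda>q :: real^'m. ax (q $ U))"
  by (rule linear_linear[THEN iffD2, OF linearI]) (simp_all add: vec_eq_iff axis_def)

lemma smooth_axis:
  assumes "smooth_on W f"
  shows "smooth_on (slab K) (\<lambda>q. f (ax (q $ U)))"
  by (rule smooth_on_compose[OF smooth_on_linear[OF open_slab[OF K] bounded_linear_ax_U] assms])
    (use axW in auto)

lemma smooth_Y_nth: "smooth_on (slab K) (\<lambda>q. Y q $ i)"
  by (rule smooth_on_vec_nth[OF smooth_on_linear[OF open_slab[OF K] bounded_linear_Y]])

lemma smooth_lim_map: "smooth_on (slab K) lim_map"
proof -
  note S = open_slab[OF K]
  have V: "smooth_on (slab K) (\<lambda>q. q $ V * pd V (kc V) (ax (q $ U)) +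
       (\<Sum>i\<in>UNIV. \<Sum>k\<in>UNIV. Y q $ i * Y q $ k * pd k (pd i (kc V)) (ax (q $ U))) / 2)"
    by (intro smooth_on_add smooth_on_mult smooth_on_divide smooth_on_sum smooth_axis smooth_Y_nth smooth_on_dd
        smooth_kc S smooth_on_const smooth_on_linear bounded_linear_vec_nth) simp
  have y: "smooth_on (slab K) (\<lambda>q. \<Sum>i\<in>UNIV. Y q $ i * pd i (kc j) (ax (q $ U)))" for j
    by (intro smooth_on_mult smooth_on_sum smooth_axis smooth_Y_nth smooth_on_dd smooth_kc S)
  show ?thesis unfolding lim_map_def
  proof (rule smooth_on_vec_lambda[OF S])
    fix j
    show "smooth_on (slab K) (\<lambda>q. if j = U then kc U (ax (q $ U)) else
     if j = V then q $ V * pd V (kc V) (ax (q $ U)) +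
       (\<Sum>i\<in>UNIV. \<Sum>k\<in>UNIV. Y q $ i * Y q $ k * pd k (pd i (kc V)) (ax (q $ U))) / 2
     else (\<Sum>i\<in>UNIV. Y q $ i * pd i (kc j) (ax (q $ U))))"
      using V y smooth_axis[OF smooth_kc] by (cases "j = U"; cases "j = V") simp_all
  qed
qed

lemma axis_has_derivative:
  assumes f: "smooth_on W f" and q: "q \<in> slab K"
  shows "((\<lambda>q. f (ax (q $ U))) has_derivative (\<lambda>x. x $ U * pd U f (ax (q $ U)))) (at q)"
proof -
  have "((\<lambda>u. f (ax u)) has_derivative (\<lambda>t. t * pd U f (ax (q $ U)))) (at (q $ U))"
  proof -
    have "(\<lambda>t. t * pd U f (ax (q $ U))) = (*) (pd U f (ax (q $ U)))" by (simp add: fun_eq_iff)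
    then show ?thesis using axis_derivative[OF f, of "q $ U"] q unfolding has_field_derivative_def by simp
  qed
  from has_derivative_compose[OF has_derivative_nth this] show ?thesis .
qed

lemma Y_nth_has_derivative: "((\<lambda>q. Y q $ i) has_derivative (\<lambda>x. Y x $ i)) F"
  by (rule bounded_linear.has_derivative[OF bounded_linear_vec_nth
        bounded_linear_imp_has_derivative[OF bounded_linear_Y]])

lemma frechet_derivative_lim_map:
  assumes q: "q \<in> slab K"
  defines "D \<equiv> frechet_derivative lim_map (at q)" and "a \<equiv> ax (q $ U)"
  shows "D x $ U = x $ U * pd U (kc U) a"
    and "j \<noteq> U \<Longrightarrow> j \<noteq> V \<Longrightarrow> D x $ j =
      (\<Sum>i\<in>UNIV. Y q $ i * (x $ U * pd U (pd i (kc j)) a) + Y x $ i * pd i (kc j) a)"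
    and "D x $ V = q $ V * (x $ U * pd U (pd V (kc V)) a) + x $ V * pd V (kc V) a +
      (\<Sum>i\<in>UNIV. \<Sum>k\<in>UNIV. Y q $ i * Y q $ k * (x $ U * pd U (pd k (pd i (kc V))) a)
         + (Y q $ i * Y x $ k + Y x $ i * Y q $ k) * pd k (pd i (kc V)) a) / 2"
proof -
  have D: "D x $ j = f' x"
    if eq: "\<And>q. lim_map q $ j = f q" and f: "(f has_derivative f') (at q)" for f f' j
  proof -
    have "(\<lambda>q. lim_map q $ j) = f" using eq by auto
    then have "frechet_derivative (\<lambda>q. lim_map q $ j) (at q) x = f' x"
      using fun_cong[OF frechet_derivative_at[OF f], of x] by simp
    then show ?thesis
      using frechet_derivative_vec_nth[OF smooth_on_differentiable[OF smooth_lim_map q]] by (simp add: D_def)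
  qed
  note sm = smooth_kc smooth_on_dd
  show "D x $ U = x $ U * pd U (kc U) a"
    unfolding a_def by (rule D[OF lim_map_nth(1)]) (rule axis_has_derivative[OF smooth_kc q])
  show "D x $ j = (\<Sum>i\<in>UNIV. Y q $ i * (x $ U * pd U (pd i (kc j)) a) + Y x $ i * pd i (kc j) a)"
    if j: "j \<noteq> U" "j \<noteq> V"
    unfolding a_def
    by (rule D[OF lim_map_nth(3)[OF j]])
      (intro has_derivative_sum has_derivative_mult Y_nth_has_derivative axis_has_derivative[OF _ q] sm)
  show "D x $ V = q $ V * (x $ U * pd U (pd V (kc V)) a) + x $ V * pd V (kc V) a +
      (\<Sum>i\<in>UNIV. \<Sum>k\<in>UNIV. Y q $ i * Y q $ k * (x $ U * pd U (pd k (pd i (kc V))) a)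
         + (Y q $ i * Y x $ k + Y x $ i * Y q $ k) * pd k (pd i (kc V)) a) / 2"
    unfolding a_def
    by (rule D[OF lim_map_nth(2)])
      (intro has_derivative_add bounded_linear.has_derivative[OF bounded_linear_divide] has_derivative_sum has_derivative_mult has_derivative_nth
        Y_nth_has_derivative axis_has_derivative[OF _ q] sm)
qed

lemma dd_commute_second:
  assumes f: "smooth_on W f" and z: "z \<in> W"
  shows "pd U (pd k (pd i f)) z = pd k (pd i (pd U f)) z"
proof -
  have "pd U (pd k (pd i f)) z = pd k (pd U (pd i f)) z" by (rule dd_commute[OF smooth_on_dd[OF f] z])
  also have "\<dots> = pd k (pd i (pd U f)) z"
    using frechet_derivative_transform_open(2)[OF open_W z, of "pd U (pd i f)" "pd i (pd U f)"] dd_commute[OF f]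
    by simp
  finally show ?thesis .
qed

text \<open>Convergence of maps says nothing about their derivatives, so the weighted limits are
  applied anew to the partial derivatives of \<kappa>. Differentiation along the axis preserves
  vanishing there, and symmetry of mixed derivatives matches the outcome with the derivative of
  \<open>lim_map\<close>.\<close>

lemma jacobian_limit:
  assumes q: "q \<in> slab K"
  shows "((\<lambda>\<Omega>. dil (1 / \<Omega>) (frechet_derivative \<kappa> (at (dil \<Omega> q)) (dil \<Omega> x))) \<longlongrightarrow>
     frechet_derivative lim_map (at q) x) (at_right 0)"
proof (rule vec_tendstoI)
  fix j
  let ?D = "frechet_derivative lim_map (at q)"
  define a where "a = ax (q $ U)"
  have qK: "q $ U \<in> K" using q by simp
  have aW: "a \<in> W" using axW[OF qK] by (simp add: a_def)
  have cq: "((\<lambda>\<Omega>::real. q) \<longlongrightarrow> q) (at_right 0)" by simp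
  have evW: "\<forall>\<^sub>F \<Omega> in at_right 0. dil \<Omega> q \<in> W"
    using topological_tendstoD[OF tendsto_dil[OF cq] open_W] aW by (simp add: a_def)
  note sm = smooth_kc smooth_on_dd[OF smooth_kc]
  have lim0: "((\<lambda>\<Omega>. f (dil \<Omega> q)) \<longlongrightarrow> f a) (at_right 0)" if "smooth_on W f" for f
    using dil_limit_0[OF isCont_W[OF that] cq] aW by (simp add: a_def)
  \<comment> \<open>The parts of \<open>dil \<Omega> x\<close> have weights 0, 1 and 2; what is
    missing to the weight of the entry \<open>j\<close> must come from the vanishing of the partial
    derivative.\<close>
  have split: "dd (dil \<Omega> x) (kc j) z = x $ U * pd U (kc j) z + \<Omega> * (\<Sum>i\<in>UNIV. Y x $ i * pd i (kc j) z)
    + \<Omega>\<^sup>2 * (x $ V * pd V (kc j) z)" if z: "z \<in> W" for \<Omega> z j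
  proof -
    let ?L = "frechet_derivative (kc j) (at z)"
    have lin: "linear ?L" using linear_frechet_derivative[OF smooth_on_differentiable[OF smooth_kc z]] .
    have "dil \<Omega> x = x $ U *\<^sub>R axis U 1 + (\<Omega> *\<^sub>R Y x + (\<Omega>\<^sup>2 * x $ V) *\<^sub>R axis V 1)"
      by (simp add: dil_eq[of \<Omega>] ax_scaleR[symmetric])
    then have "?L (dil \<Omega> x) = x $ U * ?L (axis U 1) + (\<Omega> * ?L (Y x) + \<Omega>\<^sup>2 * x $ V * ?L (axis V 1))"
      by (simp add: linear_add[OF lin] linear_cmul[OF lin])
    then show ?thesis
      using frechet_derivative_axis_expansion[OF smooth_on_differentiable[OF smooth_kc z], of j "Y x"] by simp
  qed
  consider "j = U" | "j = V" | "j \<noteq> U" "j \<noteq> V" by blast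
  then show "((\<lambda>\<Omega>. dil (1 / \<Omega>) (frechet_derivative \<kappa> (at (dil \<Omega> q)) (dil \<Omega> x)) $ j) \<longlongrightarrow> ?D x $ j) (at_right 0)"
  proof cases
    case 1
    have "((\<lambda>\<Omega>. x $ U * pd U (kc j) (dil \<Omega> q) + \<Omega> * (\<Sum>i\<in>UNIV. Y x $ i * pd i (kc j) (dil \<Omega> q))
       + \<Omega>\<^sup>2 * (x $ V * pd V (kc j) (dil \<Omega> q))) \<longlongrightarrow>
       x $ U * pd U (kc j) a + 0 * (\<Sum>i\<in>UNIV. Y x $ i * pd i (kc j) a) + 0\<^sup>2 * (x $ V * pd V (kc j) a)) (at_right 0)"
      by (intro tendsto_add tendsto_mult tendsto_sum tendsto_power tendsto_const at_right_ident lim0 sm)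
    then have "((\<lambda>\<Omega>. x $ U * pd U (kc j) (dil \<Omega> q) + \<Omega> * (\<Sum>i\<in>UNIV. Y x $ i * pd i (kc j) (dil \<Omega> q))
       + \<Omega>\<^sup>2 * (x $ V * pd V (kc j) (dil \<Omega> q))) \<longlongrightarrow> ?D x $ j) (at_right 0)"
      using frechet_derivative_lim_map(1)[OF q, of x] 1 by (simp add: a_def)
    then show ?thesis
    proof (rule Lim_transform_eventually)
      show "\<forall>\<^sub>F \<Omega> in at_right 0. x $ U * pd U (kc j) (dil \<Omega> q) + \<Omega> * (\<Sum>i\<in>UNIV. Y x $ i * pd i (kc j) (dil \<Omega> q))
       + \<Omega>\<^sup>2 * (x $ V * pd V (kc j) (dil \<Omega> q)) = dil (1 / \<Omega>) (frechet_derivative \<kappa> (at (dil \<Omega> q)) (dil \<Omega> x)) $ j"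
        using evW by eventually_elim (simp add: pd_kc[symmetric] split 1)
    qed
  next
    case 2
    \<comment> \<open>\<open>pd U (kc V)\<close> has the same order of vanishing as
      \<open>kc V\<close>: it and its transverse derivatives are derivatives along the axis of
      functions that vanish there.\<close>
    have T2: "((\<lambda>\<Omega>. pd U (kc V) (dil \<Omega> q) / \<Omega>\<^sup>2) \<longlongrightarrow> q $ V * pd V (pd U (kc V)) (ax (q $ U)) +
      (\<Sum>i\<in>UNIV. \<Sum>k\<in>UNIV. Y q $ i * Y q $ k * pd k (pd i (pd U (kc V))) (ax (q $ U))) / 2) (at_right 0)"
    proof (rule dil_limit_2[OF smooth_on_dd[OF smooth_kc] K qK axW _ _ cq])
      show "pd U (kc V) (ax u) = 0" if "u \<in> K" for u using pd_U_kc[OF that] UV by simp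
      show "pd i (pd U (kc V)) (ax u) = 0" if u: "u \<in> K" and i: "i \<noteq> U" "i \<noteq> V" for u i
      proof -
        have "pd U (pd i (kc V)) (ax u) = 0"
          by (rule pd_U_zero[OF smooth_on_dd[OF smooth_kc] _ u]) (rule pd_i_kc_V[OF _ i(2)])
        then show ?thesis using dd_commute[OF smooth_kc axW[OF u], of V "axis i 1" "axis U 1"] by simp
      qed
    qed
    \<comment> \<open>For \<open>i = V\<close> the partial derivative does not vanish on the axis,
      but then the coefficient \<open>Y x $ i\<close> is zero.\<close>
    have T1: "((\<lambda>\<Omega>. Y x $ i * (pd i (kc V) (dil \<Omega> q) / \<Omega>)) \<longlongrightarrow>
      Y x $ i * (\<Sum>k\<in>UNIV. Y q $ k * pd k (pd i (kc V)) (ax (q $ U)))) (at_right 0)" for i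
    proof (cases "i = U \<or> i = V")
      case True
      then have "Y x $ i = 0" by auto
      then show ?thesis by simp
    next
      case False
      show ?thesis
        by (intro tendsto_mult tendsto_const dil_limit_1[OF smooth_on_dd[OF smooth_kc] K qK axW _ cq])
          (use pd_i_kc_V False in auto)
    qed
    have "((\<lambda>\<Omega>. x $ U * (pd U (kc V) (dil \<Omega> q) / \<Omega>\<^sup>2) + (\<Sum>i\<in>UNIV. Y x $ i * (pd i (kc V) (dil \<Omega> q) / \<Omega>))
       + x $ V * pd V (kc V) (dil \<Omega> q)) \<longlongrightarrow>
       x $ U * (q $ V * pd V (pd U (kc V)) (ax (q $ U)) +
        (\<Sum>i\<in>UNIV. \<Sum>k\<in>UNIV. Y q $ i * Y q $ k * pd k (pd i (pd U (kc V))) (ax (q $ U))) / 2)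
       + (\<Sum>i\<in>UNIV. Y x $ i * (\<Sum>k\<in>UNIV. Y q $ k * pd k (pd i (kc V)) (ax (q $ U))))
       + x $ V * pd V (kc V) a) (at_right 0)"
      by (intro tendsto_add tendsto_sum T1 tendsto_mult[OF tendsto_const] T2 lim0 sm)
    moreover have "x $ U * (q $ V * pd V (pd U (kc V)) (ax (q $ U)) +
        (\<Sum>i\<in>UNIV. \<Sum>k\<in>UNIV. Y q $ i * Y q $ k * pd k (pd i (pd U (kc V))) (ax (q $ U))) / 2)
       + (\<Sum>i\<in>UNIV. Y x $ i * (\<Sum>k\<in>UNIV. Y q $ k * pd k (pd i (kc V)) (ax (q $ U))))
       + x $ V * pd V (kc V) a = ?D x $ V"
    proof -
      let ?H = "\<lambda>i k. pd k (pd i (kc V)) a" and ?T = "\<lambda>i k. pd U (pd k (pd i (kc V))) a"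
      have sym: "?H i k = ?H k i" for i k by (rule dd_commute[OF smooth_kc aW])
      \<comment> \<open>The product rule gives the Hessian term in both orders; its symmetry merges
        them and cancels the factor one half.\<close>
      have "(\<Sum>i\<in>UNIV. \<Sum>k\<in>UNIV. Y q $ i * Y x $ k * ?H i k) = (\<Sum>i\<in>UNIV. \<Sum>k\<in>UNIV. Y x $ i * Y q $ k * ?H i k)"
        by (subst sum.swap) (intro sum.cong refl, simp add: sym mult.commute)
      then have "(\<Sum>i\<in>UNIV. \<Sum>k\<in>UNIV. Y q $ i * Y q $ k * (x $ U * ?T i k) + (Y q $ i * Y x $ k + Y x $ i * Y q $ k) * ?H i k)
        = x $ U * (\<Sum>i\<in>UNIV. \<Sum>k\<in>UNIV. Y q $ i * Y q $ k * ?T i k) + 2 * (\<Sum>i\<in>UNIV. Y x $ i * (\<Sum>k\<in>UNIV. Y q $ k * ?H i k))"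
        by (simp add: distrib_right distrib_left sum.distrib sum_distrib_left mult.assoc mult.left_commute[of "x $ U"])
      moreover have "pd V (pd U (kc V)) a = pd U (pd V (kc V)) a" by (rule dd_commute[OF smooth_kc aW])
      moreover have "pd k (pd i (pd U (kc V))) a = ?T i k" for i k
        using dd_commute_second[OF smooth_kc aW] by simp
      ultimately show ?thesis
        unfolding frechet_derivative_lim_map(3)[OF q] a_def[symmetric] by (simp add: field_simps)
    qed
    ultimately have "((\<lambda>\<Omega>. x $ U * (pd U (kc V) (dil \<Omega> q) / \<Omega>\<^sup>2) + (\<Sum>i\<in>UNIV. Y x $ i * (pd i (kc V) (dil \<Omega> q) / \<Omega>))
       + x $ V * pd V (kc V) (dil \<Omega> q)) \<longlongrightarrow> ?D x $ j) (at_right 0)"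
      using 2 by simp
    then show ?thesis
    proof (rule Lim_transform_eventually)
      show "\<forall>\<^sub>F \<Omega> in at_right 0. x $ U * (pd U (kc V) (dil \<Omega> q) / \<Omega>\<^sup>2) +
         (\<Sum>i\<in>UNIV. Y x $ i * (pd i (kc V) (dil \<Omega> q) / \<Omega>)) + x $ V * pd V (kc V) (dil \<Omega> q)
         = dil (1 / \<Omega>) (frechet_derivative \<kappa> (at (dil \<Omega> q)) (dil \<Omega> x)) $ j"
        using evW at_right_pos
      proof eventually_elim
        case (elim \<Omega>)
        have "(\<Sum>i\<in>UNIV. Y x $ i * (pd i (kc V) (dil \<Omega> q) / \<Omega>)) = (\<Sum>i\<in>UNIV. Y x $ i * pd i (kc V) (dil \<Omega> q)) / \<Omega>"
          by (simp add: sum_divide_distrib)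
        moreover have "dil (1 / \<Omega>) (dd (dil \<Omega> x) \<kappa> (dil \<Omega> q)) $ V = dd (dil \<Omega> x) (kc V) (dil \<Omega> q) / \<Omega>\<^sup>2"
          using pd_kc[OF elim(1)] by (simp add: power_one_over)
        ultimately show ?case
          unfolding 2 using elim(2) by (simp add: split[OF elim(1)] add_divide_distrib power2_eq_square)
      qed
    qed
  next
    case 3
    have T1: "((\<lambda>\<Omega>. pd U (kc j) (dil \<Omega> q) / \<Omega>) \<longlongrightarrow> (\<Sum>i\<in>UNIV. Y q $ i * pd i (pd U (kc j)) (ax (q $ U)))) (at_right 0)"
      by (rule dil_limit_1[OF smooth_on_dd[OF smooth_kc] K qK axW _ cq]) (use pd_U_kc 3 in auto)
    have "((\<lambda>\<Omega>. x $ U * (pd U (kc j) (dil \<Omega> q) / \<Omega>) + (\<Sum>i\<in>UNIV. Y x $ i * pd i (kc j) (dil \<Omega> q))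
       + \<Omega> * (x $ V * pd V (kc j) (dil \<Omega> q))) \<longlongrightarrow>
       x $ U * (\<Sum>i\<in>UNIV. Y q $ i * pd i (pd U (kc j)) (ax (q $ U))) + (\<Sum>i\<in>UNIV. Y x $ i * pd i (kc j) a)
       + 0 * (x $ V * pd V (kc j) a)) (at_right 0)"
      by (intro tendsto_add tendsto_sum tendsto_mult tendsto_const at_right_ident T1 lim0 sm)
    moreover have "x $ U * (\<Sum>i\<in>UNIV. Y q $ i * pd i (pd U (kc j)) (ax (q $ U))) + (\<Sum>i\<in>UNIV. Y x $ i * pd i (kc j) a)
       + 0 * (x $ V * pd V (kc j) a) = ?D x $ j"
    proof -
      have "pd i (pd U (kc j)) a = pd U (pd i (kc j)) a" for i by (rule dd_commute[OF smooth_kc aW])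
      then show ?thesis
        unfolding frechet_derivative_lim_map(2)[OF q 3] a_def[symmetric]
        by (simp add: sum.distrib sum_distrib_left mult.left_commute[of "x $ U"])
    qed
    ultimately have "((\<lambda>\<Omega>. x $ U * (pd U (kc j) (dil \<Omega> q) / \<Omega>) + (\<Sum>i\<in>UNIV. Y x $ i * pd i (kc j) (dil \<Omega> q))
       + \<Omega> * (x $ V * pd V (kc j) (dil \<Omega> q))) \<longlongrightarrow> ?D x $ j) (at_right 0)" by simp
    then show ?thesis
    proof (rule Lim_transform_eventually)
      show "\<forall>\<^sub>F \<Omega> in at_right 0. x $ U * (pd U (kc j) (dil \<Omega> q) / \<Omega>) + (\<Sum>i\<in>UNIV. Y x $ i * pd i (kc j) (dil \<Omega> q))
         + \<Omega> * (x $ V * pd V (kc j) (dil \<Omega> q)) = dil (1 / \<Omega>) (frechet_derivative \<kappa> (at (dil \<Omega> q)) (dil \<Omega> x)) $ j"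
        using evW at_right_pos
      proof eventually_elim
        case (elim \<Omega>)
        have "dil (1 / \<Omega>) (dd (dil \<Omega> x) \<kappa> (dil \<Omega> q)) $ j = dd (dil \<Omega> x) (kc j) (dil \<Omega> q) / \<Omega>"
          using pd_kc[OF elim(1)] 3 by simp
        then show ?case
          using elim(2) by (simp add: split[OF elim(1)] add_divide_distrib power2_eq_square)
      qed
    qed
  qed
qed

text \<open>The isometry identity of \<kappa>, evaluated on dilated vectors and divided by
  \<Omega>^2, holds for all small \<Omega>, and both sides converge to Rosen forms.\<close>

lemma lim_map_rosen:
  assumes q: "q \<in> slab K"
  shows "rosen (g' (ax (\<sigma> (q $ U)))) (frechet_derivative lim_map (at q) x) (frechet_derivative lim_map (at q) y)
    = rosen (g (ax (q $ U))) x y"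
proof -
  let ?D = "frechet_derivative lim_map (at q)" and ?a = "ax (q $ U)"
  let ?J = "\<lambda>x \<Omega>. dil (1 / \<Omega>) (frechet_derivative \<kappa> (at (dil \<Omega> q)) (dil \<Omega> x))"
  have qK: "q $ U \<in> K" using q by simp
  have aW: "?a \<in> W" by (rule axW[OF qK])
  have cq: "((\<lambda>\<Omega>::real. q) \<longlongrightarrow> q) (at_right 0)" by simp
  have evW: "\<forall>\<^sub>F \<Omega> in at_right 0. dil \<Omega> q \<in> W"
    by (rule topological_tendstoD[OF tendsto_dil[OF cq] open_W aW])
  have \<kappa>z: "((\<lambda>\<Omega>. \<kappa> (dil \<Omega> q)) \<longlongrightarrow> ax (\<sigma> (q $ U))) (at_right 0)"
    using dil_limit_0[OF isCont_W[OF smooth_\<kappa> aW] cq] \<kappa>_ax[OF qK] by simp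
  have "isCont g' (ax (\<sigma> (q $ U)))"
    using cont_g' W' aW \<kappa>_ax[OF qK] continuous_on_eq_continuous_at by (metis image_subset_iff)
  then have 1: "((\<lambda>\<Omega>. dil \<Omega> (?J x \<Omega>) \<bullet> (g' (\<kappa> (dil \<Omega> q)) *v dil \<Omega> (?J y \<Omega>)) / \<Omega>\<^sup>2) \<longlongrightarrow>
      rosen (g' (ax (\<sigma> (q $ U)))) (?D x) (?D y)) (at_right 0)"
  proof (rule dil_limit_metric[OF _ \<kappa>z _ jacobian_limit[OF q] jacobian_limit[OF q]])
    show "\<forall>\<^sub>F \<Omega> in at_right 0. adapted_metric U V (g' (\<kappa> (dil \<Omega> q)))"
      using evW by eventually_elim (use adapted_g' W' in blast)
  qed
  have "isCont g ?a" using cont_g open_W aW continuous_on_eq_continuous_at by blast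
  then have 2: "((\<lambda>\<Omega>. dil \<Omega> x \<bullet> (g (dil \<Omega> q) *v dil \<Omega> y) / \<Omega>\<^sup>2) \<longlongrightarrow> rosen (g ?a) x y) (at_right 0)"
  proof (rule dil_limit_metric[OF _ tendsto_dil[OF cq] _ tendsto_const tendsto_const])
    show "\<forall>\<^sub>F \<Omega> in at_right 0. adapted_metric U V (g (dil \<Omega> q))"
      using evW by eventually_elim (use adapted_g in blast)
  qed
  have "\<forall>\<^sub>F \<Omega> in at_right 0. dil \<Omega> x \<bullet> (g (dil \<Omega> q) *v dil \<Omega> y) / \<Omega>\<^sup>2 =
      dil \<Omega> (?J x \<Omega>) \<bullet> (g' (\<kappa> (dil \<Omega> q)) *v dil \<Omega> (?J y \<Omega>)) / \<Omega>\<^sup>2"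
    using evW at_right_pos
  proof eventually_elim
    case (elim \<Omega>)
    then show ?case using iso_on_inner[OF iso elim(1)] by simp
  qed
  from Lim_transform_eventually[OF 2 this]
  show ?thesis using tendsto_unique[OF _ 1] by (simp add: trivial_limit_at_right_real)
qed

end

subsection \<open>The induced isometries of the Penrose limit\<close>

context axis_isometry
begin

text \<open>The action of the limit on the transverse part over \<open>u\<close>. For a change of
  charts this is the map \<open>T\<close> of \<open>rosen_atlas\<close>.\<close>

definition lim_linear :: "real \<Rightarrow> real^'m \<Rightarrow> real^'m" where
  "lim_linear u w = (\<chi> j. if j = U \<or> j = V then 0 else \<Sum>i\<in>UNIV. w $ i * pd i (kc j) (ax u))"

lemma linear_lim_linear: "linear (lim_linear u)"
  by (rule linearI)
    (simp_all add: vec_eq_iff lim_linear_def distrib_right sum.distrib sum_distrib_left mult.assoc)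

lemma Y_lim_map: "Y (lim_map q) = lim_linear (q $ U) (Y q)"
proof -
  have "Y (lim_map q) $ j = lim_linear (q $ U) (Y q) $ j" for j
    using lim_map_nth(3)[of j q] by (cases "j = U \<or> j = V") (auto simp: lim_linear_def)
  then show ?thesis by (simp add: vec_eq_iff)
qed

end

locale homogeneous_penrose = null_frame U V for U V :: "'m::finite" +
  fixes M :: "('a, 'm) metric_mfd" and N :: "('b, 'm) metric_mfd"
    and \<gamma> :: "real \<Rightarrow> 'a" and I :: "real set" and \<Phi> :: "real \<Rightarrow> 'a \<Rightarrow> 'a" and \<tau> :: "real \<Rightarrow> real"
    and P :: "(real set \<times> ('a, 'm) chart \<times> ('b, 'm) chart) set"
  assumes M: "lorentzian_manifold M" and N: "lorentzian_manifold N"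
    and \<Phi>: "one_parameter_isometries M \<Phi>"
    and \<tau>: "smooth_on UNIV \<tau>" "\<And>s. deriv \<tau> s \<noteq> 0" "range \<tau> = I"
    and \<gamma>: "\<And>s. \<gamma> (\<tau> s) = \<Phi> s (\<gamma> (\<tau> 0))"
    and P_I: "(\<Union>(J, c, d)\<in>P. J) = I"
    and P_N: "(\<Union>(J, c, d)\<in>P. fst d) = topspace (top_of N)"
    and P_chart: "\<And>J c d. (J, c, d) \<in> P \<Longrightarrow> adapted_chart U V M \<gamma> J c \<and> d \<in> charts N \<and> snd d ` fst d = slab J"
    and P_limit: "\<And>J c d q. (J, c, d) \<in> P \<Longrightarrow> q $ U \<in> J \<Longrightarrow>
      ((\<lambda>\<Omega>. (1 / \<Omega>\<^sup>2) *\<^sub>R pullback_form (dil \<Omega>) (local_metric M c) q) \<longlongrightarrow> local_metric N d q) (at_right 0)"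
    and P_glue: "\<And>J c d J' c' d'. (J, c, d) \<in> P \<Longrightarrow> (J', c', d') \<in> P \<Longrightarrow>
      fst d \<inter> fst d' = {p \<in> fst d. snd d p $ U \<in> J'}"
    and P_trans: "\<And>J c d J' c' d' q. (J, c, d) \<in> P \<Longrightarrow> (J', c', d') \<in> P \<Longrightarrow> q $ U \<in> J \<inter> J' \<Longrightarrow>
      ((\<lambda>\<Omega>. dil (1 / \<Omega>) (snd c' (chart_inv c (dil \<Omega> q)))) \<longlongrightarrow> snd d' (chart_inv d q)) (at_right 0)"
begin

lemma \<Phi>_isometry: "isometry M M (\<Phi> s)"
  and \<Phi>_add: "p \<in> topspace (top_of M) \<Longrightarrow> \<Phi> (s + t) p = \<Phi> s (\<Phi> t p)"
  using \<Phi> unfolding one_parameter_isometries_def by blast+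

lemma \<Phi>_topspace: "p \<in> topspace (top_of M) \<Longrightarrow> \<Phi> s p \<in> topspace (top_of M)"
  using \<Phi>_isometry[of s] unfolding isometry_def bij_betw_def by blast

text \<open>The group law makes \<open>\<Phi> 0\<close> idempotent, and an injective idempotent map
  is the identity.\<close>

lemma \<Phi>_0: "p \<in> topspace (top_of M) \<Longrightarrow> \<Phi> 0 p = p"
proof -
  assume p: "p \<in> topspace (top_of M)"
  have "inj_on (\<Phi> 0) (topspace (top_of M))"
    using \<Phi>_isometry[of 0] unfolding isometry_def bij_betw_def by blast
  moreover have "\<Phi> 0 (\<Phi> 0 p) = \<Phi> 0 p" using \<Phi>_add[OF p, of 0 0] by simp
  ultimately show ?thesis using p \<Phi>_topspace[OF p] by (simp add: inj_on_eq_iff)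
qed

lemma P_J:
  assumes "(J, c, d) \<in> P"
  shows "open J" "connected J" "J \<subseteq> I"
  using P_chart[OF assms] is_interval_connected[of J] unfolding adapted_chart_def P_I[symmetric]
  using assms by blast+

lemma P_c:
  assumes "(J, c, d) \<in> P"
  shows "c \<in> charts M" "\<And>u. u \<in> J \<Longrightarrow> \<gamma> u \<in> fst c \<and> snd c (\<gamma> u) = ax u"
    "\<And>p. p \<in> fst c \<Longrightarrow> adapted_metric U V (metric M c p)"
  using P_chart[OF assms] unfolding adapted_chart_def by blast+

lemma P_at:
  assumes "u \<in> I" obtains J c d where "(J, c, d) \<in> P" "u \<in> J"
  using assms P_I by blast

text \<open>The mean value theorem suffices, whatever the sign of the derivative.\<close>

lemma inj_\<tau>: "inj \<tau>"
proof (rule linorder_injI)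
  fix s t :: real assume "s < t"
  have "DERIV \<tau> x :> deriv \<tau> x" for x
    using smooth_on_differentiable[OF \<tau>(1)] by (simp add: DERIV_deriv_iff_real_differentiable)
  then obtain z where "\<tau> t - \<tau> s = (t - s) * deriv \<tau> z" using MVT2[OF \<open>s < t\<close>] by blast
  then show "\<tau> s \<noteq> \<tau> t" using \<tau>(2)[of z] \<open>s < t\<close> by auto
qed

text \<open>Time \<open>s\<close> of the flow read in the parameter of \<gamma>: a translation of
  the orbit parameter conjugated with \<tau>.\<close>

definition \<sigma> :: "real \<Rightarrow> real \<Rightarrow> real" where "\<sigma> s u = \<tau> (s + inv \<tau> u)"

lemma \<tau>_inv: "u \<in> I \<Longrightarrow> \<tau> (inv \<tau> u) = u"
  using \<tau>(3) by (simp add: f_inv_into_f)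

lemma \<sigma>_in [simp]: "\<sigma> s u \<in> I"
  using \<tau>(3) by (auto simp: \<sigma>_def)

lemma \<sigma>_add: "\<sigma> s (\<sigma> t u) = \<sigma> (s + t) u"
  by (simp add: \<sigma>_def inv_f_f[OF inj_\<tau>] add.assoc)

lemma \<sigma>_0: "u \<in> I \<Longrightarrow> \<sigma> 0 u = u"
  by (simp add: \<sigma>_def \<tau>_inv)

lemma \<sigma>_transitive: "u \<in> I \<Longrightarrow> \<exists>s. \<sigma> s t = u"
  using \<tau>_inv by (intro exI[of _ "inv \<tau> u - inv \<tau> t"]) (simp add: \<sigma>_def)

lemma continuous_\<tau>: "continuous_on UNIV \<tau>"
  by (rule smooth_on_continuous_on[OF \<tau>(1)])

lemma connected_I: "connected I"
  using connected_continuous_image[OF continuous_\<tau>] \<tau>(3) by simp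

text \<open>An injective continuous map of the line is a homeomorphism onto its image, so the
  inverse of \<tau> is continuous on \<open>I\<close>.\<close>

lemma continuous_\<sigma>: "continuous_on I (\<sigma> s)"
proof -
  obtain g where g: "homeomorphism UNIV I \<tau> g"
    using homeomorphism_into_1d[OF _ continuous_\<tau> \<tau>(3) inj_\<tau>] by auto
  have "inv \<tau> u = g u" if "u \<in> I" for u
    using g inv_f_f[OF inj_\<tau>, of "g u"] that by (simp add: homeomorphism_def)
  then have "continuous_on I (inv \<tau>)"
    using g continuous_on_cong[of I I "inv \<tau>" g] by (simp add: homeomorphism_def)
  then show ?thesis unfolding \<sigma>_def
    by (intro continuous_on_compose2[OF continuous_\<tau>] continuous_intros) auto
qed

lemma \<Phi>_\<gamma>:
  assumes u: "u \<in> I"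
  shows "\<Phi> s (\<gamma> u) = \<gamma> (\<sigma> s u)"
proof -
  have "\<tau> 0 \<in> I" using \<tau>(3) by blast
  then obtain J c d where "(J, c, d) \<in> P" "\<tau> 0 \<in> J" using P_at by blast
  then have "\<gamma> (\<tau> 0) \<in> topspace (top_of M)"
    using P_c chart_topspace(1)[OF M] by blast
  then have "\<Phi> s (\<Phi> (inv \<tau> u) (\<gamma> (\<tau> 0))) = \<Phi> (s + inv \<tau> u) (\<gamma> (\<tau> 0))"
    using \<Phi>_add by simp
  then show ?thesis using \<gamma>[of "inv \<tau> u"] \<gamma>[of "s + inv \<tau> u"] \<tau>_inv[OF u] by (simp add: \<sigma>_def)
qed

definition flow_rep :: "real \<Rightarrow> ('a, 'm) chart \<Rightarrow> ('a, 'm) chart \<Rightarrow> real^'m \<Rightarrow> real^'m" where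
  "flow_rep s c c' z = snd c' (\<Phi> s (chart_inv c z))"

definition flow_dom :: "real \<Rightarrow> ('a, 'm) chart \<Rightarrow> ('a, 'm) chart \<Rightarrow> (real^'m) set" where
  "flow_dom s c c' = snd c ` {p \<in> fst c. \<Phi> s p \<in> fst c'}"

text \<open>\<open>lim_map\<close> depends on the map alone, so no domain has to be supplied. The
  value is meaningful over parameters of the first patch that \<open>\<sigma> s\<close> carries into
  the second.\<close>

definition lim_rep :: "real \<Rightarrow> ('a, 'm) chart \<Rightarrow> ('a, 'm) chart \<Rightarrow> real^'m \<Rightarrow> real^'m" where
  "lim_rep s c c' = axis_isometry.lim_map U V (flow_rep s c c')"

lemma local_metric_adapted:
  assumes "(J, c, d) \<in> P" "z \<in> snd c ` fst c"
  shows "adapted_metric U V (local_metric M c z)"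
  using P_c(3)[OF assms(1) chart_inv_right(1)[OF assms(2)]] by (simp add: local_metric_def)

lemma local_metric_continuous:
  assumes "(J, c, d) \<in> P"
  shows "continuous_on (snd c ` fst c) (local_metric M c)"
proof -
  have "smooth_on (snd c ` fst c) (local_metric M c)"
    using M P_c(1)[OF assms] unfolding lorentzian_manifold_def by blast
  then show ?thesis by (rule smooth_on_continuous_on)
qed

lemma axis_isometry_flow_rep:
  assumes X: "(J, c, d) \<in> P" and X': "(J', c', d') \<in> P"
  shows "axis_isometry U V (flow_dom s c c') (snd c' ` fst c') (local_metric M c) (local_metric M c')
    (flow_rep s c c') {u \<in> J. \<sigma> s u \<in> J'} (\<sigma> s)"
proof unfold_locales
  have W: "flow_dom s c c' \<subseteq> snd c ` fst c" by (auto simp: flow_dom_def)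
  show "iso_on (flow_dom s c c') (local_metric M c) (local_metric M c') (flow_rep s c c')"
    using isometry_iso_on[OF M \<Phi>_isometry P_c(1)[OF X] P_c(1)[OF X']]
    by (simp add: flow_dom_def flow_rep_def[abs_def])
  show "open (snd c' ` fst c')" by (rule chart_homeo(2)[OF M P_c(1)[OF X']])
  show "flow_rep s c c' ` flow_dom s c c' \<subseteq> snd c' ` fst c'"
    using chart_inv_left[OF M P_c(1)[OF X]] by (auto simp: flow_dom_def flow_rep_def)
  show "continuous_on (flow_dom s c c') (local_metric M c)"
    using local_metric_continuous[OF X] W continuous_on_subset by blast
  show "continuous_on (snd c' ` fst c') (local_metric M c')"
    by (rule local_metric_continuous[OF X'])
  show "adapted_metric U V (local_metric M c z)" if "z \<in> flow_dom s c c'" for z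
    using local_metric_adapted[OF X] W that by blast
  show "adapted_metric U V (local_metric M c' z)" if "z \<in> snd c' ` fst c'" for z
    by (rule local_metric_adapted[OF X' that])
  have "continuous_on J (\<sigma> s)" using continuous_\<sigma> P_J(3)[OF X] continuous_on_subset by blast
  then have "open (J \<inter> \<sigma> s -` J')" using P_J(1)[OF X] P_J(1)[OF X'] by (simp add: continuous_open_preimage)
  then show "open {u \<in> J. \<sigma> s u \<in> J'}" by (simp add: Int_def vimage_def)
  fix u assume u: "u \<in> {u \<in> J. \<sigma> s u \<in> J'}"
  have 1: "\<gamma> u \<in> fst c" "snd c (\<gamma> u) = ax u" using P_c(2)[OF X] u by auto
  have 2: "\<Phi> s (\<gamma> u) = \<gamma> (\<sigma> s u)" using \<Phi>_\<gamma> P_J(3)[OF X] u by blast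
  have 3: "\<gamma> (\<sigma> s u) \<in> fst c'" "snd c' (\<gamma> (\<sigma> s u)) = ax (\<sigma> s u)" using P_c(2)[OF X'] u by auto
  show "ax u \<in> flow_dom s c c'" unfolding flow_dom_def using 1 2 3 by (intro image_eqI[of _ _ "\<gamma> u"]) auto
  show "flow_rep s c c' (ax u) = ax (\<sigma> s u)"
    using chart_inv_left[OF M P_c(1)[OF X] 1(1)] 1 2 3 by (simp add: flow_rep_def)
qed

lemma lim_rep_limit:
  assumes "(J, c, d) \<in> P" "(J', c', d') \<in> P" "q $ U \<in> J" "\<sigma> s (q $ U) \<in> J'" "(qq \<longlongrightarrow> q) (at_right 0)"
  shows "((\<lambda>\<Omega>. dil (1 / \<Omega>) (flow_rep s c c' (dil \<Omega> (qq \<Omega>)))) \<longlongrightarrow> lim_rep s c c' q) (at_right 0)"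
  unfolding lim_rep_def
  by (rule axis_isometry.lim_map_limit[OF axis_isometry_flow_rep[OF assms(1,2)]]) (use assms in auto)

lemma lim_rep_U:
  assumes "(J, c, d) \<in> P" "(J', c', d') \<in> P" "q $ U \<in> J" "\<sigma> s (q $ U) \<in> J'"
  shows "lim_rep s c c' q $ U = \<sigma> s (q $ U)"
  unfolding lim_rep_def
  by (rule axis_isometry.lim_map_U[OF axis_isometry_flow_rep[OF assms(1,2)]]) (use assms in auto)

lemma eventually_flow_dom:
  assumes "(J, c, d) \<in> P" "(J', c', d') \<in> P" "q $ U \<in> J" "\<sigma> s (q $ U) \<in> J'"
  shows "\<forall>\<^sub>F \<Omega> in at_right 0. dil \<Omega> q \<in> flow_dom s c c'"
proof -
  interpret axis_isometry U V "flow_dom s c c'" "snd c' ` fst c'" "local_metric M c" "local_metric M c'"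
    "flow_rep s c c'" "{u \<in> J. \<sigma> s u \<in> J'}" "\<sigma> s"
    by (rule axis_isometry_flow_rep[OF assms(1,2)])
  show ?thesis
    by (rule topological_tendstoD[OF tendsto_dil[OF tendsto_const] open_W axW]) (use assms in auto)
qed

text \<open>The rescaled images under time \<open>s\<close> are a moving family of points converging
  to \<open>lim_rep s c c' q\<close>; continuous convergence allows the second limit to be taken
  along this family.\<close>

lemma lim_rep_compose:
  assumes X: "(J, c, d) \<in> P" and X': "(J', c', d') \<in> P" and X'': "(J'', c'', d'') \<in> P"
    and q: "q $ U \<in> J" "\<sigma> s (q $ U) \<in> J'" "\<sigma> (t + s) (q $ U) \<in> J''"
  shows "lim_rep t c' c'' (lim_rep s c c' q) = lim_rep (t + s) c c'' q"
proof -
  define qq where "qq \<Omega> = dil (1 / \<Omega>) (flow_rep s c c' (dil \<Omega> q))" for \<Omega>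
  have "(qq \<longlongrightarrow> lim_rep s c c' q) (at_right 0)"
    unfolding qq_def by (rule lim_rep_limit[OF X X' q(1,2) tendsto_const])
  then have 1: "((\<lambda>\<Omega>. dil (1 / \<Omega>) (flow_rep t c' c'' (dil \<Omega> (qq \<Omega>)))) \<longlongrightarrow> lim_rep t c' c'' (lim_rep s c c' q)) (at_right 0)"
    by (rule lim_rep_limit[OF X' X'', rotated 2]) (use lim_rep_U[OF X X' q(1,2)] q \<sigma>_add in auto)
  have 2: "((\<lambda>\<Omega>. dil (1 / \<Omega>) (flow_rep (t + s) c c'' (dil \<Omega> q))) \<longlongrightarrow> lim_rep (t + s) c c'' q) (at_right 0)"
    by (rule lim_rep_limit[OF X X'' q(1,3) tendsto_const])
  have "\<forall>\<^sub>F \<Omega> in at_right 0. dil (1 / \<Omega>) (flow_rep t c' c'' (dil \<Omega> (qq \<Omega>))) = dil (1 / \<Omega>) (flow_rep (t + s) c c'' (dil \<Omega> q))"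
    using eventually_flow_dom[OF X X' q(1,2)] at_right_pos
  proof eventually_elim
    case (elim \<Omega>)
    then obtain p where p: "p \<in> fst c" "\<Phi> s p \<in> fst c'" "dil \<Omega> q = snd c p" by (auto simp: flow_dom_def)
    have "p \<in> topspace (top_of M)" using chart_topspace(1)[OF M P_c(1)[OF X]] p(1) by blast
    then have "flow_rep t c' c'' (flow_rep s c c' (dil \<Omega> q)) = flow_rep (t + s) c c'' (dil \<Omega> q)"
      using p chart_inv_left[OF M P_c(1)[OF X] p(1)] chart_inv_left[OF M P_c(1)[OF X'] p(2)] \<Phi>_add[of p t s]
      by (simp add: flow_rep_def)
    then show ?case using elim(2) by (simp add: qq_def)
  qed
  from Lim_transform_eventually[OF 1 this]
  show ?thesis using tendsto_unique[OF _ _ 2] by (simp add: trivial_limit_at_right_real)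
qed

text \<open>At time zero the flow in charts is the change of charts of \<open>M\<close>, whose
  rescaled limit is the gluing map of \<open>N\<close>.\<close>

lemma lim_rep_0:
  assumes X: "(J, c, d) \<in> P" and X': "(J', c', d') \<in> P" and q: "q $ U \<in> J" "q $ U \<in> J'"
  shows "snd d' (chart_inv d q) = lim_rep 0 c c' q"
proof -
  have s: "\<sigma> 0 (q $ U) \<in> J'" using \<sigma>_0 P_J(3)[OF X] q by (metis subsetD)
  have 1: "((\<lambda>\<Omega>. dil (1 / \<Omega>) (flow_rep 0 c c' (dil \<Omega> q))) \<longlongrightarrow> lim_rep 0 c c' q) (at_right 0)"
    by (rule lim_rep_limit[OF X X' q(1) s tendsto_const])
  have "\<forall>\<^sub>F \<Omega> in at_right 0. dil (1 / \<Omega>) (flow_rep 0 c c' (dil \<Omega> q)) = dil (1 / \<Omega>) (snd c' (chart_inv c (dil \<Omega> q)))"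
    using eventually_flow_dom[OF X X' q(1) s]
  proof eventually_elim
    case (elim \<Omega>)
    then have "chart_inv c (dil \<Omega> q) \<in> topspace (top_of M)"
      using chart_topspace(1)[OF M P_c(1)[OF X]] chart_inv_left[OF M P_c(1)[OF X]] by (auto simp: flow_dom_def)
    then show ?case by (simp add: flow_rep_def \<Phi>_0)
  qed
  from Lim_transform_eventually[OF 1 this] P_trans[OF X X', of q] q
  show ?thesis using tendsto_unique[of "at_right (0::real)"] by (auto simp: trivial_limit_at_right_real)
qed

text \<open>Only the transverse block of the metric of \<open>M\<close> on the axis survives the
  rescaling. The dilation is linear, hence its own derivative, which turns the rescaled pullback
  into the expression of \<open>dil_limit_metric\<close>.\<close>

lemma local_metric_N:
  assumes X: "(J, c, d) \<in> P" and q: "q $ U \<in> J"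
  shows "x \<bullet> (local_metric N d q *v y) = rosen (local_metric M c (ax (q $ U))) x y"
proof -
  let ?g = "local_metric M c"
  have S: "open (snd c ` fst c)" by (rule chart_homeo(2)[OF M P_c(1)[OF X]])
  have a: "ax (q $ U) \<in> snd c ` fst c" using P_c(2)[OF X q] by (metis imageI)
  have td: "((\<lambda>\<Omega>. dil \<Omega> q) \<longlongrightarrow> ax (q $ U)) (at_right 0)" by (rule tendsto_dil[OF tendsto_const])
  have "isCont ?g (ax (q $ U))"
    using local_metric_continuous[OF X] S a continuous_on_eq_continuous_at by blast
  then have 1: "((\<lambda>\<Omega>. dil \<Omega> x \<bullet> (?g (dil \<Omega> q) *v dil \<Omega> y) / \<Omega>\<^sup>2) \<longlongrightarrow> rosen (?g (ax (q $ U))) x y) (at_right 0)"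
  proof (rule dil_limit_metric[OF _ td _ tendsto_const tendsto_const])
    show "\<forall>\<^sub>F \<Omega> in at_right 0. adapted_metric U V (?g (dil \<Omega> q))"
      using topological_tendstoD[OF td S a] by eventually_elim (rule local_metric_adapted[OF X])
  qed
  have "((\<lambda>\<Omega>. x \<bullet> ((1 / \<Omega>\<^sup>2) *\<^sub>R pullback_form (dil \<Omega>) ?g q *v y)) \<longlongrightarrow> x \<bullet> (local_metric N d q *v y)) (at_right 0)"
    unfolding matrix_vector_mult_def
    by (intro tendsto_inner tendsto_const vec_tendstoI)
      (simp only: vec_lambda_beta, intro tendsto_sum tendsto_mult tendsto_const
        tendsto_vec_nth[OF tendsto_vec_nth[OF P_limit[OF X q]]])
  moreover have "x \<bullet> ((1 / \<Omega>\<^sup>2) *\<^sub>R pullback_form (dil \<Omega>) ?g q *v y) = dil \<Omega> x \<bullet> (?g (dil \<Omega> q) *v dil \<Omega> y) / \<Omega>\<^sup>2" for \<Omega>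
  proof -
    have d: "(dil \<Omega> has_derivative dil \<Omega>) (at q)"
      using linear_dil by (simp add: bounded_linear_imp_has_derivative linear_conv_bounded_linear)
    have "x \<bullet> (pullback_form (dil \<Omega>) ?g q *v y) = dil \<Omega> x \<bullet> (?g (dil \<Omega> q) *v dil \<Omega> y)"
      using pullback_form_inner[of "dil \<Omega>" q x ?g y] d frechet_derivative_at[OF d]
      by (auto simp: differentiable_def)
    then show ?thesis by (simp add: scaleR_matrix_vector_assoc[symmetric])
  qed
  ultimately show ?thesis using tendsto_unique[OF _ _ 1] by (simp add: trivial_limit_at_right_real)
qed

lemma rosen_metric_N:
  assumes X: "(J, c, d) \<in> P"
  shows "rosen_metric (local_metric N d) (\<lambda>u. local_metric M c (ax u)) J"
  unfolding rosen_metric_def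
proof (intro conjI ballI allI impI)
  show "smooth_on (slab J) (local_metric N d)"
    using N P_chart[OF X] by (auto simp: lorentzian_manifold_def)
  fix u assume "u \<in> J"
  then have "ax u \<in> snd c ` fst c" using P_c(2)[OF X] by (metis imageI)
  then have ad: "adapted_metric U V (local_metric M c (ax u))" by (rule local_metric_adapted[OF X])
  then show "transpose (local_metric M c (ax u)) = local_metric M c (ax u)" by (simp add: adapted_metric_def)
  show "0 < w \<bullet> (local_metric M c (ax u) *v w)" if "Y w = w" "w \<noteq> 0" for w
    using ad Y_fixed_nth[OF that(1)] that(2) by (simp add: adapted_metric_def)
qed (use local_metric_N[OF X] in simp)

section \<open>The Penrose limit as a Rosen atlas\<close>

definition atlas :: "(real set \<times> ('b, 'm) chart) set" where
  "atlas = {(J, d). \<exists>c. (J, c, d) \<in> P}"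

lemma atlasI: "(J, c, d) \<in> P \<Longrightarrow> (J, d) \<in> atlas"
  unfolding atlas_def by blast

lemma P_inv:
  assumes X: "(J, c, d) \<in> P" and p: "p \<in> fst d"
  shows "chart_inv d (snd d p) = p" "snd d p $ U \<in> J"
  using chart_inv_left[OF N _ p] P_chart[OF X] p by auto

lemma trans_lim_rep:
  assumes X: "(J, c, d) \<in> P" and X': "(J', c', d') \<in> P" and p: "p \<in> fst d" "p \<in> fst d'"
  shows "snd d' p = lim_rep 0 c c' (snd d p)" "snd d p $ U \<in> J" "snd d p $ U \<in> J'"
proof -
  show *: "snd d p $ U \<in> J" "snd d p $ U \<in> J'" using P_inv[OF X p(1)] P_glue[OF X X'] p by auto
  show "snd d' p = lim_rep 0 c c' (snd d p)"
    using lim_rep_0[OF X X' *] P_inv(1)[OF X p(1)] by simp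
qed

lemma rosen_atlas: "rosen_atlas U V N I atlas"
proof unfold_locales
  show "lorentzian_manifold N" by (rule N)
  show "connected I" by (rule connected_I)
  show "(\<Union>(J, d)\<in>atlas. J) = I" unfolding P_I[symmetric] atlas_def by blast
  show "(\<Union>(J, d)\<in>atlas. fst d) = topspace (top_of N)" unfolding P_N[symmetric] atlas_def by blast
next
  fix J d assume "(J, d) \<in> atlas"
  then obtain c where X: "(J, c, d) \<in> P" by (auto simp: atlas_def)
  show "d \<in> charts N \<and> open J \<and> connected J \<and> snd d ` fst d = slab J"
    using P_chart[OF X] P_J[OF X] by simp
  show "\<exists>C. rosen_metric (local_metric N d) C J" using rosen_metric_N[OF X] by blast
next
  fix J d J' d' assume "(J, d) \<in> atlas" "(J', d') \<in> atlas"
  then obtain c c' where X: "(J, c, d) \<in> P" and X': "(J', c', d') \<in> P" by (auto simp: atlas_def)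
  show "fst d \<inter> fst d' = {p \<in> fst d. snd d p $ U \<in> J'}" by (rule P_glue[OF X X'])
  show "snd d' p $ U = snd d p $ U" if p: "p \<in> fst d" "p \<in> fst d'" for p
  proof -
    have "\<sigma> 0 (snd d p $ U) = snd d p $ U" using trans_lim_rep(2)[OF X X' p] P_J(3)[OF X] \<sigma>_0 by blast
    then show ?thesis
      using trans_lim_rep[OF X X' p] lim_rep_U[OF X X', of "snd d p" 0] by simp
  qed
  interpret axis_isometry U V "flow_dom 0 c c'" "snd c' ` fst c'" "local_metric M c" "local_metric M c'"
    "flow_rep 0 c c'" "{u \<in> J. \<sigma> 0 u \<in> J'}" "\<sigma> 0"
    by (rule axis_isometry_flow_rep[OF X X'])
  \<comment> \<open>Transitions of \<open>N\<close> are limits at time zero, whose transverse part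
    is linear by \<open>Y_lim_map\<close>.\<close>
  show "\<exists>T. \<forall>p. p \<in> fst d \<longrightarrow> p \<in> fst d' \<longrightarrow> linear (T (snd d p $ U)) \<and>
        Y (snd d' p) = T (snd d p $ U) (Y (snd d p))"
    using linear_lim_linear Y_lim_map trans_lim_rep(1)[OF X X']
    by (intro exI[of _ lim_linear]) (simp add: lim_rep_def)
qed

sublocale rosen_atlas U V N I atlas
  by (rule rosen_atlas)

section \<open>The limit flow on \<open>N\<close>\<close>

definition pick :: "real \<Rightarrow> real set \<times> ('a, 'm) chart \<times> ('b, 'm) chart" where
  "pick u = (SOME x. x \<in> P \<and> u \<in> fst x)"

lemma pick:
  assumes "u \<in> I"
  obtains J c d where "pick u = (J, c, d)" "(J, c, d) \<in> P" "u \<in> J"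
proof -
  obtain J c d where "(J, c, d) \<in> P" "u \<in> J" using P_at[OF assms] by blast
  then have "\<exists>x. x \<in> P \<and> u \<in> fst x" by (metis fst_conv)
  from someI_ex[OF this] have "pick u \<in> P \<and> u \<in> fst (pick u)" unfolding pick_def .
  then show ?thesis using that[of "fst (pick u)" "fst (snd (pick u))" "snd (snd (pick u))"] by simp
qed

definition lim_flow :: "real \<Rightarrow> 'b \<Rightarrow> 'b" where
  "lim_flow s p = (case pick (u_coord p) of (J, c, d) \<Rightarrow> case pick (\<sigma> s (u_coord p)) of (J', c', d') \<Rightarrow>
     chart_inv d' (lim_rep s c c' (snd d p)))"

text \<open>The picked patches do not matter: passing to other ones composes with limits at time
  zero, which \<open>lim_rep_compose\<close> absorbs, once on the target side and once on the source
  side.\<close>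

lemma lim_flow_eq:
  assumes p: "p \<in> topspace (top_of N)" and X: "(J, c, d) \<in> P" "u_coord p \<in> J"
    and X': "(J', c', d') \<in> P" "\<sigma> s (u_coord p) \<in> J'"
  shows "p \<in> fst d" "lim_flow s p \<in> fst d'" "snd d' (lim_flow s p) = lim_rep s c c' (snd d p)" "u_coord (lim_flow s p) = \<sigma> s (u_coord p)"
proof -
  have u: "u_coord p \<in> I" by (rule u_coord_in[OF p])
  obtain J1 c1 d1 where X1: "pick (u_coord p) = (J1, c1, d1)" "(J1, c1, d1) \<in> P" "u_coord p \<in> J1" using pick[OF u] .
  obtain J2 c2 d2 where X2: "pick (\<sigma> s (u_coord p)) = (J2, c2, d2)" "(J2, c2, d2) \<in> P" "\<sigma> s (u_coord p) \<in> J2"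
    using pick[OF \<sigma>_in] .
  have r: "lim_flow s p = chart_inv d2 (lim_rep s c1 c2 (snd d1 p))" by (simp add: lim_flow_def X1(1) X2(1))
  show pd: "p \<in> fst d" using patch_dom[OF atlasI[OF X(1)]] p X(2) by blast
  have pd1: "p \<in> fst d1" using patch_dom[OF atlasI[OF X1(2)]] p X1(3) by blast
  have Up: "snd d p $ U = u_coord p" "snd d1 p $ U = u_coord p"
    using u_coord_eq[OF atlasI[OF X(1)] pd] u_coord_eq[OF atlasI[OF X1(2)] pd1] by auto
  have G: "lim_rep s c1 c2 (snd d1 p) $ U = \<sigma> s (u_coord p)"
    using lim_rep_U[OF X1(2) X2(2)] Up X1(3) X2(3) by simp
  have rd2: "lim_flow s p \<in> fst d2" "snd d2 (lim_flow s p) = lim_rep s c1 c2 (snd d1 p)" "u_coord (lim_flow s p) = \<sigma> s (u_coord p)"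
    using patch_inv(2)[OF atlasI[OF X2(2)], of "lim_rep s c1 c2 (snd d1 p)"] G X2(3) unfolding r by auto
  then show "u_coord (lim_flow s p) = \<sigma> s (u_coord p)" by blast
  show rd': "lim_flow s p \<in> fst d'"
    using patch_dom[OF atlasI[OF X'(1)]] patch_dom[OF atlasI[OF X2(2)]] rd2 X'(2) by auto
  have "snd d' (lim_flow s p) = lim_rep 0 c2 c' (lim_rep s c1 c2 (snd d1 p))"
    using trans_lim_rep(1)[OF X2(2) X'(1) rd2(1) rd'] rd2(2) by simp
  also have "\<dots> = lim_rep s c1 c' (snd d1 p)"
    using lim_rep_compose[OF X1(2) X2(2) X'(1), of "snd d1 p" s 0] Up X1 X2 X' by simp
  also have "\<dots> = lim_rep s c1 c' (lim_rep 0 c c1 (snd d p))"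
    using trans_lim_rep(1)[OF X(1) X1(2) pd pd1] by simp
  also have "\<dots> = lim_rep s c c' (snd d p)"
    using lim_rep_compose[OF X(1) X1(2) X'(1), of "snd d p" 0 s] Up X X1 X' \<sigma>_0[OF u] by simp
  finally show "snd d' (lim_flow s p) = lim_rep s c c' (snd d p)" .
qed

lemma lim_flow_topspace:
  assumes "p \<in> topspace (top_of N)"
  shows "lim_flow s p \<in> topspace (top_of N)" "u_coord (lim_flow s p) = \<sigma> s (u_coord p)"
proof -
  obtain J c d where X: "(J, c, d) \<in> P" "u_coord p \<in> J" using P_at[OF u_coord_in[OF assms]] .
  obtain J' c' d' where X': "(J', c', d') \<in> P" "\<sigma> s (u_coord p) \<in> J'" using P_at[OF \<sigma>_in] .
  show "lim_flow s p \<in> topspace (top_of N)" "u_coord (lim_flow s p) = \<sigma> s (u_coord p)"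
    using lim_flow_eq[OF assms X X'] patch_dom[OF atlasI[OF X'(1)]] by auto
qed

text \<open>Times \<open>s\<close> and \<open>- s\<close> compose to time zero, and the time-zero
  limit from a patch to itself is the gluing of that patch with itself, the identity.\<close>

lemma lim_flow_inverse:
  assumes p: "p \<in> topspace (top_of N)"
  shows "lim_flow (- s) (lim_flow s p) = p"
proof -
  obtain J c d where X: "(J, c, d) \<in> P" "u_coord p \<in> J" using P_at[OF u_coord_in[OF p]] .
  obtain J' c' d' where X': "(J', c', d') \<in> P" "\<sigma> s (u_coord p) \<in> J'" using P_at[OF \<sigma>_in] .
  note 1 = lim_flow_eq[OF p X X']
  have u: "\<sigma> (- s) (u_coord (lim_flow s p)) = u_coord p" using 1(4) \<sigma>_add[of "- s" s] \<sigma>_0[OF u_coord_in[OF p]] by simp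
  have "u_coord (lim_flow s p) \<in> J'" "\<sigma> (- s) (u_coord (lim_flow s p)) \<in> J" using u 1(4) X(2) X'(2) by simp_all
  note 2 = lim_flow_eq[OF lim_flow_topspace(1)[OF p] X'(1) this(1) X(1) this(2)]
  have Up: "snd d p $ U = u_coord p" using u_coord_eq[OF atlasI[OF X(1)] 1(1)] by simp
  have "snd d (lim_flow (- s) (lim_flow s p)) = lim_rep (- s) c' c (lim_rep s c c' (snd d p))" using 1 2 by simp
  also have "\<dots> = lim_rep 0 c c (snd d p)"
    using lim_rep_compose[OF X(1) X'(1) X(1), of "snd d p" s "- s"] Up X X' \<sigma>_0[OF u_coord_in[OF p]] by simp
  also have "\<dots> = snd d p" using trans_lim_rep(1)[OF X(1) X(1) 1(1) 1(1)] by simp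
  finally show ?thesis
    using P_inv(1)[OF X(1) 1(1)] P_inv(1)[OF X(1) 2(2)] by simp
qed

text \<open>Between two patches the flow is \<open>lim_rep\<close>, which preserves the Rosen forms
  by \<open>lim_map_rosen\<close>; by \<open>local_metric_N\<close> these forms are the metric of
  \<open>N\<close>.\<close>

lemma lim_flow_locally_isometric: "locally_isometric N N (lim_flow s)"
proof (rule locally_isometricI[OF N N])
  fix p assume p: "p \<in> topspace (top_of N)"
  obtain J c d where X: "(J, c, d) \<in> P" "u_coord p \<in> J" using P_at[OF u_coord_in[OF p]] .
  obtain J' c' d' where X': "(J', c', d') \<in> P" "\<sigma> s (u_coord p) \<in> J'" using P_at[OF \<sigma>_in] .
  let ?K = "{u \<in> J. \<sigma> s u \<in> J'}"
  interpret axis: axis_isometry U V "flow_dom s c c'" "snd c' ` fst c'" "local_metric M c" "local_metric M c'"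
    "flow_rep s c c'" ?K "\<sigma> s"
    by (rule axis_isometry_flow_rep[OF X(1) X'(1)])
  have loc: "lim_flow s (chart_inv d q) \<in> fst d' \<and> snd d' (lim_flow s (chart_inv d q)) = lim_rep s c c' q" if "q \<in> slab ?K" for q
  proof -
    have q: "chart_inv d q \<in> fst d" "snd d (chart_inv d q) = q" "u_coord (chart_inv d q) = q $ U"
      using patch_inv(2)[OF atlasI[OF X(1)], of q] that by auto
    then have "chart_inv d q \<in> topspace (top_of N)" using patch_dom[OF atlasI[OF X(1)]] by blast
    from lim_flow_eq[OF this X(1) _ X'(1), of s] show ?thesis using q that by simp
  qed
  have "iso_on (slab ?K) (local_metric N d) (local_metric N d') (lim_rep s c c')"
  proof (rule iso_onI)
    show "smooth_on (slab ?K) (lim_rep s c c')" unfolding lim_rep_def by (rule axis.smooth_lim_map)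
    fix q x y assume q: "q \<in> slab ?K"
    then have "lim_rep s c c' q $ U = \<sigma> s (q $ U)" using lim_rep_U[OF X(1) X'(1)] by simp
    then show "frechet_derivative (lim_rep s c c') (at q) x \<bullet>
        (local_metric N d' (lim_rep s c c' q) *v frechet_derivative (lim_rep s c c') (at q) y) = x \<bullet> (local_metric N d q *v y)"
      using axis.lim_map_rosen[OF q, of x y] q local_metric_N[OF X(1), of q] local_metric_N[OF X'(1), of "lim_rep s c c' q"]
      by (simp add: lim_rep_def)
  qed
  then have "iso_on (slab ?K) (local_metric N d) (local_metric N d') (\<lambda>q. snd d' (lim_flow s (chart_inv d q)))"
    by (rule iso_on_cong) (use loc in simp)
  moreover have "p \<in> fst d" "snd d p \<in> slab ?K"
    using lim_flow_eq(1)[OF p X X'] u_coord_eq[OF atlasI[OF X(1)]] X X' by simp_all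
  moreover have "slab ?K \<subseteq> snd d ` fst d" using P_chart[OF X(1)] by auto
  ultimately show "\<exists>c\<in>charts N. \<exists>c'\<in>charts N. \<exists>W. p \<in> fst c \<and> snd c p \<in> W \<and> W \<subseteq> snd c ` fst c \<and>
      (\<forall>q\<in>W. lim_flow s (chart_inv c q) \<in> fst c') \<and>
      iso_on W (local_metric N c) (local_metric N c') (\<lambda>q. snd c' (lim_flow s (chart_inv c q)))"
    using loc P_chart[OF X(1)] P_chart[OF X'(1)]
    by (intro bexI[of _ d] bexI[of _ d'] exI[of _ "slab ?K"]) auto
qed

section \<open>Transitivity and connectedness of the limit\<close>

lemma transitive_N:
  assumes p: "p \<in> topspace (top_of N)" and q: "q \<in> topspace (top_of N)"
  shows "\<exists>f. isometry N N f \<and> f p = q"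
proof -
  \<comment> \<open>The flow brings \<open>p\<close> to the slice of \<open>q\<close>; an isometry
    preserving that slice completes the motion.\<close>
  obtain s where s: "\<sigma> s (u_coord p) = u_coord q" using \<sigma>_transitive[OF u_coord_in[OF q]] by blast
  note Fp = lim_flow_topspace[OF p, of s]
  obtain H H' where H: "locally_isometric N N H" "locally_isometric N N H'"
    "\<And>r. r \<in> topspace (top_of N) \<Longrightarrow> H' (H r) = r" "\<And>r. r \<in> topspace (top_of N) \<Longrightarrow> H (H' r) = r"
    "H (lim_flow s p) = q"
    using slice_transitive[OF Fp(1) q] Fp(2) s by metis
  have "isometry N N (\<lambda>r. H (lim_flow s r))"
  proof (rule isometry_if_locally_isometric[OF N N])
    show "locally_isometric N N (\<lambda>r. H (lim_flow s r))"
      by (rule locally_isometric_compose[OF N N N lim_flow_locally_isometric H(1)])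
    show "locally_isometric N N (\<lambda>r. lim_flow (- s) (H' r))"
      by (rule locally_isometric_compose[OF N N N H(2) lim_flow_locally_isometric])
    fix r assume r: "r \<in> topspace (top_of N)"
    show "lim_flow (- s) (H' (H (lim_flow s r))) = r" using H(3) lim_flow_topspace(1)[OF r] lim_flow_inverse[OF r] by simp
    have "H' r \<in> topspace (top_of N)" using H(2) r by (simp add: locally_isometric_def)
    then show "H (lim_flow s (lim_flow (- s) (H' r))) = r" using H(4)[OF r] lim_flow_inverse[of "H' r" "- s"] by simp
  qed
  then show ?thesis using H(5) by blast
qed

text \<open>A patch is a convex slab in its coordinates, hence connected; the set of parameters
  whose points are joined to \<open>p\<close> then spreads along the connected
  \<open>I\<close>.\<close>

lemma connected_N: "connected_space (top_of N)"
proof -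
  let ?X = "top_of N"
  have cc: "connected_component_of ?X p q" if A: "(J, d) \<in> atlas" and pq: "p \<in> fst d" "q \<in> fst d" for J d p q
  proof -
    have d: "d \<in> charts N" "snd d ` fst d = slab J" "connected J" using patch[OF A] by auto
    have "convex J" using d(3) is_interval_convex is_interval_connected_1 by blast
    then have "convex (slab J)"
      using convex_linear_vimage[OF bounded_linear.linear[OF bounded_linear_vec_nth[of U]], of J]
      by (simp add: vimage_def)
    then have "connected_space (top_of_set (snd d ` fst d))"
      using d(2) connectedin_iff_connected[of "slab J"]
      by (simp add: convex_connected connectedin_def)
    then have "connected_space (subtopology ?X (fst d))"
      using homeomorphic_connected_space[OF homeomorphic_map_imp_homeomorphic_space[OF chart_homeo(3)[OF N d(1)]]] by blast
    then have "connectedin ?X (fst d)"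
      using chart_topspace(1)[OF N d(1)] by (simp add: connectedin_def)
    then show ?thesis using pq unfolding connected_component_of_def by blast
  qed
  have "connected_component_of ?X p q" if p: "p \<in> topspace ?X" and q: "q \<in> topspace ?X" for p q
  proof -
    define Q where "Q t \<longleftrightarrow> (\<forall>r\<in>topspace ?X. u_coord r = t \<longrightarrow> connected_component_of ?X p r)" for t
    have "Q (u_coord q)"
    proof (rule connected_induction_simple[OF connected_I u_coord_in[OF p] u_coord_in[OF q]])
      obtain J d where A: "(J, d) \<in> atlas" "u_coord p \<in> J" using patch_at[OF u_coord_in[OF p]] .
      then show "Q (u_coord p)" unfolding Q_def using cc[OF A(1)] patch_dom[OF A(1)] p by metis
      fix a assume "a \<in> I"
      then obtain J d where A: "(J, d) \<in> atlas" "a \<in> J" using patch_at by blast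
      have "Q y" if xy: "x \<in> J" "y \<in> J" and x: "Q x" for x y
        unfolding Q_def
      proof (intro ballI impI)
        fix r assume r: "r \<in> topspace ?X" "u_coord r = y"
        \<comment> \<open>Any point of the patch over \<open>x\<close> links the points over
          \<open>x\<close> with those over \<open>y\<close>; the one on the axis is at hand.\<close>
        let ?z = "chart_inv d (ax x)"
        have z: "?z \<in> fst d" "u_coord ?z = x" using patch_inv(2)[OF A(1), of "ax x"] xy by auto
        then have "connected_component_of ?X p ?z" using x patch_dom[OF A(1)] unfolding Q_def by blast
        moreover have "connected_component_of ?X ?z r"
          using cc[OF A(1) z(1)] patch_dom[OF A(1)] r xy by blast
        ultimately show "connected_component_of ?X p r" by (rule connected_component_of_trans)
      qed
      moreover have "openin (top_of_set I) J"
        using patch[OF A(1)] A cover_I by (intro open_subset) auto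
      ultimately show "\<exists>T. openin (top_of_set I) T \<and> a \<in> T \<and> (\<forall>x\<in>T. \<forall>y\<in>T. Q x \<longrightarrow> Q y)"
        using A(2) by blast
    qed
    then show ?thesis using q unfolding Q_def by blast
  qed
  then show ?thesis by (simp add: connected_space_iff_connected_component)
qed

lemma homogeneous_N: "homogeneous N"
  unfolding homogeneous_def using connected_N transitive_N by blast

end

theorem theorem21:
  fixes M :: "('a, 'm::finite) metric_mfd" and N :: "('b, 'm) metric_mfd"
    and \<gamma> :: "real \<Rightarrow> 'a" and I :: "real set" and U V :: 'm
  assumes "U \<noteq> V"
    and "lorentzian_manifold M"
    and "null_geodesic M \<gamma> I"
    and "homogeneous_geodesic M \<gamma> I"
    and "penrose_limit U V M \<gamma> I N"
  shows "homogeneous N"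
proof -
  interpret null_frame U V by unfold_locales (rule assms(1))
  obtain \<Phi> \<tau> where \<Phi>: "one_parameter_isometries M \<Phi>" "smooth_on UNIV \<tau>" "\<And>s. deriv \<tau> s \<noteq> 0" "range \<tau> = I"
    "\<And>s. \<gamma> (\<tau> s) = \<Phi> s (\<gamma> (\<tau> 0))"
    using assms(4) unfolding homogeneous_geodesic_def by blast
  obtain P where N: "lorentzian_manifold N"
    and P: "(\<Union>(J, c, d)\<in>P. J) = I" "(\<Union>(J, c, d)\<in>P. fst d) = topspace (top_of N)"
    and P1: "\<forall>(J, c, d)\<in>P. adapted_chart U V M \<gamma> J c \<and> d \<in> charts N \<and> snd d ` fst d = {q. q $ U \<in> J} \<and>
           (\<forall>q. q $ U \<in> J \<longrightarrow>
              ((\<lambda>\<Omega>. (1 / \<Omega>\<^sup>2) *\<^sub>R pullback_form (dilate U V \<Omega>) (local_metric M c) q)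
                 \<longlongrightarrow> local_metric N d q) (at_right 0))"
    and P2: "\<forall>(J, c, d)\<in>P. \<forall>(J', c', d')\<in>P.
           fst d \<inter> fst d' = {p \<in> fst d. snd d p $ U \<in> J'} \<and>
           (\<forall>q. q $ U \<in> J \<inter> J' \<longrightarrow>
              ((\<lambda>\<Omega>. dilate U V (1 / \<Omega>)
                     (snd c' (inv_into (fst c) (snd c) (dilate U V \<Omega> q))))
                 \<longlongrightarrow> snd d' (inv_into (fst d) (snd d) q)) (at_right 0))"
    using assms(5) unfolding penrose_limit_def by (elim conjE exE) (rule that)
  interpret homogeneous_penrose U V M N \<gamma> I \<Phi> \<tau> P
  proof unfold_locales
    show "(J, c, d) \<in> P \<Longrightarrow> adapted_chart U V M \<gamma> J c \<and> d \<in> charts N \<and> snd d ` fst d = slab J" for J c d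
      by (drule_tac bspec[OF P1]) (simp only: prod.case)
    show "(J, c, d) \<in> P \<Longrightarrow> q $ U \<in> J \<Longrightarrow>
      ((\<lambda>\<Omega>. (1 / \<Omega>\<^sup>2) *\<^sub>R pullback_form (dil \<Omega>) (local_metric M c) q) \<longlongrightarrow> local_metric N d q) (at_right 0)" for J c d q
      by (drule_tac bspec[OF P1]) (simp only: prod.case)
    show "(J, c, d) \<in> P \<Longrightarrow> (J', c', d') \<in> P \<Longrightarrow> fst d \<inter> fst d' = {p \<in> fst d. snd d p $ U \<in> J'}" for J c d J' c' d'
      by (drule_tac bspec[OF P2], unfold prod.case, drule_tac bspec, assumption) (simp only: prod.case)
    show "(J, c, d) \<in> P \<Longrightarrow> (J', c', d') \<in> P \<Longrightarrow> q $ U \<in> J \<inter> J' \<Longrightarrow>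
      ((\<lambda>\<Omega>. dil (1 / \<Omega>) (snd c' (chart_inv c (dil \<Omega> q)))) \<longlongrightarrow> snd d' (chart_inv d q)) (at_right 0)"
      for J c d J' c' d' q
      by (drule_tac bspec[OF P2], unfold prod.case, drule_tac bspec, assumption) (simp only: prod.case)
  qed (rule assms(2) N \<Phi> P)+
  show ?thesis by (rule homogeneous_N)
qed

end
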